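(* Let $d\ge1$, $\sigma>0$, $\omega_0\in\mathbb{R}\setminus\{0\}$, $z_0>0$, $\Omega\in\mathbb{R}\setminus\{0\}$. When $\Sigma=\sigma^2\mathbb{I}_d$ and the source is the plane wave $u^\varepsilon(z=0)=1$, the limiting two-point correlation $$m_{1,1}(h,\tau;\Omega)=\Big(\frac{\omega_0}{2\pi ih}\Big)^{d/2}\int_{\mathbb{R}^d}M_{1,1}(z_0,\tau-\tau')e^{\frac{i\omega_0}{2h}|\tau'|^2}d\tau',\qquad h\in\mathbb{R}\setminus\{0\},\ \tau\in\mathbb{R}^d,$$ is given by $$m_{1,1}(h,\tau;\Omega)=\Big(\frac{\omega_0}{2ih\mathfrak b}\Big)^{d/2}e^{-a(z_0)}\,e^{-\frac{\omega_0^2\mathfrak b_R|\tau|^2}{4h^2|\mathfrak b|^2}}\,e^{\frac{i\omega_0|\tau|^2}{2h}\left(1+\frac{\omega_0\mathfrak b_I}{2h|\mathfrak b|^2}\right)},$$ where $$a(z_0)=\frac12\log[\cosh(\alpha_\Omega z_0)],\quad b(z_0)=\frac{\omega_0^2\sigma^2}{8\alpha_\Omega}\tanh(\alpha_\Omega z_0),\quad\alpha_\Omega=e^{i\pi/4}\sqrt{\frac{\sigma^2\Omega}4},$$ $\mathfrak b=b_R+i\big(b_I-\frac{\omega_0}{2h}\big)$, $b_R=\mathrm{Re}\,b(z_0)$, $b_I=\mathrm{Im}\,b(z_0)$, $\mathfrak b_R=\mathrm{Re}\,\mathfrak b$, $\mathfrak b_I=\mathrm{Im}\,\mathfrak b$.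 Moreover, for fixed $\Omega$, expanding $a$ and $b$ for small values of $\alpha_\Omega z_0$ gives that a choice of $h=-\frac{z_0\Omega}{3\omega_0}$ leads to larger correlations at $\tau=0$, a reflection of the chromato-axial memory effect in this regime.
   Context: For the plane wave source $u_0=1$ (and no tilt), $M_{1,1}(z,\tau)$ is the solution, independent of the macroscopic lateral variable $r$, of $$\partial_zM_{1,1}=\frac{i\Omega}{2\omega_0^2}\Delta_\tau M_{1,1}+\frac i{\omega_0}\partial_r\cdot\partial_\tau M_{1,1}-\frac{\omega_0^2\sigma^2}8|\tau|^2M_{1,1},\qquad M_{1,1}(0,\tau)=1$$ (the mixed term vanishes). The function $m_{1,1}$ is the $\varepsilon\to0$ limiting correlation of the rescaled wavefield $u^\varepsilon(z_0+\varepsilon\eta h_j,\varepsilon^{-1}r+\eta x_j;\omega_0+\varepsilon\eta\Omega_j)$ at two parameter values, with $h=h_1-h_2$, $\tau=x_1-x_2$, $\Omega=\Omega_2-\Omega_1$ and $\eta=(\log|\log\varepsilon|)^{-1}$. Here $u^\varepsilon$ solves the Itô–Schrödinger equation $du^\varepsilon=\frac{i\eta}{2\varepsilon\omega}\Delta_xu^\varepsilon dz-\frac{\omega^2R(0)}{8\eta^2}u^\varepsilon dz+\frac{i\omega}{2\eta}u^\varepsilon dB$, where $B$ is a real mean-zero Gaussian field with covariance $\min(z_1,z_2)R(x_1-x_2)$ and $-\nabla^2R(0)=\Sigma$. The size of the correlation at $\tau=0$ is measured by $|m_{1,1}(h,0;\Omega)|$ as a function of the axial shift $h$; the value $-\frac{z_0\Omega}{3\omega_0}$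 is the approximation, for small $|\alpha_\Omega z_0|$, of the optimal shift. Powers $(\cdot)^{d/2}$ are principal; the logarithm in $a$ is the branch continuous in $z_0$ and vanishing at $z_0=0$; $\sqrt{\sigma^2\Omega/4}$ is any fixed square root.
   Formalization: The factor e^{-a(z_0)} is corrected to e^{-d a(z_0)}: the moment equation gives M_{1,1}(z_0,0)=cosh(α_Ω z_0)^{-d/2}, so the printed formula is false for every d≥2; for d=1 the two agree. "The solution" M_{1,1} is taken as the bounded classical one. *)

theory Defs
  imports "HOL-Analysis.Analysis"
begin

text \<open>The lateral space \<open>\<real>\<^sup>d\<close> is an arbitrary type \<^typ>\<open>'a::euclidean_space\<close>, with
  \<open>d = DIM('a)\<close>, which is at least \<open>1\<close>.\<close>

definition dir_deriv :: "('a::euclidean_space \<Rightarrow> complex) \<Rightarrow> 'a \<Rightarrow> 'a \<Rightarrow> complex" where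
  "dir_deriv f u x = vector_derivative (\<lambda>t. f (x + t *\<^sub>R u)) (at 0)"

definition laplacian :: "('a::euclidean_space \<Rightarrow> complex) \<Rightarrow> 'a \<Rightarrow> complex" where
  "laplacian f x = (\<Sum>u\<in>Basis. dir_deriv (dir_deriv f u) u x)"

text \<open>Continuity up to \<open>z = 0\<close>, and for \<open>z > 0\<close> partial derivatives in \<open>\<tau>\<close> of order at most two
  that exist and are jointly continuous.  The differentiability clauses are needed because
  \<^const>\<open>vector_derivative\<close> is an unspecified value where no derivative exists.
  The derivative in \<open>z\<close> is imposed by the equation itself.\<close>

definition classical_regularity :: "(real \<Rightarrow> 'a::euclidean_space \<Rightarrow> complex) \<Rightarrow> bool" where
  "classical_regularity M \<longleftrightarrow>
     continuous_on ({0..} \<times> UNIV) (\<lambda>(z, \<tau>). M z \<tau>) \<and>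
     (\<forall>u\<in>Basis.
        (\<forall>z>0. \<forall>\<tau>. (\<lambda>t. M z (\<tau> + t *\<^sub>R u)) differentiable (at 0)) \<and>
        continuous_on ({0<..} \<times> UNIV) (\<lambda>(z, \<tau>). dir_deriv (M z) u \<tau>) \<and>
        (\<forall>v\<in>Basis.
           (\<forall>z>0. \<forall>\<tau>. (\<lambda>t. dir_deriv (M z) u (\<tau> + t *\<^sub>R v)) differentiable (at 0)) \<and>
           continuous_on ({0<..} \<times> UNIV) (\<lambda>(z, \<tau>). dir_deriv (dir_deriv (M z) u) v \<tau>)))"

text \<open>\<open>M11_solution \<omega>0 \<sigma> \<Omega> M\<close>: \<open>M\<close> is the solution \<open>M\<^sub>1\<^sub>,\<^sub>1(z,\<tau>)\<close> of the moment equation for the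
  plane wave source.  As it does not depend on the macroscopic variable \<open>r\<close>, that variable and
  the mixed term \<open>\<partial>\<^sub>r \<cdot> \<partial>\<^sub>\<tau>\<close> are absent.  Boundedness (on bounded ranges of \<open>z\<close>) is what singles
  out \<^emph>\<open>the\<close> solution: \<open>M\<close> is a correlation function of a plane wave.  Only values at
  \<open>z \<ge> 0\<close> are constrained.\<close>

definition M11_solution ::
    "real \<Rightarrow> real \<Rightarrow> real \<Rightarrow> (real \<Rightarrow> 'a::euclidean_space \<Rightarrow> complex) \<Rightarrow> bool" where
  "M11_solution \<omega>0 \<sigma> \<Omega> M \<longleftrightarrow>
     classical_regularity M \<and>
     (\<forall>Z. \<exists>C. \<forall>z\<in>{0..Z}. \<forall>\<tau>. norm (M z \<tau>) \<le> C) \<and>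
     (\<forall>\<tau>. M 0 \<tau> = 1) \<and>
     (\<forall>z>0. \<forall>\<tau>. ((\<lambda>s. M s \<tau>) has_vector_derivative
          (\<i> * of_real \<Omega> / (2 * of_real (\<omega>0\<^sup>2)) * laplacian (M z) \<tau>
            - of_real (\<omega>0\<^sup>2 * \<sigma>\<^sup>2 / 8 * (norm \<tau>)\<^sup>2) * M z \<tau>)) (at z))"

text \<open>Complex \<open>powr\<close> is the principal power.\<close>

definition m11 ::
    "real \<Rightarrow> (real \<Rightarrow> 'a::euclidean_space \<Rightarrow> complex) \<Rightarrow> real \<Rightarrow> real \<Rightarrow> 'a \<Rightarrow> complex" where
  "m11 \<omega>0 M z0 h \<tau> =
     (of_real \<omega>0 / (2 * of_real pi * \<i> * of_real h)) powr (of_nat DIM('a) / 2) *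
     (LINT \<tau>'|lborel. M z0 (\<tau> - \<tau>') * exp (\<i> * of_real \<omega>0 / (2 * of_real h) * of_real ((norm \<tau>')\<^sup>2)))"

text \<open>The argument \<open>s\<close> stands for the chosen square root of \<open>\<sigma>\<^sup>2\<Omega>/4\<close> (imaginary if \<open>\<Omega> < 0\<close>).\<close>

definition alpha :: "complex \<Rightarrow> complex" where
  "alpha s = exp (\<i> * of_real pi / 4) * s"

text \<open>The continuous branch of \<open>log (cosh (\<alpha> z))\<close> vanishing at \<open>z = 0\<close>.  It exists and is unique
  for the \<open>\<alpha>\<close> used here, because \<open>\<alpha>\<^sup>2\<close> is nonzero and purely imaginary and hence \<open>cosh (\<alpha> z)\<close>
  has no real zero \<open>z\<close>; it need not be the principal logarithm.\<close>

definition log_cosh :: "complex \<Rightarrow> real \<Rightarrow> complex" where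
  "log_cosh \<alpha> = (THE L. continuous_on UNIV L \<and> L 0 = 0 \<and> (\<forall>z. exp (L z) = cosh (\<alpha> * of_real z)))"

text \<open>The solution is \<open>M\<^sub>1\<^sub>,\<^sub>1(z,\<tau>) = exp (- d a(z) - b(z) \<bar>\<tau>\<bar>\<^sup>2)\<close>: the equation separates into \<open>d\<close>
  one-dimensional ones, each contributing \<open>exp (- a)\<close>.  Hence \<open>a\<close> enters the correlation with
  the factor \<open>d\<close>.\<close>

definition coeff_a :: "complex \<Rightarrow> real \<Rightarrow> complex" where
  "coeff_a \<alpha> z0 = log_cosh \<alpha> z0 / 2"

definition coeff_b :: "real \<Rightarrow> real \<Rightarrow> complex \<Rightarrow> real \<Rightarrow> complex" where
  "coeff_b \<omega>0 \<sigma> \<alpha> z0 = of_real (\<omega>0\<^sup>2 * \<sigma>\<^sup>2) / (8 * \<alpha>) * tanh (\<alpha> * of_real z0)"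

definition frak_b :: "real \<Rightarrow> real \<Rightarrow> complex \<Rightarrow> real \<Rightarrow> real \<Rightarrow> complex" where
  "frak_b \<omega>0 \<sigma> \<alpha> z0 h =
     Complex (Re (coeff_b \<omega>0 \<sigma> \<alpha> z0)) (Im (coeff_b \<omega>0 \<sigma> \<alpha> z0) - \<omega>0 / (2 * h))"

text \<open>\<open>strict_max_shift C h1\<close>: \<open>h1\<close> is the unique maximiser of \<open>C\<close> over nonzero axial shifts.\<close>

definition strict_max_shift :: "(real \<Rightarrow> real) \<Rightarrow> real \<Rightarrow> bool" where
  "strict_max_shift C h1 \<longleftrightarrow> h1 \<noteq> 0 \<and> (\<forall>h. h \<noteq> 0 \<longrightarrow> h \<noteq> h1 \<longrightarrow> C h < C h1)"

end

theory Submission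
  imports Defs "HOL-Probability.Distributions"
begin

text \<open>A Gaussian \<open>exp (- A \<bar>\<tau>\<bar>\<^sup>2 + 2 B p \<bullet> \<tau> + C)\<close> stays Gaussian under the moment equation, with \<open>A\<close> solving
  a Riccati equation.  Starting from \<open>1\<close> this gives \<open>exp (- d a - b \<bar>\<tau>\<bar>\<^sup>2)\<close>.  Uniqueness among bounded
  solutions is by duality: a solution \<open>M\<close> is paired with a Gaussian evolving backwards from
  \<open>exp (- N \<bar>\<tau> - p\<bar>\<^sup>2)\<close> at \<open>z = T\<close>, and the pairing is conserved up to a cutoff error, so that the
  integrals of \<open>M T\<close> against all these Gaussians are determined; let \<open>N \<rightarrow> \<infinity>\<close>.  The correlation is then
  a complex Gaussian integral.  At \<open>\<tau> = 0\<close> its modulus is a decreasing function of \<open>\<bar>h \<bb>\<bar>\<^sup>2\<close>, a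
  quadratic polynomial in \<open>h\<close> with minimum at \<open>\<omega>\<^sub>0 b\<^sub>I / (2 \<bar>b\<bar>\<^sup>2)\<close>, which is close to
  \<open>- z\<^sub>0 \<Omega> / (3 \<omega>\<^sub>0)\<close> by the expansion of \<open>b\<close>.\<close>

section \<open>Gaussian integrals\<close>

text \<open>The obstacle is uniqueness. A solution is bounded but starts as the constant
  \<open>1\<close>, so \<open>L\<^sup>2\<close> energy estimates do not apply to it, and nothing
  bounds the growth of its \<open>\<tau>\<close>-derivatives. In the pairing every derivative is
  therefore moved to the explicit factor, a Gaussian times a compactly supported cutoff. The pairing
  is without complex conjugation: the dual equation read backwards in \<open>z\<close> is then the
  moment equation itself, damping included, so that one Riccati system serves for the solution
  (\<open>N = 0\<close>) and for the test Gaussians (\<open>N > 0\<close>). Its denominators do not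
  vanish because \<open>K\<close> is imaginary and \<open>\<gamma> > 0\<close>; for
  \<open>N = 0\<close> this says that \<open>cosh (\<alpha> z)\<close> has no real zero, so that the
  logarithm in \<open>a\<close> exists. The shift
  \<open>- z\<^sub>0 \<Omega> / (3 \<omega>\<^sub>0)\<close> comes from the cubic term of
  \<open>tanh\<close>: with \<open>w = \<alpha> z\<^sub>0\<close> the square
  \<open>w\<^sup>2\<close> is imaginary, so the leading term of \<open>b\<close> is real and
  \<open>b\<^sub>I\<close> begins with the correction \<open>- w\<^sup>2 / 3\<close>.\<close>

lemma has_vector_derivative_lebesgue_integral:
  fixes f :: "real \<Rightarrow> 'c \<Rightarrow> 'b::{banach, second_countable_topology}"
  assumes t: "t \<in> {a..b}"
    and int: "\<And>s. s \<in> {a..b} \<Longrightarrow> integrable M (f s)"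
    and deriv: "\<And>s x. s \<in> {a..b} \<Longrightarrow> ((\<lambda>s. f s x) has_vector_derivative f' s x) (at s within {a..b})"
    and bound: "\<And>s x. s \<in> {a..b} \<Longrightarrow> norm (f' s x) \<le> g x"
    and g: "integrable M g"
  shows "((\<lambda>s. LINT x|M. f s x) has_vector_derivative (LINT x|M. f' t x)) (at t within {a..b})"
proof -
  define q where "q y x = (f y x - f t x) /\<^sub>R (y - t)" for y x
  have quot: "((\<lambda>y. q y x) \<longlongrightarrow> f' t x) (at t within {a..b})" for x
  proof -
    have "((\<lambda>y. norm ((f y x - f t x) - (y - t) *\<^sub>R f' t x) / norm (y - t)) \<longlongrightarrow> 0) (at t within {a..b})"
      using deriv[OF t, of x] unfolding has_vector_derivative_def has_derivative_iff_norm by blast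
    moreover have "\<forall>\<^sub>F y in at t within {a..b}.
        norm ((f y x - f t x) - (y - t) *\<^sub>R f' t x) / norm (y - t) = norm (q y x - f' t x)"
      unfolding eventually_at_filter
    proof (rule always_eventually, intro allI impI)
      fix y assume "y \<noteq> t"
      then have "q y x - f' t x = ((f y x - f t x) - (y - t) *\<^sub>R f' t x) /\<^sub>R (y - t)"
        unfolding q_def by (simp add: scaleR_diff_right)
      then show "norm ((f y x - f t x) - (y - t) *\<^sub>R f' t x) / norm (y - t) = norm (q y x - f' t x)"
        by (simp add: divide_inverse mult.commute)
    qed
    ultimately have "((\<lambda>y. norm (q y x - f' t x)) \<longlongrightarrow> 0) (at t within {a..b})"
      by (simp only: tendsto_cong)
    then show ?thesis
      using Lim_null tendsto_norm_zero_iff by blast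
  qed
  \<comment> \<open>By the mean value inequality the bound on the derivative also bounds the
    difference quotients, so \<open>g\<close> dominates them.\<close>
  have q_bound: "norm (q y x) \<le> g x" if "y \<in> {a..b} - {t}" for y x
  proof -
    have "norm (f y x - f t x) \<le> g x * norm (y - t)"
    proof (rule differentiable_bound[of "{a..b}" "\<lambda>s. f s x" "\<lambda>s h. h *\<^sub>R f' s x"])
      show "((\<lambda>s. f s x) has_derivative (\<lambda>h. h *\<^sub>R f' s x)) (at s within {a..b})" if "s \<in> {a..b}" for s
        using deriv[OF that] by (simp add: has_vector_derivative_def)
      show "onorm (\<lambda>h. h *\<^sub>R f' s x) \<le> g x" if "s \<in> {a..b}" for s
      proof (rule onorm_bound)
        show "0 \<le> g x" using bound[OF that, of x] norm_ge_zero order_trans by blast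
        show "norm (h *\<^sub>R f' s x) \<le> g x * norm h" for h
          using bound[OF that, of x] by (simp add: mult.commute mult_left_mono)
      qed
    qed (use that t in auto)
    moreover have "norm (q y x) = norm (f y x - f t x) / \<bar>y - t\<bar>"
      unfolding q_def by (simp add: divide_inverse mult.commute)
    ultimately show ?thesis
      using that by (simp add: pos_divide_le_eq)
  qed
  have meas: "f s \<in> borel_measurable M" if "s \<in> {a..b}" for s
    using int[OF that] by auto
  have lim: "((\<lambda>y. (LINT x|M. q y x)) \<longlongrightarrow> (LINT x|M. f' t x)) (at t within {a..b})" if ne: "a < b"
    unfolding tendsto_at_iff_sequentially comp_def
  proof (intro allI impI)
    fix X assume X: "\<forall>i. X i \<in> {a..b} - {t}" "X \<longlonglongrightarrow> t"
    have seq: "(\<lambda>i. q (X i) x) \<longlonglongrightarrow> f' t x" for x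
      using quot[of x] X unfolding tendsto_at_iff_sequentially comp_def by blast
    have qm: "q (X i) \<in> borel_measurable M" for i
      using meas[of "X i"] meas[OF t] X unfolding q_def by auto
    \<comment> \<open>The derivative inherits measurability as a pointwise limit of difference
      quotients.\<close>
    have f'm: "f' t \<in> borel_measurable M"
      by (rule borel_measurable_LIMSEQ_metric[OF qm seq])
    show "(\<lambda>i. LINT x|M. q (X i) x) \<longlonglongrightarrow> (LINT x|M. f' t x)"
      by (rule integral_dominated_convergence[OF f'm qm g]) (use seq q_bound X in auto)
  qed
  have main: "((\<lambda>y. norm (((LINT x|M. f y x) - (LINT x|M. f t x)) - (y - t) *\<^sub>R (LINT x|M. f' t x)) / norm (y - t)) \<longlongrightarrow> 0)
     (at t within {a..b})"
  proof (cases "a < b")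
    case True
    have l: "((\<lambda>y. norm ((LINT x|M. q y x) - (LINT x|M. f' t x))) \<longlongrightarrow> 0) (at t within {a..b})"
      by (rule tendsto_norm_zero, rule LIM_zero, rule lim[OF True])
    have "\<forall>\<^sub>F y in at t within {a..b}.
        norm ((LINT x|M. q y x) - (LINT x|M. f' t x)) =
        norm (((LINT x|M. f y x) - (LINT x|M. f t x)) - (y - t) *\<^sub>R (LINT x|M. f' t x)) / norm (y - t)"
      unfolding eventually_at_filter
    proof (rule always_eventually, intro allI impI)
      fix y assume y: "y \<noteq> t" "y \<in> {a..b}"
      have "(LINT x|M. q y x) = ((LINT x|M. f y x) - (LINT x|M. f t x)) /\<^sub>R (y - t)"
        unfolding q_def using int[OF y(2)] int[OF t] by simp
      then have "(LINT x|M. q y x) - (LINT x|M. f' t x)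
          = (((LINT x|M. f y x) - (LINT x|M. f t x)) - (y - t) *\<^sub>R (LINT x|M. f' t x)) /\<^sub>R (y - t)"
        using y by (simp add: scaleR_diff_right)
      then show "norm ((LINT x|M. q y x) - (LINT x|M. f' t x)) =
        norm (((LINT x|M. f y x) - (LINT x|M. f t x)) - (y - t) *\<^sub>R (LINT x|M. f' t x)) / norm (y - t)"
        by (simp add: divide_inverse mult.commute)
    qed
    from Lim_transform_eventually[OF l this] show ?thesis .
  next
    \<comment> \<open>A one-point interval, for which the filter is trivial.\<close>
    case False
    with t have "{a..b} = {t}" by auto
    then show ?thesis by (simp add: at_within_def)
  qed
  then show ?thesis
    unfolding has_vector_derivative_def has_derivative_iff_norm
    by (simp add: bounded_linear_scaleR_left)
qed

text \<open>The polynomial is absorbed by \<open>(1 + r)\<^sup>2 \<le> exp (2 * r)\<close>, and the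
  resulting linear exponent by half of \<open>a * r\<^sup>2\<close>: the constant is the maximum of
  \<open>(\<beta> + 2) * r - (a / 2) * r\<^sup>2\<close>.\<close>

lemma quadratic_le_gaussian:
  fixes a \<beta> r :: real
  assumes a: "a > 0" and r: "r \<ge> 0"
  shows "(1 + r)\<^sup>2 * exp (\<beta> * r - a * r\<^sup>2) \<le> exp ((\<beta> + 2)\<^sup>2 / (2 * a)) * exp (- (a / 2) * r\<^sup>2)"
proof -
  have "(1 + r)\<^sup>2 \<le> exp (2 * r)"
    using power_mono[OF exp_ge_add_one_self[of r], of 2] r by (simp add: exp_double)
  then have "(1 + r)\<^sup>2 * exp (\<beta> * r - a * r\<^sup>2) \<le> exp (2 * r) * exp (\<beta> * r - a * r\<^sup>2)"
    by (rule mult_right_mono) simp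
  also have "\<dots> = exp (2 * r + (\<beta> * r - a * r\<^sup>2))" by (simp add: exp_add)
  also have "\<dots> \<le> exp ((\<beta> + 2)\<^sup>2 / (2 * a) + - (a / 2) * r\<^sup>2)"
  proof -
    have "0 \<le> (a * r - (\<beta> + 2))\<^sup>2 / (2 * a)" using a by simp
    also have "\<dots> = (\<beta> + 2)\<^sup>2 / (2 * a) + (a / 2) * r\<^sup>2 - (\<beta> + 2) * r"
      using a by (simp add: field_simps power2_eq_square)
    finally show ?thesis by (simp add: algebra_simps)
  qed
  also have "\<dots> = exp ((\<beta> + 2)\<^sup>2 / (2 * a)) * exp (- (a / 2) * r\<^sup>2)" by (rule exp_add)
  finally show ?thesis .
qed

lemma integrable_gaussian_real:
  fixes a :: real
  assumes a: "a > 0"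
  shows "integrable lborel (\<lambda>x. exp (- a * x\<^sup>2))"
proof -
  define s where "s = sqrt (1 / (2 * a))"
  have s: "2 * s\<^sup>2 = 1 / a" and "s > 0"
    using a by (simp_all add: s_def)
  have e: "exp (- a * x\<^sup>2) = sqrt (2 * pi * s\<^sup>2) * normal_density 0 s x" for x
  proof -
    have "sqrt (2 * pi * s\<^sup>2) \<noteq> 0" using \<open>s > 0\<close> by simp
    moreover have "- (x - 0)\<^sup>2 / (2 * s\<^sup>2) = - a * x\<^sup>2"
      unfolding s using a by simp
    ultimately show ?thesis
      unfolding normal_density_def by simp
  qed
  show ?thesis
    unfolding e by (rule integrable_mult_right, rule integrable_normal_density[OF \<open>s > 0\<close>])
qed

lemma integral_gaussian_real: "(LINT x|lborel. exp (- x\<^sup>2)) = sqrt pi"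
proof -
  define s :: real where "s = sqrt (1 / 2)"
  have s: "s\<^sup>2 = 1 / 2" and "s > 0" unfolding s_def by simp_all
  have e: "exp (- x\<^sup>2) = sqrt pi * normal_density 0 s x" for x :: real
    unfolding normal_density_def s by simp
  have "(LINT x|lborel. sqrt pi * normal_density 0 s x) = sqrt pi * 1"
    by (subst integral_mult_right_zero, subst integral_normal_density[OF \<open>s > 0\<close>], rule refl)
  then show ?thesis
    unfolding e by (simp only: mult_1_right)
qed

text \<open>Lebesgue measure on \<open>'a\<close> is the image of a product of one-dimensional
  Lebesgue measures under the coordinate map, so this is Fubini for a product of functions of one
  coordinate each.\<close>

lemma
  fixes f :: "'a::euclidean_space \<Rightarrow> real \<Rightarrow> 'b::{real_normed_field, banach, second_countable_topology}"
  assumes f: "\<And>u. u \<in> Basis \<Longrightarrow> integrable lborel (f u)"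
  shows integrable_lborel_prod: "integrable lborel (\<lambda>x::'a. \<Prod>u\<in>Basis. f u (x \<bullet> u))"
    and integral_lborel_prod:
      "(LINT x::'a|lborel. (\<Prod>u\<in>Basis. f u (x \<bullet> u))) = (\<Prod>u\<in>Basis. LINT t|lborel. f u t)"
proof -
  interpret product_sigma_finite "\<lambda>_::'a. lborel :: real measure" by standard
  have [measurable]: "f u \<in> borel_measurable borel" if "u \<in> Basis" for u
    using f[OF that] by auto
  have coord: "(\<Sum>u\<in>Basis. g u *\<^sub>R u) \<bullet> b = g b" if "b \<in> Basis" for g and b :: 'a
    using that by (simp add: inner_sum_left inner_Basis if_distrib cong: if_cong)
  have meas: "(\<lambda>g. \<Sum>u\<in>Basis. g u *\<^sub>R (u::'a)) \<in> Pi\<^sub>M Basis (\<lambda>_. lborel) \<rightarrow>\<^sub>M borel"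
    by measurable
  have fm: "(\<lambda>x::'a. \<Prod>u\<in>Basis. f u (x \<bullet> u)) \<in> borel_measurable borel"
    by measurable
  show "integrable lborel (\<lambda>x::'a. \<Prod>u\<in>Basis. f u (x \<bullet> u))"
    unfolding lborel_eq[where 'a='a] integrable_distr_eq[OF meas fm]
    using product_integrable_prod[of Basis f] f by (simp add: coord cong: prod.cong)
  show "(LINT x::'a|lborel. (\<Prod>u\<in>Basis. f u (x \<bullet> u))) = (\<Prod>u\<in>Basis. LINT t|lborel. f u t)"
    unfolding lborel_eq[where 'a='a] integral_distr[OF meas fm]
    using product_integral_prod[of Basis f] f by (simp add: coord cong: prod.cong)
qed

lemma norm_power2_Basis: "(norm x)\<^sup>2 = (\<Sum>u\<in>Basis. (x \<bullet> u)\<^sup>2)" for x :: "'a::euclidean_space"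
  by (subst power2_norm_eq_inner, subst euclidean_inner) (simp add: power2_eq_square)

lemma integrable_gaussian:
  fixes a :: real
  assumes "a > 0"
  shows "integrable lborel (\<lambda>x::'a::euclidean_space. exp (- a * (norm x)\<^sup>2))"
proof -
  have "(\<lambda>x::'a. exp (- a * (norm x)\<^sup>2)) = (\<lambda>x. \<Prod>u\<in>Basis. exp (- a * (x \<bullet> u)\<^sup>2))"
    by (simp add: norm_power2_Basis sum_distrib_left exp_sum flip: sum_negf)
  then show ?thesis
    using integrable_lborel_prod[of "\<lambda>_ t. exp (- a * t\<^sup>2)"] integrable_gaussian_real[OF assms] by simp
qed

lemma integral_gaussian_pos: "(LINT x::'a::euclidean_space|lborel. exp (- (norm x)\<^sup>2)) > 0"
proof -
  have "(\<lambda>x::'a. exp (- (norm x)\<^sup>2)) = (\<lambda>x. \<Prod>u\<in>Basis. exp (- (x \<bullet> u)\<^sup>2))"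
    by (simp add: norm_power2_Basis exp_sum flip: sum_negf)
  then have "(LINT x::'a|lborel. exp (- (norm x)\<^sup>2)) = (\<Prod>u\<in>(Basis::'a set). sqrt pi)"
    using integral_lborel_prod[of "\<lambda>_ t. exp (- t\<^sup>2)"] integrable_gaussian_real[of 1]
    by (simp add: integral_gaussian_real)
  then show ?thesis by (simp add: prod_pos)
qed

lemma integrable_quadratic_gaussian:
  fixes a \<beta> :: real
  assumes "a > 0"
  shows "integrable lborel (\<lambda>x::'a::euclidean_space. (1 + norm x)\<^sup>2 * exp (\<beta> * norm x - a * (norm x)\<^sup>2))"
proof (rule Bochner_Integration.integrable_bound)
  show "integrable lborel (\<lambda>x::'a. exp ((\<beta> + 2)\<^sup>2 / (2 * a)) * exp (- (a / 2) * (norm x)\<^sup>2))"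
    by (rule integrable_mult_right) (use integrable_gaussian[of "a/2"] assms in simp)
  show "AE x::'a in lborel. norm ((1 + norm x)\<^sup>2 * exp (\<beta> * norm x - a * (norm x)\<^sup>2))
      \<le> norm (exp ((\<beta> + 2)\<^sup>2 / (2 * a)) * exp (- (a / 2) * (norm x)\<^sup>2))"
  proof (rule AE_I2)
    fix x :: 'a
    have pos: "norm ((1 + norm x)\<^sup>2 * exp (\<beta> * norm x - a * (norm x)\<^sup>2)) = (1 + norm x)\<^sup>2 * exp (\<beta> * norm x - a * (norm x)\<^sup>2)"
      "norm (exp ((\<beta> + 2)\<^sup>2 / (2 * a)) * exp (- (a / 2) * (norm x)\<^sup>2)) = exp ((\<beta> + 2)\<^sup>2 / (2 * a)) * exp (- (a / 2) * (norm x)\<^sup>2)"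
      unfolding norm_mult norm_power by (simp_all only: real_norm_def abs_exp_cancel power2_abs)
    show "norm ((1 + norm x)\<^sup>2 * exp (\<beta> * norm x - a * (norm x)\<^sup>2))
      \<le> norm (exp ((\<beta> + 2)\<^sup>2 / (2 * a)) * exp (- (a / 2) * (norm x)\<^sup>2))"
      unfolding pos by (rule quadratic_le_gaussian[OF assms norm_ge_zero])
  qed
  show "(\<lambda>x::'a. (1 + norm x)\<^sup>2 * exp (\<beta> * norm x - a * (norm x)\<^sup>2)) \<in> borel_measurable lborel"
    by measurable
qed

lemma integrable_dominated_gaussian:
  fixes f :: "'a::euclidean_space \<Rightarrow> complex"
  assumes "f \<in> borel_measurable lborel" "m > 0"
    and "\<And>x. norm (f x) \<le> C * ((1 + norm x)\<^sup>2 * exp (\<beta> * norm x - m * (norm x)\<^sup>2))"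
  shows "integrable lborel f"
proof (rule Bochner_Integration.integrable_bound)
  show "integrable lborel (\<lambda>x::'a. C * ((1 + norm x)\<^sup>2 * exp (\<beta> * norm x - m * (norm x)\<^sup>2)))"
    by (rule integrable_mult_right[OF integrable_quadratic_gaussian[OF assms(2)]])
  show "AE x in lborel. norm (f x) \<le> norm (C * ((1 + norm x)\<^sup>2 * exp (\<beta> * norm x - m * (norm x)\<^sup>2)))"
    by (intro AE_I2) (metis abs_ge_self assms(3) order_trans real_norm_def)
qed (use assms in auto)

lemma tendsto_quadratic_gaussian_0:
  fixes m \<beta> :: real
  assumes m: "m > 0" and F: "F = at_top \<or> F = at_bot"
  shows "((\<lambda>x::real. (1 + \<bar>x\<bar>)\<^sup>2 * exp (\<beta> * \<bar>x\<bar> - m * x\<^sup>2)) \<longlongrightarrow> 0) F"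
proof (rule Lim_null_comparison)
  show "\<forall>\<^sub>F x in F. norm ((1 + \<bar>x\<bar>)\<^sup>2 * exp (\<beta> * \<bar>x\<bar> - m * x\<^sup>2))
      \<le> exp ((\<beta> + 2)\<^sup>2 / (2 * m)) * exp (- (m / 2) * x\<^sup>2)"
  proof (rule always_eventually, rule allI)
    fix x :: real
    have "norm ((1 + \<bar>x\<bar>)\<^sup>2 * exp (\<beta> * \<bar>x\<bar> - m * x\<^sup>2)) = (1 + \<bar>x\<bar>)\<^sup>2 * exp (\<beta> * \<bar>x\<bar> - m * x\<^sup>2)"
      unfolding norm_mult norm_power by (simp only: real_norm_def abs_exp_cancel power2_abs)
    then show "norm ((1 + \<bar>x\<bar>)\<^sup>2 * exp (\<beta> * \<bar>x\<bar> - m * x\<^sup>2))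
      \<le> exp ((\<beta> + 2)\<^sup>2 / (2 * m)) * exp (- (m / 2) * x\<^sup>2)"
      using quadratic_le_gaussian[OF m abs_ge_zero, of x \<beta>] by (simp only: power2_abs)
  qed
  have "filterlim (\<lambda>x::real. x\<^sup>2) at_top F"
    using F filterlim_pow_at_top[of 2 "\<lambda>x::real. x" at_top] filterlim_pow_at_bot_even[of 2 "\<lambda>x::real. x" at_bot]
    by (auto simp: filterlim_ident)
  from filterlim_tendsto_pos_mult_at_top[OF tendsto_const _ this, of "m / 2"] m
  have "filterlim (\<lambda>x::real. (m / 2) * x\<^sup>2) at_top F"
    by simp
  then have "filterlim (\<lambda>x::real. - (m / 2) * x\<^sup>2) at_bot F"
    by (simp add: filterlim_uminus_at_bot)
  then have "((\<lambda>x. exp (- (m / 2) * x\<^sup>2)) \<longlongrightarrow> 0) F"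
    by (rule filterlim_compose[OF exp_at_bot])
  then show "((\<lambda>x. exp ((\<beta> + 2)\<^sup>2 / (2 * m)) * exp (- (m / 2) * x\<^sup>2)) \<longlongrightarrow> 0) F"
    by (rule tendsto_mult_right_zero)
qed

text \<open>Stated with bounds \<open>m\<close> and \<open>\<beta>\<close>, so that one majorant
  covers a whole path of parameters.\<close>

lemma norm_exp_quadratic_le:
  fixes c v :: complex and x :: real
  assumes "m \<le> Re c" "norm v \<le> \<beta>"
  shows "norm (exp (- c * (of_real x)\<^sup>2 + 2 * v * of_real x)) \<le> exp (2 * \<beta> * \<bar>x\<bar> - m * x\<^sup>2)"
proof -
  have "Re v * x \<le> norm v * \<bar>x\<bar>"
    using mult_right_mono[OF abs_Re_le_cmod[of v] abs_ge_zero[of x]] abs_ge_self[of "Re v * x"]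
    by (simp add: abs_mult)
  also have "\<dots> \<le> \<beta> * \<bar>x\<bar>" using assms(2) by (rule mult_right_mono) simp
  finally have "Re v * x \<le> \<beta> * \<bar>x\<bar>" .
  moreover have "m * x\<^sup>2 \<le> Re c * x\<^sup>2" using assms(1) by (rule mult_right_mono) simp
  ultimately show ?thesis by (simp add: norm_exp_eq_Re power2_eq_square)
qed

text \<open>The integrand is the derivative of
  \<open>(p * x + q) * exp (- c * x\<^sup>2 + 2 * v * x)\<close>, which tends to \<open>0\<close> at
  both ends. Varying \<open>c\<close> and \<open>v\<close> in a Gaussian produces a quadratic
  polynomial factor; the free \<open>p\<close> and \<open>q\<close> allow its two upper coefficients
  to be matched.\<close>

lemma integral_deriv_gaussian_0:
  fixes c v p q :: complex
  assumes c: "Re c > 0"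
  shows "(LINT x::real|lborel. (p + (p * of_real x + q) * (- 2 * c * of_real x + 2 * v)) *
           exp (- c * (of_real x)\<^sup>2 + 2 * v * of_real x)) = 0"
proof -
  define h where "h x = (p * of_real x + q) * exp (- c * (of_real x)\<^sup>2 + 2 * v * of_real x)" for x :: real
  define h' where "h' x = (p + (p * of_real x + q) * (- 2 * c * of_real x + 2 * v)) *
           exp (- c * (of_real x)\<^sup>2 + 2 * v * of_real x)" for x :: real
  have deriv: "(h has_vector_derivative h' x) (at x)" for x
  proof -
    have "((\<lambda>z. (p * z + q) * exp (- c * z\<^sup>2 + 2 * v * z)) has_field_derivative
       (p * 1) * exp (- c * z\<^sup>2 + 2 * v * z)
         + (exp (- c * z\<^sup>2 + 2 * v * z) * (- c * (2 * z) + 2 * v)) * (p * z + q)) (at z)" for z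
      by (rule derivative_eq_intros refl | simp)+
    from has_vector_derivative_real_field[OF this[of "of_real x"], of UNIV] show ?thesis
      unfolding h_def h'_def by (simp add: algebra_simps)
  qed
  have normE: "norm (exp (- c * (of_real x)\<^sup>2 + 2 * v * of_real x)) \<le> exp (2 * norm v * \<bar>x\<bar> - Re c * x\<^sup>2)" for x :: real
    by (rule norm_exp_quadratic_le) simp_all
  have lin: "norm (a * of_real x + b) \<le> (norm a + norm b) * (1 + \<bar>x\<bar>)" for a b :: complex and x :: real
  proof -
    have "norm (a * of_real x + b) \<le> norm a * \<bar>x\<bar> + norm b"
      using norm_triangle_ineq[of "a * of_real x" b] by (simp add: norm_mult)
    also have "\<dots> \<le> (norm a + norm b) * (1 + \<bar>x\<bar>)" by (simp add: algebra_simps)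
    finally show ?thesis .
  qed
  have sq: "1 + \<bar>x\<bar> \<le> (1 + \<bar>x\<bar>)\<^sup>2" "1 \<le> (1 + \<bar>x\<bar>)\<^sup>2" for x :: real
    by (simp_all add: power2_eq_square algebra_simps)
  define g where "g x = (1 + \<bar>x\<bar>)\<^sup>2 * exp (2 * norm v * \<bar>x\<bar> - Re c * x\<^sup>2)" for x :: real
  have hb: "norm (h x) \<le> (norm p + norm q) * g x" for x
  proof -
    have "norm (p * of_real x + q) \<le> (norm p + norm q) * (1 + \<bar>x\<bar>)\<^sup>2"
      using lin[of p x q] mult_left_mono[OF sq(1)[of x], of "norm p + norm q"] by force
    then show ?thesis
      unfolding h_def g_def norm_mult mult.assoc[symmetric]
      by (intro mult_mono normE) auto
  qed
  define C where "C = norm p + (norm p + norm q) * (norm (- 2 * c) + norm (2 * v))"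
  have h'b: "norm (h' x) \<le> C * g x" for x
  proof -
    have "norm ((p * of_real x + q) * (- 2 * c * of_real x + 2 * v))
       \<le> ((norm p + norm q) * (1 + \<bar>x\<bar>)) * ((norm (- 2 * c) + norm (2 * v)) * (1 + \<bar>x\<bar>))"
      unfolding norm_mult[of "p * of_real x + q"] by (intro mult_mono lin) auto
    also have "\<dots> = ((norm p + norm q) * (norm (- 2 * c) + norm (2 * v))) * (1 + \<bar>x\<bar>)\<^sup>2"
      by (simp only: power2_eq_square mult_ac)
    finally have "norm (p + (p * of_real x + q) * (- 2 * c * of_real x + 2 * v)) \<le> C * (1 + \<bar>x\<bar>)\<^sup>2"
      using norm_triangle_ineq[of p "(p * of_real x + q) * (- 2 * c * of_real x + 2 * v)"]
        mult_left_mono[OF sq(2)[of x], of "norm p"] unfolding C_def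
      by (simp add: distrib_right)
    then show ?thesis
      unfolding h'_def g_def norm_mult[of _ "exp _"] mult.assoc[symmetric]
      by (intro mult_mono normE) (auto simp: C_def)
  qed
  have lim: "(h \<longlongrightarrow> 0) F" if "F = at_top \<or> F = at_bot" for F
  proof (rule Lim_null_comparison)
    show "\<forall>\<^sub>F x in F. norm (h x) \<le> (norm p + norm q) * g x"
      using hb by simp
    show "((\<lambda>x. (norm p + norm q) * g x) \<longlongrightarrow> 0) F"
      unfolding g_def by (rule tendsto_mult_right_zero[OF tendsto_quadratic_gaussian_0[OF c that]])
  qed
  have cont: "isCont h' x" for x
    unfolding h'_def by (intro continuous_intros)
  have meas: "h' \<in> borel_measurable lborel"
    using cont by (simp add: borel_measurable_continuous_onI continuous_at_imp_continuous_on)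
  have int: "integrable lborel h'"
    by (rule integrable_dominated_gaussian[OF meas c, of C "2 * norm v"]) (use h'b in \<open>simp add: g_def\<close>)
  have "(LBINT x=-\<infinity>..\<infinity>. h' x) = 0 - 0"
  proof (rule interval_integral_FTC_integrable[where F = h])
    show "set_integrable lborel (einterval (- \<infinity>) \<infinity>) h'"
      using int by (simp add: set_integrable_def)
    show "((h \<circ> real_of_ereal) \<longlongrightarrow> 0) (at_right (- \<infinity>))"
      using lim[of at_bot] by (simp add: ereal_tendsto_simps)
    show "((h \<circ> real_of_ereal) \<longlongrightarrow> 0) (at_left \<infinity>)"
      using lim[of at_top] by (simp add: ereal_tendsto_simps)
  qed (use deriv cont in auto)
  then show ?thesis
    unfolding h'_def by (simp add: interval_lebesgue_integral_def set_lebesgue_integral_def)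
qed

lemma integrable_gaussian_complex:
  fixes c v :: complex
  assumes c: "Re c > 0"
  shows "integrable lborel (\<lambda>x::real. exp (- c * (of_real x)\<^sup>2 + 2 * v * of_real x))"
proof (rule integrable_dominated_gaussian[OF _ c, of _ 1 "2 * norm v"])
  fix x :: real
  have "norm (exp (- c * (of_real x)\<^sup>2 + 2 * v * of_real x)) \<le> 1 * exp (2 * norm v * \<bar>x\<bar> - Re c * x\<^sup>2)"
    using norm_exp_quadratic_le[of "Re c" c v "norm v" x] by simp
  also have "\<dots> \<le> (1 + \<bar>x\<bar>)\<^sup>2 * exp (2 * norm v * \<bar>x\<bar> - Re c * x\<^sup>2)"
    by (rule mult_right_mono) (simp_all add: power2_eq_square algebra_simps)
  finally show "norm (exp (- c * (of_real x)\<^sup>2 + 2 * v * of_real x))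
     \<le> 1 * ((1 + norm x)\<^sup>2 * exp (2 * norm v * norm x - Re c * (norm x)\<^sup>2))"
    by simp
next
  have "continuous_on UNIV (\<lambda>x::real. exp (- c * (of_real x)\<^sup>2 + 2 * v * of_real x))"
    by (intro continuous_intros)
  then show "(\<lambda>x::real. exp (- c * (of_real x)\<^sup>2 + 2 * v * of_real x)) \<in> borel_measurable lborel"
    by (simp add: borel_measurable_continuous_onI)
qed

text \<open>Along the path \<open>c t = 1 + t (c - 1)\<close>, \<open>v t = t v\<close> the \<open>t\<close>-derivative of
  \<open>sqrt c * exp (- v\<^sup>2 / c) * exp (- c x\<^sup>2 + 2 v x)\<close> is an \<open>x\<close>-derivative, so its integral does not
  depend on \<open>t\<close>.\<close>

lemma integral_gaussian_complex:
  fixes c v :: complex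
  assumes c: "Re c > 0"
  shows "(LINT x::real|lborel. exp (- c * (of_real x)\<^sup>2 + 2 * v * of_real x))
       = of_real (sqrt pi) * exp (v\<^sup>2 / c) / csqrt c"
proof -
  define ct where "ct t = 1 + of_real t * (c - 1)" for t :: real
  define vt where "vt t = of_real t * v" for t :: real
  \<comment> \<open>On the segment from \<open>1\<close> to \<open>c\<close> the real part stays
    above \<open>m\<close>. This gives one dominating Gaussian for all \<open>t\<close> and keeps
    \<open>csqrt (ct t)\<close> away from its branch cut.\<close>
  define m where "m = min 1 (Re c)"
  have m: "m > 0" using c by (simp add: m_def)
  define F where "F t x = exp (- ct t * (of_real x)\<^sup>2 + 2 * vt t * of_real x)" for t x :: real
  define D where "D t x = (- (c - 1) * (of_real x)\<^sup>2 + 2 * v * of_real x) * F t x" for t x :: real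
  define G where "G t = (LINT x|lborel. F t x)" for t
  have ctm: "m \<le> Re (ct t)" if "t \<in> {0..1}" for t
  proof -
    have "Re (ct t) = (1 - t) * 1 + t * Re c" by (simp add: ct_def algebra_simps)
    moreover have "(1 - t) * m + t * m \<le> (1 - t) * 1 + t * Re c"
      using that by (intro add_mono mult_left_mono) (auto simp: m_def)
    ultimately show ?thesis by (simp add: algebra_simps)
  qed
  have ct0: "Re (ct t) > 0" if "t \<in> {0..1}" for t using ctm[OF that] m by simp
  have vtb: "norm (vt t) \<le> norm v" if "t \<in> {0..1}" for t
    using that by (auto simp: vt_def norm_mult intro: mult_left_le_one_le)
  have intF: "integrable lborel (F t)" if "t \<in> {0..1}" for t
    unfolding F_def by (rule integrable_gaussian_complex[OF ct0[OF that]])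
  define g where "g x = (norm (c - 1) + norm (2 * v)) * ((1 + norm x)\<^sup>2 * exp (2 * norm v * norm x - m * (norm x)\<^sup>2))" for x :: real
  have g: "integrable lborel g"
    unfolding g_def by (rule integrable_mult_right[OF integrable_quadratic_gaussian[OF m]])
  have Db: "norm (D t x) \<le> g x" if t: "t \<in> {0..1}" for t x
  proof -
    have "norm (- (c - 1) * (of_real x)\<^sup>2 + 2 * v * of_real x) \<le> norm (c - 1) * x\<^sup>2 + norm (2 * v) * \<bar>x\<bar>"
      using norm_triangle_ineq[of "- (c - 1) * (of_real x)\<^sup>2" "2 * v * of_real x"]
      by (simp add: norm_mult norm_power norm_minus_commute)
    also have "\<dots> \<le> norm (c - 1) * (1 + \<bar>x\<bar>)\<^sup>2 + norm (2 * v) * (1 + \<bar>x\<bar>)\<^sup>2"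
      by (intro add_mono mult_left_mono) (simp_all add: power2_eq_square algebra_simps)
    finally have "norm (- (c - 1) * (of_real x)\<^sup>2 + 2 * v * of_real x) \<le> (norm (c - 1) + norm (2 * v)) * (1 + norm x)\<^sup>2"
      by (simp add: algebra_simps)
    moreover have "norm (F t x) \<le> exp (2 * norm v * norm x - m * (norm x)\<^sup>2)"
      unfolding F_def using norm_exp_quadratic_le[OF ctm[OF t] vtb[OF t], of x] by simp
    ultimately show ?thesis
      unfolding D_def g_def norm_mult[of _ "F t x"] mult.assoc[symmetric] by (intro mult_mono) auto
  qed
  have dF: "((\<lambda>t. F t x) has_vector_derivative D t x) (at t within {0..1})" for t x
  proof -
    have "((\<lambda>z. exp (- (1 + z * (c - 1)) * (of_real x)\<^sup>2 + 2 * (z * v) * of_real x)) has_field_derivative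
        exp (- (1 + z * (c - 1)) * (of_real x)\<^sup>2 + 2 * (z * v) * of_real x) * (- (c - 1) * (of_real x)\<^sup>2 + 2 * v * of_real x)) (at z)" for z
      by (rule derivative_eq_intros refl | simp)+
    from has_vector_derivative_real_field[OF this[of "of_real t"], of "{0..1}"] show ?thesis
      unfolding F_def D_def ct_def vt_def by (simp add: mult.commute)
  qed
  have dG: "(G has_vector_derivative (LINT x|lborel. D t x)) (at t within {0..1})" if "t \<in> {0..1}" for t
    unfolding G_def
    by (rule has_vector_derivative_lebesgue_integral[OF that intF dF Db g])
  \<comment> \<open>The logarithmic derivative of
    \<open>csqrt (ct t) * exp (- (vt t)\<^sup>2 / ct t)\<close>.\<close>
  define \<kappa> where "\<kappa> t = (c - 1) / (2 * ct t) - (2 * vt t * v * ct t - (vt t)\<^sup>2 * (c - 1)) / (ct t)\<^sup>2" for t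
  have intD: "(LINT x|lborel. D t x) = - \<kappa> t * G t" if t: "t \<in> {0..1}" for t
  proof -
    \<comment> \<open>The coefficients of \<open>x\<^sup>2\<close> and of \<open>x\<close> in
      \<open>D t x\<close> force \<open>p\<close> and \<open>q\<close>; the constant term that is
      left over is exactly \<open>\<kappa> t\<close>.\<close>
    define p where "p = (c - 1) / (2 * ct t)"
    define q where "q = (vt t * p - v) / ct t"
    have nz: "ct t \<noteq> 0" using ct0[OF t] by auto
    have "(p + (p * of_real x + q) * (- 2 * ct t * of_real x + 2 * vt t)) * F t x = D t x + \<kappa> t * F t x" for x
    proof -
      have "p + (p * z + q) * (- 2 * ct t * z + 2 * vt t) = (- (c - 1) * z\<^sup>2 + 2 * v * z) + \<kappa> t" for z
        unfolding p_def q_def \<kappa>_def using nz by (simp add: field_simps power2_eq_square)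
      then have "(p + (p * of_real x + q) * (- 2 * ct t * of_real x + 2 * vt t)) * F t x
          = ((- (c - 1) * (of_real x)\<^sup>2 + 2 * v * of_real x) + \<kappa> t) * F t x"
        by (simp only:)
      also have "\<dots> = D t x + \<kappa> t * F t x" unfolding D_def by (rule distrib_right)
      finally show ?thesis .
    qed
    then have "(LINT x|lborel. D t x + \<kappa> t * F t x) = 0"
      using integral_deriv_gaussian_0[OF ct0[OF t], of p q "vt t"] unfolding F_def by simp
    moreover have "integrable lborel (D t)"
    proof (rule Bochner_Integration.integrable_bound[OF g])
      have "continuous_on UNIV (D t)" unfolding D_def F_def by (intro continuous_intros)
      then show "D t \<in> borel_measurable lborel" by (simp add: borel_measurable_continuous_onI)
      show "AE x in lborel. norm (D t x) \<le> norm (g x)"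
        using Db[OF t] by (intro AE_I2) (metis abs_ge_self order_trans real_norm_def)
    qed
    ultimately show ?thesis
      using intF[OF t] unfolding G_def by (simp add: add_eq_0_iff)
  qed
  define pre where "pre t = csqrt (ct t) * exp (- (vt t)\<^sup>2 / ct t)" for t
  have dpre: "(pre has_vector_derivative \<kappa> t * pre t) (at t within {0..1})" if t: "t \<in> {0..1}" for t
  proof -
    define z where "z = complex_of_real t"
    have ctz: "ct t = 1 + z * (c - 1)" "vt t = z * v" by (simp_all add: ct_def vt_def z_def)
    have nz: "1 + z * (c - 1) \<noteq> 0" "1 + z * (c - 1) \<notin> \<real>\<^sub>\<le>\<^sub>0"
    proof -
      have "w \<noteq> 0 \<and> w \<notin> \<real>\<^sub>\<le>\<^sub>0" if "Re w > 0" for w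
        using that by (auto simp: complex_nonpos_Reals_iff)
      from this[OF ct0[OF t]] show "1 + z * (c - 1) \<noteq> 0" "1 + z * (c - 1) \<notin> \<real>\<^sub>\<le>\<^sub>0"
        unfolding ctz by blast+
    qed
    have "((\<lambda>z. csqrt (1 + z * (c - 1))) has_field_derivative (c - 1) / (2 * csqrt (1 + z * (c - 1)))) (at z)"
      by (rule derivative_eq_intros refl nz | simp)+
    moreover have "((\<lambda>z. exp (- (z * v)\<^sup>2 / (1 + z * (c - 1)))) has_field_derivative
        - exp (- (z * v)\<^sup>2 / (1 + z * (c - 1))) *
          ((2 * (z * v) * v * (1 + z * (c - 1)) - (z * v)\<^sup>2 * (c - 1)) / (1 + z * (c - 1))\<^sup>2)) (at z)"
      apply (rule derivative_eq_intros refl nz | simp only: )+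
      using nz(1) by (simp add: field_simps power2_eq_square)
    ultimately have "((\<lambda>z. csqrt (1 + z * (c - 1)) * exp (- (z * v)\<^sup>2 / (1 + z * (c - 1)))) has_field_derivative
        csqrt (ct t) * (- exp (- (vt t)\<^sup>2 / ct t) *
          ((2 * vt t * v * ct t - (vt t)\<^sup>2 * (c - 1)) / (ct t)\<^sup>2)) +
        (c - 1) / (2 * csqrt (ct t)) * exp (- (vt t)\<^sup>2 / ct t)) (at (of_real t))"
      unfolding ctz z_def[symmetric] by (rule DERIV_mult'[THEN DERIV_cong]) simp
    from has_vector_derivative_real_field[OF this, of "{0..1}"]
    have "(pre has_vector_derivative csqrt (ct t) * (- exp (- (vt t)\<^sup>2 / ct t) *
          ((2 * vt t * v * ct t - (vt t)\<^sup>2 * (c - 1)) / (ct t)\<^sup>2)) +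
        (c - 1) / (2 * csqrt (ct t)) * exp (- (vt t)\<^sup>2 / ct t)) (at t within {0..1})"
      unfolding pre_def ct_def vt_def by simp
    moreover have "(c - 1) / (2 * csqrt (ct t)) = (c - 1) / (2 * ct t) * csqrt (ct t)"
    proof -
      have "csqrt (ct t) \<noteq> 0" using nz ctz by simp
      then have "a / (2 * csqrt (ct t)) = a / (2 * (csqrt (ct t))\<^sup>2) * csqrt (ct t)" for a
        by (simp add: power2_eq_square)
      then show ?thesis by (simp only: power2_csqrt)
    qed
    moreover have "s * (- e * w) + u * s * e = (u - w) * (s * e)" for s e u w :: complex
      by (simp add: algebra_simps)
    ultimately show ?thesis
      unfolding \<kappa>_def pre_def by (simp only:)
  qed
  have "((\<lambda>t. pre t * G t) has_vector_derivative 0) (at t within {0..1})" if t: "t \<in> {0..1}" for t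
    using has_vector_derivative_mult[OF dpre[OF t] dG[OF t]] intD[OF t] by (simp add: algebra_simps)
  then obtain C where C: "\<And>t. t \<in> {0..1} \<Longrightarrow> pre t * G t = C"
    using has_vector_derivative_zero_constant[of "{0..1::real}" "\<lambda>t. pre t * G t"] by auto
  have "G 0 = (LINT x|lborel. of_real (exp (- x\<^sup>2)))"
    unfolding G_def F_def ct_def vt_def by (simp add: exp_of_real[symmetric])
  then have G0: "G 0 = of_real (sqrt pi)"
    by (simp only: integral_complex_of_real integral_gaussian_real)
  have "pre 1 * G 1 = of_real (sqrt pi)"
    using C[of 0] C[of 1] G0 by (simp add: pre_def ct_def vt_def)
  moreover have "pre 1 = csqrt c / exp (v\<^sup>2 / c)"
    by (simp add: pre_def ct_def vt_def exp_minus divide_inverse)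
  moreover have "csqrt c \<noteq> 0" using c by auto
  ultimately have "G 1 = of_real (sqrt pi) * exp (v\<^sup>2 / c) / csqrt c"
    by (simp add: field_simps)
  then show ?thesis by (simp add: G_def F_def ct_def vt_def)
qed

lemma
  fixes c v :: complex and q :: "'a::euclidean_space"
  assumes c: "Re c > 0"
  shows integrable_gaussian_complex_euclidean:
      "integrable lborel (\<lambda>x::'a. exp (- c * of_real ((norm x)\<^sup>2) + 2 * v * of_real (q \<bullet> x)))"
    and integral_gaussian_complex_euclidean:
      "(LINT x::'a|lborel. exp (- c * of_real ((norm x)\<^sup>2) + 2 * v * of_real (q \<bullet> x)))
       = (of_real (sqrt pi) / csqrt c) ^ DIM('a) * exp (v\<^sup>2 / c * of_real ((norm q)\<^sup>2))"
proof -
  have prod: "exp (- c * of_real ((norm x)\<^sup>2) + 2 * v * of_real (q \<bullet> x))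
      = (\<Prod>u\<in>Basis. exp (- c * (of_real (x \<bullet> u))\<^sup>2 + 2 * (v * of_real (q \<bullet> u)) * of_real (x \<bullet> u)))" for x :: 'a
  proof -
    have "- c * of_real ((norm x)\<^sup>2) + 2 * v * of_real (q \<bullet> x)
      = (\<Sum>u\<in>Basis. - c * (of_real (x \<bullet> u))\<^sup>2 + 2 * (v * of_real (q \<bullet> u)) * of_real (x \<bullet> u))"
      unfolding norm_power2_Basis euclidean_inner[of q x]
      by (simp add: sum.distrib sum_subtractf sum_negf sum_distrib_left mult.assoc)
    then show ?thesis by (simp add: exp_sum)
  qed
  note int = integrable_gaussian_complex[OF c]
  show "integrable lborel (\<lambda>x::'a. exp (- c * of_real ((norm x)\<^sup>2) + 2 * v * of_real (q \<bullet> x)))"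
    unfolding prod
    by (rule integrable_lborel_prod[of "\<lambda>u t. exp (- c * (of_real t)\<^sup>2 + 2 * (v * of_real (q \<bullet> u)) * of_real t)"]) (rule int)
  have "(LINT x::'a|lborel. exp (- c * of_real ((norm x)\<^sup>2) + 2 * v * of_real (q \<bullet> x)))
    = (\<Prod>u\<in>(Basis::'a set). of_real (sqrt pi) * exp ((v * of_real (q \<bullet> u))\<^sup>2 / c) / csqrt c)"
    unfolding prod
    by (subst integral_lborel_prod[of "\<lambda>u t. exp (- c * (of_real t)\<^sup>2 + 2 * (v * of_real (q \<bullet> u)) * of_real t)"], rule int)
      (simp only: integral_gaussian_complex[OF c])
  also have "\<dots> = (\<Prod>u\<in>(Basis::'a set). (of_real (sqrt pi) / csqrt c) * exp (v\<^sup>2 / c * (of_real ((q \<bullet> u)\<^sup>2))))"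
    by (simp add: power_mult_distrib)
  also have "\<dots> = (of_real (sqrt pi) / csqrt c) ^ DIM('a) * exp (v\<^sup>2 / c * of_real ((norm q)\<^sup>2))"
    unfolding prod.distrib norm_power2_Basis by (simp add: exp_sum sum_distrib_left)
  finally show "(LINT x::'a|lborel. exp (- c * of_real ((norm x)\<^sup>2) + 2 * v * of_real (q \<bullet> x)))
       = (of_real (sqrt pi) / csqrt c) ^ DIM('a) * exp (v\<^sup>2 / c * of_real ((norm q)\<^sup>2))" .
qed

section \<open>The continuous logarithm of cosh\<close>

text \<open>The difference takes values in the integer multiples of \<open>2 pi i\<close>, a
  discrete set, so it is constant on the connected line. The separation \<open>1\<close> used in the
  proof is a convenient lower bound for \<open>2 pi\<close>.\<close>

lemma exp_continuous_eq_unique: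
  fixes f g :: "real \<Rightarrow> complex"
  assumes "continuous_on UNIV f" "continuous_on UNIV g" "\<And>x. exp (f x) = exp (g x)" "f a = g a"
  shows "f = g"
proof -
  have "(\<lambda>x. f x - g x) constant_on UNIV"
  proof (rule continuous_discrete_range_constant)
    show "continuous_on UNIV (\<lambda>x. f x - g x)" using assms by (intro continuous_intros)
    show "\<exists>e>0. \<forall>y. y \<in> UNIV \<and> f y - g y \<noteq> f x - g x \<longrightarrow> e \<le> norm (f y - g y - (f x - g x))" for x
    proof (intro exI[of _ 1] conjI allI impI)
      fix y assume y: "y \<in> UNIV \<and> f y - g y \<noteq> f x - g x"
      define w where "w = f y - g y - (f x - g x)"
      have "exp w = 1" unfolding w_def by (simp add: exp_diff assms(3))
      then obtain n :: int where n: "Re w = 0" "Im w = of_int (2 * n) * pi"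
        by (auto simp: exp_eq_1)
      have "w \<noteq> 0" using y by (simp add: w_def)
      then have "n \<noteq> 0" using n by (auto simp: complex_eq_iff)
      then have "1 \<le> \<bar>real_of_int n\<bar>" by linarith
      then have "1 * 1 \<le> (2 * pi) * \<bar>real_of_int n\<bar>"
        using pi_gt3 by (intro mult_mono) auto
      also have "\<dots> = \<bar>Im w\<bar>" using n(2) by (simp add: abs_mult)
      also have "\<dots> \<le> norm w" by (rule abs_Im_le_cmod)
      finally show "1 \<le> norm w" by simp
    qed simp
  qed simp
  then obtain c where c: "\<And>x. f x - g x = c" unfolding constant_on_def by auto
  from c[of a] assms(4) have "c = 0" by simp
  then show ?thesis using c by auto
qed

context
  fixes \<alpha> :: complex
  assumes nz: "\<And>z::real. cosh (\<alpha> * of_real z) \<noteq> 0"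
begin

text \<open>The integral \<open>L\<close> of \<open>\<alpha> * tanh (\<alpha> * z)\<close> from
  \<open>0\<close> is the required branch: \<open>exp (- L) * cosh\<close> has derivative zero and
  equals \<open>1\<close> at \<open>0\<close>. Uniqueness of continuous logarithms then evaluates
  the description operator in \<open>log_cosh\<close>.\<close>

lemma
  shows has_vector_derivative_log_cosh:
      "(log_cosh \<alpha> has_vector_derivative \<alpha> * tanh (\<alpha> * of_real z)) (at z)"
    and log_cosh_0: "log_cosh \<alpha> 0 = 0"
proof -
  define f where "f z = \<alpha> * tanh (\<alpha> * of_real z)" for z :: real
  have cont: "continuous_on S f" for S
    unfolding f_def by (intro continuous_intros) (use nz in auto)
  define L where "L x = (LBINT y=(0::real)..x. f y)" for x :: real
  have dL: "(L has_vector_derivative f x) (at x)" for x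
  proof -
    have "((\<lambda>u. LBINT y=(0::real)..u. f y) has_vector_derivative f x) (at x within {-(\<bar>x\<bar>+1)..\<bar>x\<bar>+1})"
      by (rule interval_integral_FTC2) (use cont in auto)
    moreover have "at x within {-(\<bar>x\<bar>+1)..\<bar>x\<bar>+1} = at x"
      by (rule at_within_interior) auto
    ultimately show ?thesis unfolding L_def by simp
  qed
  have L0: "L 0 = 0" by (simp add: L_def)
  have dcosh: "((\<lambda>x. cosh (\<alpha> * of_real x)) has_vector_derivative sinh (\<alpha> * of_real x) * \<alpha>) (at x)" for x :: real
  proof -
    have "((\<lambda>w. cosh (\<alpha> * w)) has_field_derivative sinh (\<alpha> * w) * \<alpha>) (at w)" for w
      by (rule derivative_eq_intros refl | simp)+
    from has_vector_derivative_real_field[OF this] show ?thesis .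
  qed
  have expL: "exp (L x) = cosh (\<alpha> * of_real x)" for x
  proof -
    have dexp: "((\<lambda>x. exp (- L x)) has_vector_derivative - f x * exp (- L x)) (at x)" for x
      using field_vector_diff_chain_at[of "\<lambda>x. - L x" "- f x" x exp "exp (- L x)"] dL[of x]
      by (auto intro!: derivative_intros simp: o_def DERIV_exp mult.commute)
    have "((\<lambda>x. exp (- L x) * cosh (\<alpha> * of_real x)) has_vector_derivative 0) (at x within UNIV)" for x
    proof -
      have "exp (- L x) * (sinh (\<alpha> * of_real x) * \<alpha>) + - f x * exp (- L x) * cosh (\<alpha> * of_real x) = 0"
        using nz[of x] by (simp add: f_def tanh_def)
      then show ?thesis
        using has_vector_derivative_mult[OF dexp[of x] dcosh[of x]] by simp
    qed
    then obtain c where c: "\<And>x. exp (- L x) * cosh (\<alpha> * of_real x) = c"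
      using has_vector_derivative_zero_constant[of UNIV "\<lambda>x. exp (- L x) * cosh (\<alpha> * of_real x)"] by auto
    from c[of 0] have "c = 1" by (simp add: L0)
    with c[of x] show ?thesis by (simp add: exp_minus field_simps)
  qed
  have contL: "continuous_on UNIV L"
    using dL has_vector_derivative_continuous by (blast intro: continuous_at_imp_continuous_on)
  have eq: "log_cosh \<alpha> = L"
    unfolding log_cosh_def
  proof (rule the_equality)
    show "continuous_on UNIV L \<and> L 0 = 0 \<and> (\<forall>z. exp (L z) = cosh (\<alpha> * of_real z))"
      using contL L0 expL by blast
    fix P assume P: "continuous_on UNIV P \<and> P 0 = 0 \<and> (\<forall>z. exp (P z) = cosh (\<alpha> * of_real z))"
    show "P = L"
      by (rule exp_continuous_eq_unique[where a = 0]) (use P contL L0 expL in auto)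
  qed
  show "(log_cosh \<alpha> has_vector_derivative \<alpha> * tanh (\<alpha> * of_real z)) (at z)"
    using dL[of z] unfolding eq f_def .
  show "log_cosh \<alpha> 0 = 0"
    using L0 unfolding eq .
qed

text \<open>As long as \<open>cosh (\<alpha> * s)\<close> stays in the right half-plane for every
  \<open>s\<close> up to \<open>z\<close>, the principal logarithm is differentiable along the way,
  has the same derivative as \<open>log_cosh\<close> and also vanishes at \<open>0\<close>.\<close>

lemma log_cosh_eq_Ln:
  assumes z: "z \<ge> 0" and pos: "\<And>s. s \<in> {0..z} \<Longrightarrow> Re (cosh (\<alpha> * of_real s)) > 0"
  shows "log_cosh \<alpha> z = Ln (cosh (\<alpha> * of_real z))"
proof -
  have "((\<lambda>x. log_cosh \<alpha> x - Ln (cosh (\<alpha> * of_real x))) has_vector_derivative 0) (at s within {0..z})"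
    if s: "s \<in> {0..z}" for s
  proof -
    have "w \<noteq> 0 \<and> w \<notin> \<real>\<^sub>\<le>\<^sub>0" if "Re w > 0" for w
      using that by (auto simp: complex_nonpos_Reals_iff)
    note 1 = this[OF pos[OF s]]
    have "((\<lambda>w. cosh (\<alpha> * w)) has_field_derivative sinh (\<alpha> * of_real s) * \<alpha>) (at (of_real s))"
      by (rule derivative_eq_intros refl | simp)+
    from DERIV_chain2[OF has_field_derivative_Ln[OF conjunct2[OF 1]] this]
    have "((\<lambda>w. Ln (cosh (\<alpha> * w))) has_field_derivative sinh (\<alpha> * of_real s) * \<alpha> / cosh (\<alpha> * of_real s)) (at (of_real s))"
      by (simp add: divide_inverse mult.commute)
    from has_vector_derivative_real_field[OF this, of "{0..z}"]
    have "((\<lambda>x. Ln (cosh (\<alpha> * of_real x))) has_vector_derivative \<alpha> * tanh (\<alpha> * of_real s)) (at s within {0..z})"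
      by (simp add: tanh_def mult.commute)
    from has_vector_derivative_diff[OF has_vector_derivative_at_within[OF has_vector_derivative_log_cosh] this]
    show ?thesis by simp
  qed
  then obtain c where c: "\<And>s. s \<in> {0..z} \<Longrightarrow> log_cosh \<alpha> s - Ln (cosh (\<alpha> * of_real s)) = c"
    using has_vector_derivative_zero_constant[of "{0..z}" "\<lambda>s. log_cosh \<alpha> s - Ln (cosh (\<alpha> * of_real s))"]
    by auto
  from c[of 0] c[of z] z show ?thesis by (simp add: log_cosh_0)
qed

end

section \<open>Gaussian solutions of the moment equation\<close>

text \<open>The Riccati equation \<open>A' = \<gamma> - 4 K A\<^sup>2\<close>, \<open>A 0 = N\<close>, is solved by \<open>A = Y / y\<close> with \<open>y' = 4 K Y\<close> and
  \<open>Y' = \<gamma> y\<close>.  For imaginary \<open>K\<close> the quantity \<open>Re (Y * cnj y)\<close> increases, which keeps \<open>y\<close> away from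
  \<open>0\<close> and \<open>Re A\<close> positive.\<close>

definition riccati_num :: "complex \<Rightarrow> complex \<Rightarrow> real \<Rightarrow> real \<Rightarrow> complex" where
  "riccati_num K \<alpha> N s = \<alpha> / (4 * K) * sinh (\<alpha> * of_real s) + of_real N * cosh (\<alpha> * of_real s)"

definition riccati_den :: "complex \<Rightarrow> complex \<Rightarrow> real \<Rightarrow> real \<Rightarrow> complex" where
  "riccati_den K \<alpha> N s = cosh (\<alpha> * of_real s) + 4 * K * of_real N / \<alpha> * sinh (\<alpha> * of_real s)"

definition riccati :: "complex \<Rightarrow> complex \<Rightarrow> real \<Rightarrow> real \<Rightarrow> complex" where
  "riccati K \<alpha> N s = riccati_num K \<alpha> N s / riccati_den K \<alpha> N s"

text \<open>The moment equation in the form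
  \<open>M' = K \<Delta>M - \<gamma> \<bar>\<tau>\<bar>\<^sup>2 M\<close>. The linearised Riccati
  system reads \<open>y'' = 4 K \<gamma> y\<close>, which is where \<open>\<alpha>\<close> comes
  from.\<close>

locale schroedinger_params =
  fixes K \<alpha> :: complex and \<gamma> :: real
  assumes K_imaginary: "Re K = 0" and K_nonzero: "K \<noteq> 0" and \<gamma>_pos: "\<gamma> > 0"
    and \<alpha>_square: "\<alpha>\<^sup>2 = 4 * K * of_real \<gamma>"
begin

lemma \<alpha>_nonzero: "\<alpha> \<noteq> 0"
  using \<alpha>_square K_nonzero \<gamma>_pos by auto

lemma riccati_den_deriv:
  "(riccati_den K \<alpha> N has_vector_derivative 4 * K * riccati_num K \<alpha> N s) (at s within S)"
proof -
  have "((\<lambda>w. cosh (\<alpha> * w) + 4 * K * of_real N / \<alpha> * sinh (\<alpha> * w)) has_field_derivative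
     sinh (\<alpha> * w) * \<alpha> + 4 * K * of_real N / \<alpha> * (cosh (\<alpha> * w) * \<alpha>)) (at w)" for w
    by (rule derivative_eq_intros refl | simp)+
  from has_vector_derivative_real_field[OF this[of "of_real s"], of S]
  show ?thesis
    unfolding riccati_den_def[abs_def] riccati_num_def using \<alpha>_nonzero K_nonzero
    by (simp add: distrib_left mult_ac)
qed

lemma riccati_num_deriv:
  "(riccati_num K \<alpha> N has_vector_derivative of_real \<gamma> * riccati_den K \<alpha> N s) (at s within S)"
proof -
  have "((\<lambda>w. \<alpha> / (4 * K) * sinh (\<alpha> * w) + of_real N * cosh (\<alpha> * w)) has_field_derivative
     \<alpha> / (4 * K) * (cosh (\<alpha> * w) * \<alpha>) + of_real N * (sinh (\<alpha> * w) * \<alpha>)) (at w)" for w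
    by (rule derivative_eq_intros refl | simp)+
  from has_vector_derivative_real_field[OF this[of "of_real s"], of S]
  have "(riccati_num K \<alpha> N has_vector_derivative
     \<alpha> / (4 * K) * (cosh (\<alpha> * of_real s) * \<alpha>) + of_real N * (sinh (\<alpha> * of_real s) * \<alpha>)) (at s within S)"
    unfolding riccati_num_def[abs_def] .
  moreover have "\<alpha> / (4 * K) * (c * \<alpha>) + of_real N * (d * \<alpha>) = of_real \<gamma> * (c + 4 * K * of_real N / \<alpha> * d)" for c d
  proof -
    have "\<alpha> / (4 * K) * (c * \<alpha>) = \<alpha>\<^sup>2 / (4 * K) * c" by (simp add: power2_eq_square)
    also have "\<dots> = of_real \<gamma> * c" using K_nonzero by (simp add: \<alpha>_square)
    finally have 1: "\<alpha> / (4 * K) * (c * \<alpha>) = of_real \<gamma> * c" .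
    have "of_real \<gamma> * (4 * K * of_real N / \<alpha> * d) = of_real N * d * (\<alpha>\<^sup>2 / \<alpha>)"
      by (simp add: \<alpha>_square)
    also have "\<dots> = of_real N * (d * \<alpha>)" by (simp add: power2_eq_square)
    finally show ?thesis by (simp only: 1 distrib_left)
  qed
  ultimately show ?thesis unfolding riccati_den_def by (simp only:)
qed

lemma riccati_energy_deriv:
  "((\<lambda>s. Re (riccati_num K \<alpha> N s * cnj (riccati_den K \<alpha> N s))) has_real_derivative
      \<gamma> * (norm (riccati_den K \<alpha> N s))\<^sup>2) (at s)"
proof -
  let ?y = "riccati_den K \<alpha> N" and ?Y = "riccati_num K \<alpha> N"
  have "((\<lambda>s. cnj (?y s)) has_vector_derivative cnj (4 * K * ?Y s)) (at s)"
    by (rule bounded_linear.has_vector_derivative[OF bounded_linear_cnj riccati_den_deriv])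
  from has_vector_derivative_mult[OF riccati_num_deriv this]
  have "((\<lambda>s. Re (?Y s * cnj (?y s))) has_vector_derivative
     Re (?Y s * cnj (4 * K * ?Y s) + of_real \<gamma> * ?y s * cnj (?y s))) (at s)"
    by (rule bounded_linear.has_vector_derivative[OF bounded_linear_Re])
  \<comment> \<open>This half of the product rule is \<open>4 * Re K\<close> times the squared
    modulus of the numerator, so it vanishes for imaginary \<open>K\<close>.\<close>
  moreover have "Re (?Y s * cnj (4 * K * ?Y s)) = 0"
    using K_imaginary by (simp add: algebra_simps)
  moreover have "Re (of_real \<gamma> * ?y s * cnj (?y s)) = \<gamma> * (norm (?y s))\<^sup>2"
    by (simp only: mult.assoc complex_norm_square[symmetric]) simp
  ultimately show ?thesis by (simp add: has_real_derivative_iff_has_vector_derivative)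
qed

text \<open>The quantity equals \<open>N\<close> at \<open>s = 0\<close>, so for
  \<open>N = 0\<close> monotonicity alone does not make it positive. Its derivative at
  \<open>0\<close> is \<open>\<gamma> > 0\<close>, as the denominator is \<open>1\<close> there;
  this gives a strict initial increase, which monotonicity preserves.\<close>

lemma riccati_energy_pos:
  assumes s: "s \<ge> 0" and N: "N \<ge> 0" and sN: "s > 0 \<or> N > 0"
  shows "Re (riccati_num K \<alpha> N s * cnj (riccati_den K \<alpha> N s)) > 0"
proof -
  define P where "P s = Re (riccati_num K \<alpha> N s * cnj (riccati_den K \<alpha> N s))" for s
  have dP: "(P has_real_derivative \<gamma> * (norm (riccati_den K \<alpha> N s))\<^sup>2) (at s)" for s
    unfolding P_def by (rule riccati_energy_deriv)
  have P0: "P 0 = N" by (simp add: P_def riccati_num_def riccati_den_def)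
  have mono: "P a \<le> P b" if "a \<le> b" for a b
    by (rule DERIV_nonneg_imp_nondecreasing[OF that]) (use dP \<gamma>_pos in \<open>auto intro!: exI\<close>)
  show ?thesis
  proof (cases "s = 0")
    case True
    then show ?thesis using P0 sN by (simp add: P_def)
  next
    case False
    then have "s > 0" using s by simp
    have "\<gamma> * (norm (riccati_den K \<alpha> N 0))\<^sup>2 > 0" using \<gamma>_pos by (simp add: riccati_den_def)
    from DERIV_pos_inc_right[OF dP this] obtain d where d: "d > 0" "\<And>h. h > 0 \<Longrightarrow> h < d \<Longrightarrow> P 0 < P (0 + h)"
      by blast
    define h where "h = min s (d / 2)"
    have "0 < h" "h < d" "h \<le> s" using d(1) \<open>s > 0\<close> by (auto simp: h_def)
    with d(2)[of h] mono[of h s] P0 N show ?thesis by (simp add: P_def)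
  qed
qed

lemma riccati_den_nonzero:
  assumes "s \<ge> 0" "N \<ge> 0"
  shows "riccati_den K \<alpha> N s \<noteq> 0"
proof (cases "s = 0")
  case False
  then show ?thesis using riccati_energy_pos[of s N] assms by auto
qed (simp add: riccati_den_def)

lemma Re_riccati_pos:
  assumes "s \<ge> 0" "N \<ge> 0" "s > 0 \<or> N > 0"
  shows "Re (riccati K \<alpha> N s) > 0"
proof -
  have "Re (w / z) > 0" if "Re (w * cnj z) > 0" for w z
  proof -
    have "z \<noteq> 0" using that by auto
    then have "(norm z)\<^sup>2 > 0" by simp
    then show ?thesis using that unfolding complex_div_cnj[of w z] Re_divide_of_real[symmetric]
      by (simp flip: of_real_power)
  qed
  from this[OF riccati_energy_pos[OF assms]] show ?thesis by (simp add: riccati_def)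
qed

text \<open>The second function is the coefficient \<open>B\<close> of the linear term
  \<open>2 B p \<bullet> \<tau>\<close>. It starts at \<open>N\<close>, the value in
  \<open>exp (- N \<bar>\<tau> - p\<bar>\<^sup>2)\<close>. Its equation is scalar and homogeneous,
  so the linear term keeps the direction \<open>p\<close> throughout.\<close>

lemma riccati_deriv:
  assumes "s \<ge> 0" "N \<ge> 0"
  shows "(riccati K \<alpha> N has_vector_derivative of_real \<gamma> - 4 * K * (riccati K \<alpha> N s)\<^sup>2) (at s within S)"
    and "((\<lambda>s. of_real N / riccati_den K \<alpha> N s) has_vector_derivative
           - 4 * K * riccati K \<alpha> N s * (of_real N / riccati_den K \<alpha> N s)) (at s within S)"
proof -
  let ?y = "riccati_den K \<alpha> N" and ?Y = "riccati_num K \<alpha> N"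
  note nz = riccati_den_nonzero[OF assms]
  have inv: "((\<lambda>s. inverse (?y s)) has_vector_derivative - (inverse (?y s) * (4 * K * ?Y s) * inverse (?y s))) (at s within S)"
  proof -
    have "(?y has_derivative (\<lambda>h. h *\<^sub>R (4 * K * ?Y s))) (at s within S)"
      using riccati_den_deriv unfolding has_vector_derivative_def .
    from Deriv.has_derivative_inverse[OF nz this] show ?thesis
      unfolding has_vector_derivative_def by (rule has_derivative_eq_rhs) (auto simp: fun_eq_iff)
  qed
  have "((\<lambda>s. ?Y s * inverse (?y s)) has_vector_derivative
     ?Y s * - (inverse (?y s) * (4 * K * ?Y s) * inverse (?y s)) + of_real \<gamma> * ?y s * inverse (?y s)) (at s within S)"
    by (rule has_vector_derivative_mult[OF riccati_num_deriv inv])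
  moreover have "?Y s * - (inverse (?y s) * (4 * K * ?Y s) * inverse (?y s)) + of_real \<gamma> * ?y s * inverse (?y s)
     = of_real \<gamma> - 4 * K * (riccati K \<alpha> N s)\<^sup>2"
    using nz unfolding riccati_def by (simp add: field_simps power2_eq_square)
  ultimately show "(riccati K \<alpha> N has_vector_derivative of_real \<gamma> - 4 * K * (riccati K \<alpha> N s)\<^sup>2) (at s within S)"
    unfolding riccati_def[abs_def] by (simp add: divide_inverse)
  have "((\<lambda>s. of_real N * inverse (?y s)) has_vector_derivative
     of_real N * - (inverse (?y s) * (4 * K * ?Y s) * inverse (?y s))) (at s within S)"
    by (rule has_vector_derivative_mult_right[OF inv])
  then show "((\<lambda>s. of_real N / riccati_den K \<alpha> N s) has_vector_derivative
           - 4 * K * riccati K \<alpha> N s * (of_real N / riccati_den K \<alpha> N s)) (at s within S)"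
    unfolding riccati_def by (simp add: divide_inverse mult_ac)
qed

text \<open>For \<open>N = 0\<close> the denominator is \<open>cosh\<close> itself; negative
  arguments follow by evenness.\<close>

lemma cosh_nonzero: "cosh (\<alpha> * of_real s) \<noteq> 0"
proof (cases "s \<ge> 0")
  case True
  then show ?thesis using riccati_den_nonzero[of s 0] by (simp add: riccati_den_def)
next
  case False
  then show ?thesis using riccati_den_nonzero[of "- s" 0] by (simp add: riccati_den_def)
qed

lemma riccati_0: "riccati K \<alpha> 0 s = \<alpha> / (4 * K) * tanh (\<alpha> * of_real s)"
  by (simp add: riccati_def riccati_num_def riccati_den_def tanh_def)

end

section \<open>Derivatives of Gaussians, and the explicit solution\<close>

definition gauss :: "complex \<Rightarrow> complex \<Rightarrow> 'a::euclidean_space \<Rightarrow> complex \<Rightarrow> 'a \<Rightarrow> complex" where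
  "gauss A B p C \<tau> = exp (- A * of_real ((norm \<tau>)\<^sup>2) + 2 * B * of_real (p \<bullet> \<tau>) + C)"

text \<open>The logarithmic derivative of \<open>gauss\<close> in the direction
  \<open>u\<close>.\<close>

definition gauss_slope :: "complex \<Rightarrow> complex \<Rightarrow> 'a::euclidean_space \<Rightarrow> 'a \<Rightarrow> 'a \<Rightarrow> complex" where
  "gauss_slope A B p u \<tau> = - 2 * A * of_real (\<tau> \<bullet> u) + 2 * B * of_real (p \<bullet> u)"

lemma gauss_line_deriv:
  assumes "u \<in> Basis"
  shows "((\<lambda>t. gauss A B p C (\<tau> + t *\<^sub>R u)) has_vector_derivative
           gauss_slope A B p u \<tau> * gauss A B p C \<tau>) (at 0)"
proof -
  have n: "(norm (\<tau> + t *\<^sub>R u))\<^sup>2 = (norm \<tau>)\<^sup>2 + 2 * t * (\<tau> \<bullet> u) + t\<^sup>2" for t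
    using assms unfolding power2_norm_eq_inner
    by (simp add: inner_simps inner_commute[of u \<tau>] inner_Basis power2_eq_square algebra_simps)
  have "((\<lambda>z. exp (- A * (of_real ((norm \<tau>)\<^sup>2) + 2 * z * of_real (\<tau> \<bullet> u) + z\<^sup>2)
            + 2 * B * (of_real (p \<bullet> \<tau>) + z * of_real (p \<bullet> u)) + C)) has_field_derivative
          exp (- A * (of_real ((norm \<tau>)\<^sup>2) + 2 * z * of_real (\<tau> \<bullet> u) + z\<^sup>2)
            + 2 * B * (of_real (p \<bullet> \<tau>) + z * of_real (p \<bullet> u)) + C) *
          (- A * (2 * of_real (\<tau> \<bullet> u) + 2 * z) + 2 * B * of_real (p \<bullet> u))) (at z)" for z
    by (rule derivative_eq_intros refl | simp)+
  from has_vector_derivative_real_field[OF this[of "of_real 0"], of UNIV]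
  show ?thesis
    unfolding gauss_def gauss_slope_def n by (simp add: inner_simps mult_ac)
qed

lemma gauss_slope_line_deriv:
  "((\<lambda>t. gauss_slope A B p u (\<tau> + t *\<^sub>R v)) has_vector_derivative - 2 * A * of_real (v \<bullet> u)) (at 0)"
proof -
  have "((\<lambda>z. - 2 * A * (of_real (\<tau> \<bullet> u) + z * of_real (v \<bullet> u)) + 2 * B * of_real (p \<bullet> u))
     has_field_derivative - 2 * A * of_real (v \<bullet> u)) (at z)" for z
    by (rule derivative_eq_intros refl | simp)+
  from has_vector_derivative_real_field[OF this[of "of_real 0"], of UNIV] show ?thesis
    unfolding gauss_slope_def by (simp add: inner_simps)
qed

lemma dir_deriv_gauss:
  assumes "u \<in> Basis"
  shows "dir_deriv (gauss A B p C) u = (\<lambda>\<tau>. gauss_slope A B p u \<tau> * gauss A B p C \<tau>)"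
  unfolding dir_deriv_def using gauss_line_deriv[OF assms] vector_derivative_at by blast

lemma gauss_line_deriv2:
  assumes "v \<in> Basis"
  shows "((\<lambda>t. gauss_slope A B p u (\<tau> + t *\<^sub>R v) * gauss A B p C (\<tau> + t *\<^sub>R v)) has_vector_derivative
     (gauss_slope A B p u \<tau> * gauss_slope A B p v \<tau> - 2 * A * of_real (v \<bullet> u)) * gauss A B p C \<tau>) (at 0)"
  using has_vector_derivative_mult[OF gauss_slope_line_deriv gauss_line_deriv[OF assms]]
  by (simp add: algebra_simps)

lemma dir_deriv2_gauss:
  assumes "u \<in> Basis" "v \<in> Basis"
  shows "dir_deriv (dir_deriv (gauss A B p C) u) v =
    (\<lambda>\<tau>. (gauss_slope A B p u \<tau> * gauss_slope A B p v \<tau> - 2 * A * of_real (v \<bullet> u)) * gauss A B p C \<tau>)"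
  unfolding dir_deriv_gauss[OF assms(1)] dir_deriv_def
  using gauss_line_deriv2[OF assms(2)] vector_derivative_at by blast

text \<open>For an exponent \<open>f\<close> this is \<open>(\<nabla>f)\<^sup>2 + \<Delta>f\<close>,
  the factor by which the Laplacian multiplies \<open>exp f\<close>. The same sum returns in the
  duality argument, hence a statement of its own.\<close>

lemma sum_gauss_slope_square:
  "(\<Sum>u\<in>Basis. (gauss_slope A B p u \<tau>)\<^sup>2 - 2 * A) =
     4 * A\<^sup>2 * of_real ((norm \<tau>)\<^sup>2) - 8 * A * B * of_real (p \<bullet> \<tau>) + 4 * B\<^sup>2 * of_real ((norm p)\<^sup>2)
      - 2 * of_nat DIM('a) * A"
  for \<tau> :: "'a::euclidean_space"
proof -
  have "(gauss_slope A B p u \<tau>)\<^sup>2 - 2 * A = 4 * A\<^sup>2 * of_real ((\<tau> \<bullet> u)\<^sup>2)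
     + (- 8 * A * B) * of_real ((p \<bullet> u) * (\<tau> \<bullet> u)) + 4 * B\<^sup>2 * of_real ((p \<bullet> u)\<^sup>2) + (- 2 * A)" for u
    unfolding gauss_slope_def by (simp add: power2_eq_square algebra_simps)
  then show ?thesis
    unfolding norm_power2_Basis euclidean_inner[of p \<tau>] of_real_sum sum_distrib_left
    by (simp add: sum.distrib sum_negf sum_subtractf)
qed

lemma laplacian_gauss:
  "laplacian (gauss A B p C) \<tau> =
    (4 * A\<^sup>2 * of_real ((norm \<tau>)\<^sup>2) - 8 * A * B * of_real (p \<bullet> \<tau>) + 4 * B\<^sup>2 * of_real ((norm p)\<^sup>2)
      - 2 * of_nat DIM('a) * A) * gauss A B p C \<tau>"
  for \<tau> :: "'a::euclidean_space"
proof -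
  have "laplacian (gauss A B p C) \<tau> = (\<Sum>u\<in>Basis. ((gauss_slope A B p u \<tau>)\<^sup>2 - 2 * A) * gauss A B p C \<tau>)"
    unfolding laplacian_def by (rule sum.cong) (simp_all add: dir_deriv2_gauss inner_Basis power2_eq_square)
  then show ?thesis
    by (simp only: sum_distrib_right[symmetric] sum_gauss_slope_square)
qed

lemma gauss_param_deriv:
  assumes "(A has_vector_derivative A') (at z within S)" "(B has_vector_derivative B') (at z within S)"
    "(C has_vector_derivative C') (at z within S)"
  shows "((\<lambda>z. gauss (A z) (B z) p (C z) \<tau>) has_vector_derivative
    (- A' * of_real ((norm \<tau>)\<^sup>2) + 2 * B' * of_real (p \<bullet> \<tau>) + C') * gauss (A z) (B z) p (C z) \<tau>) (at z within S)"
proof -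
  define f where "f z = - A z * of_real ((norm \<tau>)\<^sup>2) + 2 * B z * of_real (p \<bullet> \<tau>) + C z" for z
  have f: "(f has_vector_derivative - A' * of_real ((norm \<tau>)\<^sup>2) + 2 * B' * of_real (p \<bullet> \<tau>) + C') (at z within S)"
    unfolding f_def
    by (intro has_vector_derivative_add has_vector_derivative_mult_left has_vector_derivative_minus
        has_vector_derivative_mult_right assms)
  have "(exp has_field_derivative exp (f z)) (at (f z) within f ` S)"
    using DERIV_exp has_field_derivative_at_within by blast
  from field_vector_diff_chain_within[OF f this] show ?thesis
    unfolding gauss_def f_def o_def .
qed

lemma continuous_on_gauss [continuous_intros]:
  assumes "continuous_on S A" "continuous_on S B" "continuous_on S C" "continuous_on S f"
  shows "continuous_on S (\<lambda>x. gauss (A x) (B x) p (C x) (f x))"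
  unfolding gauss_def using assms by (intro continuous_intros)

lemma continuous_on_gauss_slope [continuous_intros]:
  assumes "continuous_on S A" "continuous_on S B" "continuous_on S f"
  shows "continuous_on S (\<lambda>x. gauss_slope (A x) (B x) p u (f x))"
  unfolding gauss_slope_def using assms by (intro continuous_intros)

context schroedinger_params
begin

definition plane_wave_moment :: "real \<Rightarrow> 'a::euclidean_space \<Rightarrow> complex" where
  "plane_wave_moment z = gauss (riccati K \<alpha> 0 z) 0 0 (- of_nat DIM('a) * (log_cosh \<alpha> z / 2))"

lemma plane_wave_regular: "classical_regularity (plane_wave_moment :: real \<Rightarrow> 'a::euclidean_space \<Rightarrow> complex)"
proof -
  have cA: "continuous_on {0..} (riccati K \<alpha> 0)"
    by (rule continuous_on_vector_derivative, rule riccati_deriv) auto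
  have cL: "continuous_on UNIV (log_cosh \<alpha>)"
    by (rule continuous_on_vector_derivative, rule has_vector_derivative_log_cosh[OF cosh_nonzero])
  have fstA: "continuous_on S (\<lambda>x::real \<times> 'a. riccati K \<alpha> 0 (fst x))" if "S \<subseteq> {0..} \<times> UNIV" for S
    using that by (intro continuous_on_compose2[OF cA continuous_on_fst[OF continuous_on_id]]) auto
  have fstC: "continuous_on S (\<lambda>x::real \<times> 'a. - of_nat DIM('a) * (log_cosh \<alpha> (fst x) / 2))" for S
    by (intro continuous_intros continuous_on_compose2[OF cL continuous_on_fst[OF continuous_on_id]]) auto
  show ?thesis
    unfolding classical_regularity_def case_prod_beta plane_wave_moment_def
  proof (intro conjI ballI allI impI)
    fix u v :: 'a assume u: "u \<in> Basis" and v: "v \<in> Basis"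
    show "(\<lambda>t. dir_deriv (gauss (riccati K \<alpha> 0 z) 0 0 (- of_nat DIM('a) * (log_cosh \<alpha> z / 2))) u (\<tau> + t *\<^sub>R v))
       differentiable at 0" for z \<tau>
      unfolding dir_deriv_gauss[OF u] by (rule differentiableI_vector, rule gauss_line_deriv2[OF v])
    show "continuous_on ({0<..} \<times> UNIV) (\<lambda>x. dir_deriv (dir_deriv (gauss (riccati K \<alpha> 0 (fst x)) 0 0
           (- of_nat DIM('a) * (log_cosh \<alpha> (fst x) / 2))) u) v (snd x))"
      unfolding dir_deriv2_gauss[OF u v] by (intro continuous_intros fstA fstC) auto
  next
    fix u :: 'a assume u: "u \<in> Basis"
    show "(\<lambda>t. gauss (riccati K \<alpha> 0 z) 0 0 (- of_nat DIM('a) * (log_cosh \<alpha> z / 2)) (\<tau> + t *\<^sub>R u))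
       differentiable at 0" for z \<tau>
      by (rule differentiableI_vector, rule gauss_line_deriv[OF u])
    show "continuous_on ({0<..} \<times> UNIV) (\<lambda>x. dir_deriv (gauss (riccati K \<alpha> 0 (fst x)) 0 0
           (- of_nat DIM('a) * (log_cosh \<alpha> (fst x) / 2))) u (snd x))"
      unfolding dir_deriv_gauss[OF u] by (intro continuous_intros fstA fstC) auto
  next
    show "continuous_on ({0..} \<times> UNIV) (\<lambda>x. gauss (riccati K \<alpha> 0 (fst x)) 0 0
           (- of_nat DIM('a) * (log_cosh \<alpha> (fst x) / 2)) (snd x :: 'a))"
      by (intro continuous_intros fstA fstC) auto
  qed
qed

text \<open>Since \<open>Re A \<ge> 0\<close>, the Gaussian factor has modulus at most
  \<open>1\<close>; the remaining factor depends on \<open>z\<close> only and is continuous on a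
  compact interval.\<close>

lemma plane_wave_bounded: "\<exists>C. \<forall>z\<in>{0..Z}. \<forall>\<tau>. norm (plane_wave_moment z (\<tau>::'a::euclidean_space)) \<le> C"
proof -
  have "continuous_on UNIV (log_cosh \<alpha>)"
    by (rule continuous_on_vector_derivative, rule has_vector_derivative_log_cosh[OF cosh_nonzero])
  then have "continuous_on {0..Z} (\<lambda>z. exp (- of_nat DIM('a) * (log_cosh \<alpha> z / 2)))"
    by (intro continuous_intros) (auto intro: continuous_on_subset)
  then have "bounded ((\<lambda>z. exp (- of_nat DIM('a) * (log_cosh \<alpha> z / 2))) ` {0..Z})"
    by (intro compact_imp_bounded compact_continuous_image) auto
  then obtain C where "\<forall>x\<in>(\<lambda>z. exp (- of_nat DIM('a) * (log_cosh \<alpha> z / 2))) ` {0..Z}. norm x \<le> C"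
    unfolding bounded_iff by blast
  then have C: "norm (exp (- of_nat DIM('a) * (log_cosh \<alpha> z / 2))) \<le> C" if "z \<in> {0..Z}" for z
    using that by blast
  have "norm (plane_wave_moment z \<tau>) \<le> C" if z: "z \<in> {0..Z}" for z and \<tau> :: 'a
  proof -
    have "0 \<le> Re (riccati K \<alpha> 0 z)"
      using Re_riccati_pos[of z 0] z by (cases "z = 0") (auto simp: riccati_0)
    then have "norm (exp (- riccati K \<alpha> 0 z * of_real ((norm \<tau>)\<^sup>2))) \<le> 1"
      by (simp add: norm_exp_eq_Re)
    then have "norm (plane_wave_moment z \<tau>) \<le> 1 * norm (exp (- of_nat DIM('a) * (log_cosh \<alpha> z / 2)))"
      unfolding plane_wave_moment_def gauss_def exp_add norm_mult
      by (intro mult_right_mono) auto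
    with C[OF z] show ?thesis by simp
  qed
  then show ?thesis by blast
qed

text \<open>Comparison of coefficients: that of \<open>\<bar>\<tau>\<bar>\<^sup>2\<close> is the
  Riccati equation, and the constant term requires \<open>C' = - 2 K d A\<close>. As
  \<open>A = \<alpha> / (4 K) * tanh (\<alpha> z)\<close>, the latter integrates to
  \<open>- d / 2\<close> times the logarithm of \<open>cosh\<close>.\<close>

lemma plane_wave_equation:
  fixes \<tau> :: "'a::euclidean_space"
  assumes "z > 0"
  shows "((\<lambda>s. plane_wave_moment s \<tau>) has_vector_derivative
     K * laplacian (plane_wave_moment z) \<tau> - of_real (\<gamma> * (norm \<tau>)\<^sup>2) * plane_wave_moment z \<tau>) (at z)"
proof -
  let ?A = "riccati K \<alpha> 0" and ?C = "\<lambda>z. - of_nat DIM('a) * (log_cosh \<alpha> z / 2)"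
  have dC: "(?C has_vector_derivative - of_nat DIM('a) * (\<alpha> * tanh (\<alpha> * of_real z) / 2)) (at z)"
    by (intro has_vector_derivative_mult_right has_vector_derivative_divide has_vector_derivative_log_cosh cosh_nonzero)
  have C': "- of_nat DIM('a) * (\<alpha> * tanh (\<alpha> * of_real z) / 2) = - 2 * K * of_nat DIM('a) * ?A z"
    unfolding riccati_0 using K_nonzero by (simp add: field_simps)
  have "(- (of_real \<gamma> - 4 * K * (?A z)\<^sup>2) * of_real ((norm \<tau>)\<^sup>2) + 2 * 0 * of_real (0 \<bullet> \<tau>)
      + (- 2 * K * of_nat DIM('a) * ?A z)) * w
    = K * ((4 * (?A z)\<^sup>2 * of_real ((norm \<tau>)\<^sup>2) - 8 * ?A z * 0 * of_real (0 \<bullet> \<tau>) + 4 * 0\<^sup>2 * of_real ((norm (0::'a))\<^sup>2)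
      - 2 * of_nat DIM('a) * ?A z) * w) - of_real (\<gamma> * (norm \<tau>)\<^sup>2) * w" for w
    by (simp add: algebra_simps)
  then show ?thesis
    using gauss_param_deriv[OF riccati_deriv(1) has_vector_derivative_const[of 0] dC[unfolded C'], of 0 0 \<tau>] assms
    unfolding plane_wave_moment_def laplacian_gauss by (simp only:)
qed

end

section \<open>Integration by parts with a cutoff\<close>

lemma continuous_on_slice:
  assumes "continuous_on (S \<times> UNIV) (\<lambda>(z, x). f z x)" "z \<in> S"
  shows "continuous_on UNIV (f z)"
proof -
  have "continuous_on UNIV (\<lambda>x. (z, x))" by (intro continuous_intros)
  moreover have "range (\<lambda>x. (z, x)) \<subseteq> S \<times> UNIV" using assms(2) by auto
  ultimately show ?thesis using continuous_on_compose2[OF assms(1)] by fastforce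
qed

lemma integrable_compact_support:
  fixes f :: "'a::euclidean_space \<Rightarrow> complex"
  assumes f: "continuous_on UNIV f" and supp: "\<And>x. norm x > R \<Longrightarrow> f x = 0"
  shows "integrable lborel f"
proof -
  have "integrable lborel (\<lambda>x. indicator (cball 0 R) x *\<^sub>R f x)"
    by (rule borel_integrable_compact) (auto intro: continuous_on_subset[OF f])
  moreover have "(\<lambda>x. indicator (cball 0 R) x *\<^sub>R f x) = f"
    by (auto simp: fun_eq_iff indicator_def supp)
  ultimately show ?thesis by simp
qed

text \<open>Compactness of \<open>{a..b} \<times> cball 0 R\<close>. The bound is written as a
  multiple of an indicator function so that it can serve directly as an integrable majorant.\<close>

lemma bounded_compact_support:
  fixes f :: "real \<Rightarrow> 'a::euclidean_space \<Rightarrow> complex"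
  assumes f: "continuous_on ({a..b} \<times> UNIV) (\<lambda>(z, x). f z x)"
    and supp: "\<And>z x. norm x > R \<Longrightarrow> f z x = 0"
  shows "\<exists>C. \<forall>z\<in>{a..b}. \<forall>x. norm (f z x) \<le> C * indicator (cball 0 R) x"
proof -
  have "compact ((\<lambda>(z, x). f z x) ` ({a..b} \<times> cball 0 R))"
    by (intro compact_continuous_image compact_Times continuous_on_subset[OF f]) auto
  from compact_imp_bounded[OF this]
  obtain C where C: "\<forall>y\<in>(\<lambda>(z, x). f z x) ` ({a..b} \<times> cball 0 R). norm y \<le> C"
    unfolding bounded_iff by (rule exE)
  have "norm (f z x) \<le> C * indicator (cball 0 R) x" if z: "z \<in> {a..b}" for z x
  proof (cases "norm x > R")
    case False
    then have "f z x \<in> (\<lambda>(z, x). f z x) ` ({a..b} \<times> cball 0 R)"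
      using z by (auto intro!: image_eqI[of _ _ "(z, x)"])
    from bspec[OF C this] False show ?thesis by simp
  qed (simp add: supp)
  then show ?thesis by blast
qed

lemma integrable_indicator_cball:
  fixes C R :: real
  shows "integrable lborel (\<lambda>x::'a::euclidean_space. C * indicator (cball 0 R) x)"
  by (rule integrable_mult_right, rule integrable_real_indicator) (use emeasure_bounded_finite[OF bounded_cball[of "0::'a" R]] in simp_all)

lemma continuous_on_param_integral:
  fixes f :: "real \<Rightarrow> 'a::euclidean_space \<Rightarrow> complex"
  assumes f: "continuous_on ({a..b} \<times> UNIV) (\<lambda>(z, x). f z x)"
    and supp: "\<And>z x. norm x > R \<Longrightarrow> f z x = 0"
  shows "continuous_on {a..b} (\<lambda>z. LINT x|lborel. f z x)"
proof -
  obtain C where "\<forall>z\<in>{a..b}. \<forall>x. norm (f z x) \<le> C * indicator (cball 0 R) x"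
    using bounded_compact_support[OF assms] by (rule exE)
  then have C: "norm (f z x) \<le> C * indicator (cball 0 R) x" if "z \<in> {a..b}" for z x
    using that by blast
  note slice = continuous_on_slice[OF f]
  show ?thesis
  proof (rule continuous_on_sequentiallyI)
    fix X z assume X: "\<forall>n. X n \<in> {a..b}" "z \<in> {a..b}" "X \<longlonglongrightarrow> z"
    show "(\<lambda>n. LINT x|lborel. f (X n) x) \<longlonglongrightarrow> (LINT x|lborel. f z x)"
    proof (rule integral_dominated_convergence[OF _ _ integrable_indicator_cball[of C R]])
      show "f z \<in> borel_measurable lborel" "f (X n) \<in> borel_measurable lborel" for n
        using slice X by (simp_all add: borel_measurable_continuous_onI)
      show "AE x in lborel. (\<lambda>n. f (X n) x) \<longlonglongrightarrow> f z x"
      proof (rule AE_I2)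
        fix x :: 'a
        have "continuous_on {a..b} (\<lambda>z::real. (z, x))" by (intro continuous_intros)
        from continuous_on_compose2[OF f this] have "continuous_on {a..b} (\<lambda>z. f z x)" by auto
        then show "(\<lambda>n. f (X n) x) \<longlonglongrightarrow> f z x"
          using X by (auto simp: continuous_on_sequentially comp_def)
      qed
      show "AE x in lborel. norm (f (X n) x) \<le> C * indicator (cball 0 R) x" for n
        using C X by auto
    qed
  qed
qed

lemma integral_param_deriv_compact_support:
  fixes f :: "real \<Rightarrow> 'a::euclidean_space \<Rightarrow> complex"
  assumes t: "t \<in> {a..b}"
    and f: "\<And>s. s \<in> {a..b} \<Longrightarrow> continuous_on UNIV (f s)"
    and f': "continuous_on ({a..b} \<times> UNIV) (\<lambda>(z, x). f' z x)"
    and deriv: "\<And>s x. s \<in> {a..b} \<Longrightarrow> ((\<lambda>s. f s x) has_vector_derivative f' s x) (at s within {a..b})"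
    and supp: "\<And>z x. norm x > R \<Longrightarrow> f z x = 0" "\<And>z x. norm x > R \<Longrightarrow> f' z x = 0"
  shows "((\<lambda>s. LINT x|lborel. f s x) has_vector_derivative (LINT x|lborel. f' t x)) (at t within {a..b})"
proof -
  obtain C where "\<forall>z\<in>{a..b}. \<forall>x. norm (f' z x) \<le> C * indicator (cball 0 R) x"
    using bounded_compact_support[OF f' supp(2)] by (rule exE)
  then have C: "norm (f' z x) \<le> C * indicator (cball 0 R) x" if "z \<in> {a..b}" for z x
    using that by blast
  show ?thesis
    by (rule has_vector_derivative_lebesgue_integral[OF t _ deriv C integrable_indicator_cball])
      (auto intro!: integrable_compact_support[OF f supp(1)])
qed

lemma integral_lborel_translation:
  fixes f :: "'a::euclidean_space \<Rightarrow> complex"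
  assumes "continuous_on UNIV f"
  shows "(LINT x|lborel. f (c + x)) = (LINT x|lborel. f x)"
proof -
  have m: "f \<in> borel_measurable borel" using assms by (rule borel_measurable_continuous_onI)
  have "(LINT x|lborel. f x) = (LINT x|distr lborel borel ((+) c). f x)"
    by (simp add: lborel_distr_plus)
  also have "\<dots> = (LINT x|lborel. f (c + x))"
    by (rule integral_distr) (use m in auto)
  finally show ?thesis by simp
qed

text \<open>By translation invariance \<open>t \<mapsto> \<integral> f (x + t u) dx\<close> is constant.\<close>

lemma integral_dir_deriv_0:
  fixes f :: "'a::euclidean_space \<Rightarrow> complex"
  assumes f: "continuous_on UNIV f" and f': "continuous_on UNIV f'"
    and deriv: "\<And>x. ((\<lambda>t. f (x + t *\<^sub>R u)) has_vector_derivative f' x) (at 0)"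
    and supp: "\<And>x. norm x > R \<Longrightarrow> f x = 0" "\<And>x. norm x > R \<Longrightarrow> f' x = 0"
  shows "(LINT x|lborel. f' x) = 0"
proof -
  have d: "((\<lambda>t. f (x + t *\<^sub>R u)) has_vector_derivative f' (x + s *\<^sub>R u)) (at s within S)" for x s S
  proof -
    have "((\<lambda>t. t - s) has_vector_derivative 1) (at s)"
      by (auto intro!: derivative_eq_intros)
    moreover have "((\<lambda>t. f (x + s *\<^sub>R u + t *\<^sub>R u)) has_vector_derivative f' (x + s *\<^sub>R u)) (at (s - s))"
      using deriv[of "x + s *\<^sub>R u"] by simp
    ultimately have "((\<lambda>t. f (x + s *\<^sub>R u + t *\<^sub>R u)) \<circ> (\<lambda>t. t - s) has_vector_derivative 1 *\<^sub>R f' (x + s *\<^sub>R u)) (at s)"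
      by (rule vector_diff_chain_at)
    then show ?thesis
      by (simp add: o_def algebra_simps has_vector_derivative_at_within)
  qed
  have out: "norm (x + s *\<^sub>R u) > R" if "norm x > R + norm u" "s \<in> {-1..1}" for x s
  proof -
    have "norm (s *\<^sub>R u) \<le> 1 * norm u"
      using that unfolding norm_scaleR by (intro mult_right_mono) auto
    moreover have "norm x - norm (s *\<^sub>R u) \<le> norm (x + s *\<^sub>R u)"
      using norm_triangle_ineq2[of x "- (s *\<^sub>R u)"] by simp
    ultimately show ?thesis using that by simp
  qed
  \<comment> \<open>Clamping the shift to \<open>[-1, 1]\<close> keeps all translates supported in
    one ball, of radius \<open>R + norm u\<close>, for every real value of the parameter, as the
    differentiation lemma asks.\<close>
  define c where "c s = max (-1) (min 1 s)" for s :: real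
  have c: "c s \<in> {-1..1}" for s by (auto simp: c_def)
  have cc: "c s = s" if "s \<in> {-1..1}" for s using that by (auto simp: c_def)
  have "((\<lambda>s. LINT x|lborel. f (x + c s *\<^sub>R u)) has_vector_derivative (LINT x|lborel. f' (x + c 0 *\<^sub>R u))) (at 0 within {-1..1})"
  proof (rule integral_param_deriv_compact_support[where R = "R + norm u"])
    show "continuous_on UNIV (\<lambda>x. f (x + c s *\<^sub>R u))" for s
      by (intro continuous_on_compose2[OF f] continuous_intros) auto
    show "continuous_on ({-1..1} \<times> UNIV) (\<lambda>(z, x). f' (x + c z *\<^sub>R u))"
      unfolding case_prod_beta c_def by (intro continuous_on_compose2[OF f'] continuous_intros) auto
    show "((\<lambda>s. f (x + c s *\<^sub>R u)) has_vector_derivative f' (x + c s *\<^sub>R u)) (at s within {-1..1})"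
      if "s \<in> {-1..1}" for s x
    proof -
      have e: "f' (x + c s *\<^sub>R u) = f' (x + s *\<^sub>R u)" by (simp only: cc[OF that])
      show ?thesis
        unfolding e by (rule has_vector_derivative_transform[OF that _ d]) (simp only: cc)
    qed
  qed (use supp out[OF _ c] in auto)
  moreover have "(LINT x|lborel. f (x + v)) = (LINT x|lborel. f x)" for v
    using integral_lborel_translation[OF f, of v] by (simp add: add.commute)
  ultimately have "((\<lambda>s::real. LINT x|lborel. f x) has_vector_derivative (LINT x|lborel. f' x)) (at 0 within {-1..1})"
    using cc[of 0] by simp
  moreover have "at 0 within {-1..1} = at (0::real)" by (rule at_within_interior) auto
  ultimately have "((\<lambda>s::real. LINT x|lborel. f x) has_vector_derivative (LINT x|lborel. f' x)) (at 0)"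
    by (simp only:)
  from vector_derivative_unique_at[OF this has_vector_derivative_const] show ?thesis .
qed

section \<open>A twice differentiable cutoff and its derivatives\<close>

lemma max_0_power2_deriv: "((\<lambda>y::real. (max 0 y)\<^sup>2) has_real_derivative 2 * max 0 y) (at y)"
proof -
  consider "y < 0" | "y = 0" | "y > 0" by linarith
  then show ?thesis
  proof cases
    case 1
    have "((\<lambda>y::real. 0) has_real_derivative 2 * max 0 y) (at y)" using 1 by simp
    then show ?thesis
      by (rule has_field_derivative_transform_within_open[where S = "{..<0}"]) (use 1 in auto)
  next
    case 2
    have "((\<lambda>h::real. (max 0 h)\<^sup>2 / h) \<longlongrightarrow> 0) (at 0)"
    proof (rule Lim_null_comparison)
      show "\<forall>\<^sub>F h in at 0. norm ((max 0 h)\<^sup>2 / h) \<le> \<bar>h\<bar>"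
        by (rule always_eventually) (auto simp: max_def power2_eq_square abs_mult)
      show "((\<lambda>h::real. \<bar>h\<bar>) \<longlongrightarrow> 0) (at 0)" using tendsto_rabs_zero[OF tendsto_ident_at] by simp
    qed
    then show ?thesis using 2 by (simp add: DERIV_def)
  next
    case 3
    have "((\<lambda>y::real. y\<^sup>2) has_real_derivative 2 * max 0 y) (at y)"
      using 3 by (auto intro!: derivative_eq_intros)
    then show ?thesis
      by (rule has_field_derivative_transform_within_open[where S = "{0<..}"]) (use 3 in auto)
  qed
qed

lemma max_0_power3_deriv: "((\<lambda>y::real. (max 0 y)^3) has_real_derivative 3 * (max 0 y)\<^sup>2) (at y)"
proof -
  have "(\<lambda>y::real. (max 0 y)^3) = (\<lambda>y. y * (max 0 y)\<^sup>2)"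
    by (auto simp: fun_eq_iff max_def power2_eq_square power3_eq_cube)
  moreover have "((\<lambda>y::real. y * (max 0 y)\<^sup>2) has_real_derivative 1 * (max 0 y)\<^sup>2 + (2 * max 0 y) * y) (at y)"
    by (rule DERIV_mult[OF DERIV_ident max_0_power2_deriv])
  moreover have "1 * (max 0 y)\<^sup>2 + (2 * max 0 y) * y = 3 * (max 0 y)\<^sup>2"
    by (auto simp: max_def power2_eq_square)
  ultimately show ?thesis by (simp only:)
qed

text \<open>The cutoff used is the cube of this function. Two derivatives fall on it, and the cube
  is the lowest integer power of a positive part that is twice continuously differentiable.\<close>

definition bump :: "real \<Rightarrow> 'a::euclidean_space \<Rightarrow> real" where
  "bump R x = max 0 (1 - (norm x)\<^sup>2 / R\<^sup>2)"

text \<open>The first derivative of \<open>bump R x ^ 3\<close> in the direction \<open>u\<close>;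
  \<open>bump_curvature\<close> is the second.\<close>

definition bump_slope :: "real \<Rightarrow> 'a::euclidean_space \<Rightarrow> 'a \<Rightarrow> real" where
  "bump_slope R u x = - 6 * (bump R x)\<^sup>2 * (x \<bullet> u) / R\<^sup>2"

definition bump_curvature :: "real \<Rightarrow> 'a::euclidean_space \<Rightarrow> 'a \<Rightarrow> real" where
  "bump_curvature R u x = 24 * bump R x * (x \<bullet> u)\<^sup>2 / R^4 - 6 * (bump R x)\<^sup>2 / R\<^sup>2"

lemma bump_outside: "R > 0 \<Longrightarrow> norm x > R \<Longrightarrow> bump R x = 0"
  using power_strict_mono[of R "norm x" 2] by (simp add: bump_def)

lemma bump_le_1: "0 \<le> bump R x" "bump R x \<le> 1"
  by (auto simp: bump_def)

context
  fixes R :: real and u :: "'a::euclidean_space"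
  assumes R: "R > 0" and u: "u \<in> Basis"
begin

lemma bump_line: "bump R (x + t *\<^sub>R u) = max 0 (1 - ((norm x)\<^sup>2 + 2 * t * (x \<bullet> u) + t\<^sup>2) / R\<^sup>2)"
proof -
  have "(norm (x + t *\<^sub>R u))\<^sup>2 = (norm x)\<^sup>2 + 2 * t * (x \<bullet> u) + t\<^sup>2"
    using u unfolding power2_norm_eq_inner
    by (simp add: inner_simps inner_commute[of u x] inner_Basis power2_eq_square algebra_simps)
  then show ?thesis by (simp add: bump_def)
qed

lemma bump_line_inner_deriv:
  "((\<lambda>t. 1 - ((norm x)\<^sup>2 + 2 * t * (x \<bullet> u) + t\<^sup>2) / R\<^sup>2) has_real_derivative - 2 * (x \<bullet> u) / R\<^sup>2) (at 0)"
proof -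
  have "((\<lambda>t. (norm x)\<^sup>2 + 2 * t * (x \<bullet> u) + t\<^sup>2) has_real_derivative 2 * (x \<bullet> u)) (at 0)"
    by (auto intro!: derivative_eq_intros)
  from DERIV_diff[OF DERIV_const[of 1] DERIV_cdivide[OF this, of "R\<^sup>2"]] show ?thesis by simp
qed

lemma bump_line_deriv:
  "((\<lambda>t. of_real (bump R (x + t *\<^sub>R u) ^ 3) :: complex) has_vector_derivative of_real (bump_slope R u x)) (at 0)"
proof -
  have "((\<lambda>t. (bump R (x + t *\<^sub>R u)) ^ 3) has_real_derivative
      3 * (bump R (x + 0 *\<^sub>R u))\<^sup>2 * (- 2 * (x \<bullet> u) / R\<^sup>2)) (at 0)"
    unfolding bump_line by (rule DERIV_chain2[OF max_0_power3_deriv bump_line_inner_deriv])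
  then have "((\<lambda>t. (bump R (x + t *\<^sub>R u)) ^ 3) has_vector_derivative bump_slope R u x) (at 0)"
    by (simp add: bump_slope_def has_real_derivative_iff_has_vector_derivative mult.assoc)
  then show ?thesis by (rule bounded_linear.has_vector_derivative[OF bounded_linear_of_real])
qed

lemma bump_slope_line_deriv:
  "((\<lambda>t. of_real (bump_slope R u (x + t *\<^sub>R u)) :: complex) has_vector_derivative of_real (bump_curvature R u x)) (at 0)"
proof -
  have 1: "((\<lambda>t. (bump R (x + t *\<^sub>R u))\<^sup>2) has_real_derivative
      2 * (bump R (x + 0 *\<^sub>R u)) * (- 2 * (x \<bullet> u) / R\<^sup>2)) (at 0)"
    unfolding bump_line by (rule DERIV_chain2[OF max_0_power2_deriv bump_line_inner_deriv])
  have "(\<lambda>t. (x + t *\<^sub>R u) \<bullet> u) = (\<lambda>t. x \<bullet> u + t)"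
    using u by (simp add: inner_simps inner_Basis)
  then have 2: "((\<lambda>t. (x + t *\<^sub>R u) \<bullet> u) has_real_derivative 1) (at 0)"
    by (auto intro!: derivative_eq_intros)
  have "((\<lambda>t. - 6 / R\<^sup>2 * ((bump R (x + t *\<^sub>R u))\<^sup>2 * ((x + t *\<^sub>R u) \<bullet> u))) has_real_derivative
     - 6 / R\<^sup>2 * (2 * (bump R (x + 0 *\<^sub>R u)) * (- 2 * (x \<bullet> u) / R\<^sup>2) * ((x + 0 *\<^sub>R u) \<bullet> u) + 1 * (bump R (x + 0 *\<^sub>R u))\<^sup>2)) (at 0)"
    by (rule DERIV_cmult[OF DERIV_mult[OF 1 2]])
  moreover have "- 6 / R\<^sup>2 * (2 * b * (- 2 * y / R\<^sup>2) * y + 1 * b\<^sup>2) = 24 * b * y\<^sup>2 / R^4 - 6 * b\<^sup>2 / R\<^sup>2" for b y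
    using R by (simp add: field_simps power2_eq_square power4_eq_xxxx)
  ultimately have "((\<lambda>t. bump_slope R u (x + t *\<^sub>R u)) has_vector_derivative bump_curvature R u x) (at 0)"
    unfolding bump_slope_def bump_curvature_def has_real_derivative_iff_has_vector_derivative[symmetric]
    by (simp add: mult.assoc)
  then show ?thesis by (rule bounded_linear.has_vector_derivative[OF bounded_linear_of_real])
qed

text \<open>On the support \<open>\<bar>x \<bullet> u\<bar> \<le> R\<close>, so every derivative of
  the cutoff gains a factor \<open>1 / R\<close>. This is the source of the decay of the cutoff
  error.\<close>

lemma bump_slope_le: "\<bar>bump_slope R u x\<bar> \<le> 6 / R"
proof (cases "norm x > R")
  case False
  have "\<bar>x \<bullet> u\<bar> \<le> R" using Basis_le_norm[OF u, of x] False by simp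
  then have "6 * (bump R x)\<^sup>2 * \<bar>x \<bullet> u\<bar> \<le> 6 * 1 * R"
    using bump_le_1[of R x] by (intro mult_mono) (auto simp: power_le_one)
  then have "6 * (bump R x)\<^sup>2 * \<bar>x \<bullet> u\<bar> / R\<^sup>2 \<le> 6 * 1 * R / R\<^sup>2"
    by (rule divide_right_mono) simp
  also have "\<dots> = 6 / R" using R by (simp add: power2_eq_square)
  finally show ?thesis by (simp add: bump_slope_def abs_mult)
qed (use R in \<open>simp add: bump_slope_def bump_outside\<close>)

lemma bump_curvature_le: "\<bar>bump_curvature R u x\<bar> \<le> 30 / R\<^sup>2"
proof (cases "norm x > R")
  case False
  have "\<bar>x \<bullet> u\<bar> \<le> R" using Basis_le_norm[OF u, of x] False by simp
  then have "(x \<bullet> u)\<^sup>2 \<le> R\<^sup>2" using R by (simp add: abs_le_square_iff[symmetric])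
  then have "24 * bump R x * (x \<bullet> u)\<^sup>2 \<le> 24 * 1 * R\<^sup>2"
    using bump_le_1[of R x] by (intro mult_mono) auto
  then have "24 * bump R x * (x \<bullet> u)\<^sup>2 / R^4 \<le> 24 * 1 * R\<^sup>2 / R^4"
    by (rule divide_right_mono) simp
  also have "\<dots> = 24 / R\<^sup>2" using R by (simp add: field_simps power2_eq_square power4_eq_xxxx)
  finally have 1: "24 * bump R x * (x \<bullet> u)\<^sup>2 / R^4 \<le> 24 / R\<^sup>2" .
  have 2: "6 * (bump R x)\<^sup>2 / R\<^sup>2 \<le> 6 / R\<^sup>2"
    using bump_le_1[of R x] by (intro divide_right_mono) (auto simp: power_le_one)
  have 3: "0 \<le> 24 * bump R x * (x \<bullet> u)\<^sup>2 / R^4" "0 \<le> 6 * (bump R x)\<^sup>2 / R\<^sup>2"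
    using bump_le_1[of R x] by simp_all
  have "30 / R\<^sup>2 = 24 / R\<^sup>2 + 6 / R\<^sup>2" by (simp add: add_divide_distrib[symmetric])
  then show ?thesis using 1 2 3 unfolding bump_curvature_def by linarith
qed (use R in \<open>simp add: bump_curvature_def bump_outside\<close>)

end

lemma continuous_on_bump [continuous_intros]:
  "continuous_on S f \<Longrightarrow> continuous_on S (\<lambda>x. bump R (f x))"
  unfolding bump_def divide_inverse by (intro continuous_intros)

lemma continuous_on_bump_slope [continuous_intros]:
  "continuous_on S f \<Longrightarrow> continuous_on S (\<lambda>x. bump_slope R u (f x))"
  unfolding bump_slope_def divide_inverse by (intro continuous_intros)

lemma continuous_on_bump_curvature [continuous_intros]:
  "continuous_on S f \<Longrightarrow> continuous_on S (\<lambda>x. bump_curvature R u (f x))"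
  unfolding bump_curvature_def divide_inverse by (intro continuous_intros)

section \<open>Uniqueness of bounded solutions\<close>

lemma continuous_on_bounded_interval:
  fixes f :: "real \<Rightarrow> complex"
  assumes "continuous_on {a..b} f"
  shows "\<exists>C\<ge>0. \<forall>z\<in>{a..b}. norm (f z) \<le> C"
proof -
  have "bounded (f ` {a..b})" by (intro compact_imp_bounded compact_continuous_image assms) auto
  then obtain C where "\<forall>x\<in>f ` {a..b}. norm x \<le> C" unfolding bounded_iff by (rule exE)
  then have "\<forall>z\<in>{a..b}. norm (f z) \<le> max 0 C" by (auto simp: max.coboundedI2)
  then show ?thesis by (intro exI[of _ "max 0 C"]) auto
qed

lemma norm_gauss_le:
  fixes p \<tau> :: "'a::euclidean_space"
  assumes "a \<le> Re A" "norm B \<le> b" "norm C \<le> c"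
  shows "norm (gauss A B p C \<tau>) \<le> exp c * exp (2 * b * norm p * norm \<tau> - a * (norm \<tau>)\<^sup>2)"
proof -
  have "Re (2 * B * of_real (p \<bullet> \<tau>)) \<le> norm (2 * B * of_real (p \<bullet> \<tau>))" by (rule complex_Re_le_cmod)
  also have "\<dots> = 2 * norm B * \<bar>p \<bullet> \<tau>\<bar>" by (simp add: norm_mult)
  also have "\<dots> \<le> 2 * b * (norm p * norm \<tau>)"
    using assms(2) by (intro mult_mono Cauchy_Schwarz_ineq2) (auto intro: order_trans[OF norm_ge_zero])
  finally have 1: "Re (2 * B * of_real (p \<bullet> \<tau>)) \<le> 2 * b * norm p * norm \<tau>" by (simp add: mult_ac)
  have 2: "a * (norm \<tau>)\<^sup>2 \<le> Re (A * of_real ((norm \<tau>)\<^sup>2))"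
    using mult_right_mono[OF assms(1), of "(norm \<tau>)\<^sup>2"] by simp
  have 3: "Re C \<le> c" using complex_Re_le_cmod[of C] assms(3) by linarith
  have "norm (gauss A B p C \<tau>) = exp (- Re (A * of_real ((norm \<tau>)\<^sup>2)) + Re (2 * B * of_real (p \<bullet> \<tau>)) + Re C)"
    unfolding gauss_def norm_exp_eq_Re by simp
  also have "\<dots> \<le> exp (c + (2 * b * norm p * norm \<tau> - a * (norm \<tau>)\<^sup>2))"
    using 1 2 3 by (subst exp_le_cancel_iff) linarith
  finally show ?thesis by (simp only: exp_add)
qed

lemma norm_gauss_slope_le:
  assumes "u \<in> Basis" "norm A \<le> a" "norm B \<le> b"
  shows "norm (gauss_slope A B p u \<tau>) \<le> (2 * a + 2 * b * norm p) * (1 + norm \<tau>)"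
proof -
  have "norm (gauss_slope A B p u \<tau>) \<le> norm (- 2 * A * of_real (\<tau> \<bullet> u)) + norm (2 * B * of_real (p \<bullet> u))"
    unfolding gauss_slope_def by (rule norm_triangle_ineq)
  also have "\<dots> = 2 * norm A * \<bar>\<tau> \<bullet> u\<bar> + 2 * norm B * \<bar>p \<bullet> u\<bar>" by (simp add: norm_mult)
  also have "\<dots> \<le> 2 * a * norm \<tau> + 2 * b * norm p"
    using assms Basis_le_norm[OF assms(1)] order_trans[OF norm_ge_zero assms(2)] order_trans[OF norm_ge_zero assms(3)]
    by (intro add_mono mult_mono) auto
  also have "\<dots> \<le> (2 * a + 2 * b * norm p) * (1 + norm \<tau>)"
    using order_trans[OF norm_ge_zero assms(2)] order_trans[OF norm_ge_zero assms(3)]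
    by (simp add: algebra_simps)
  finally show ?thesis .
qed

context schroedinger_params
begin

definition moment_solution :: "(real \<Rightarrow> 'a::euclidean_space \<Rightarrow> complex) \<Rightarrow> bool" where
  "moment_solution M \<longleftrightarrow> classical_regularity M \<and>
     (\<forall>Z. \<exists>C. \<forall>z\<in>{0..Z}. \<forall>\<tau>. norm (M z \<tau>) \<le> C) \<and>
     (\<forall>\<tau>. M 0 \<tau> = 1) \<and>
     (\<forall>z>0. \<forall>\<tau>. ((\<lambda>s. M s \<tau>) has_vector_derivative
        (K * laplacian (M z) \<tau> - of_real (\<gamma> * (norm \<tau>)\<^sup>2) * M z \<tau>)) (at z))"

text \<open>The assumptions on \<open>A\<close>, \<open>B\<close>, \<open>C\<close> say that the
  Gaussian \<open>E\<close> with these coefficients solves the dual equation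
  \<open>E' = - K \<Delta>E + \<gamma> \<bar>\<tau>\<bar>\<^sup>2 E\<close>. Positivity of
  \<open>Re A\<close> makes the products with a bounded \<open>M\<close> integrable.\<close>

context
  fixes M :: "real \<Rightarrow> 'a::euclidean_space \<Rightarrow> complex" and p :: 'a and T :: real and A B C :: "real \<Rightarrow> complex"
  assumes sol: "moment_solution M" and T: "T > 0"
    and dA: "\<And>z. z \<in> {0..T} \<Longrightarrow> (A has_vector_derivative 4 * K * (A z)\<^sup>2 - of_real \<gamma>) (at z within {0..T})"
    and dB: "\<And>z. z \<in> {0..T} \<Longrightarrow> (B has_vector_derivative 4 * K * A z * B z) (at z within {0..T})"
    and dC: "\<And>z. z \<in> {0..T} \<Longrightarrow> (C has_vector_derivative
        2 * K * of_nat DIM('a) * A z - 4 * K * (B z)\<^sup>2 * of_real ((norm p)\<^sup>2)) (at z within {0..T})"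
    and ReA: "\<And>z. z \<in> {0..T} \<Longrightarrow> Re (A z) > 0"
begin

private abbreviation (input) "E z \<equiv> gauss (A z) (B z) p (C z)"
private abbreviation (input) "cutoff R \<tau> \<equiv> complex_of_real (bump R \<tau> ^ 3)"
private abbreviation (input) "dM u z \<equiv> dir_deriv (M z) u"
private abbreviation (input) "ddM u z \<equiv> dir_deriv (dir_deriv (M z) u) u"
private abbreviation (input) "slope u z \<equiv> gauss_slope (A z) (B z) p u"

text \<open>The \<open>z\<close>-derivative of \<open>\<integral> M E \<chi>\<close> is, up to the integral of a divergence, the integral of terms
  with derivatives of the cutoff \<open>\<chi>\<close>, which is \<open>O(1 / R)\<close>.\<close>

definition dtE :: "real \<Rightarrow> 'a \<Rightarrow> complex" where
  "dtE z \<tau> = (- (4 * K * (A z)\<^sup>2 - of_real \<gamma>) * of_real ((norm \<tau>)\<^sup>2) + 2 * (4 * K * A z * B z) * of_real (p \<bullet> \<tau>)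
      + (2 * K * of_nat DIM('a) * A z - 4 * K * (B z)\<^sup>2 * of_real ((norm p)\<^sup>2))) * E z \<tau>"

definition dt_integrand :: "real \<Rightarrow> real \<Rightarrow> 'a \<Rightarrow> complex" where
  "dt_integrand R z \<tau> = (M z \<tau> * dtE z \<tau> +
     (K * laplacian (M z) \<tau> - of_real (\<gamma> * (norm \<tau>)\<^sup>2) * M z \<tau>) * E z \<tau>) * cutoff R \<tau>"

text \<open>\<open>M\<close> times the \<open>u\<close>-part of
  \<open>\<Delta>(E \<chi>) - \<chi> \<Delta>E\<close>, where \<open>\<chi>\<close> is the
  cutoff.\<close>

definition commutator :: "real \<Rightarrow> real \<Rightarrow> 'a \<Rightarrow> 'a \<Rightarrow> complex" where
  "commutator R z u \<tau> = M z \<tau> * (2 * slope u z \<tau> * E z \<tau> * of_real (bump_slope R u \<tau>)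
     + E z \<tau> * of_real (bump_curvature R u \<tau>))"

text \<open>The \<open>u\<close>-part of the Green expression
  \<open>\<Delta>M (E \<chi>) - M \<Delta>(E \<chi>)\<close>.\<close>

definition flux_div :: "real \<Rightarrow> real \<Rightarrow> 'a \<Rightarrow> 'a \<Rightarrow> complex" where
  "flux_div R z u \<tau> = ddM u z \<tau> * (E z \<tau> * cutoff R \<tau>) -
     M z \<tau> * ((slope u z \<tau> * slope u z \<tau> - 2 * A z) * E z \<tau> * cutoff R \<tau>
       + 2 * slope u z \<tau> * E z \<tau> * of_real (bump_slope R u \<tau>) + E z \<tau> * of_real (bump_curvature R u \<tau>))"

lemma contA: "continuous_on {0..T} A" and contB: "continuous_on {0..T} B" and contC: "continuous_on {0..T} C"
  by (rule continuous_on_vector_derivative, erule dA dB dC)+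

lemma contM: "continuous_on ({0..} \<times> UNIV) (\<lambda>(z, \<tau>). M z \<tau>)"
  using sol by (simp add: moment_solution_def classical_regularity_def)

text \<open>The differentiability clauses of \<open>classical_regularity\<close> turn the values of
  \<open>dir_deriv\<close> into actual derivatives.\<close>

lemma
  assumes "u \<in> Basis"
  shows contdM: "continuous_on ({0<..} \<times> UNIV) (\<lambda>(z, \<tau>). dM u z \<tau>)"
    and contddM: "continuous_on ({0<..} \<times> UNIV) (\<lambda>(z, \<tau>). ddM u z \<tau>)"
    and dM_line: "z > 0 \<Longrightarrow> ((\<lambda>t. M z (\<tau> + t *\<^sub>R u)) has_vector_derivative dM u z \<tau>) (at 0)"
    and ddM_line: "z > 0 \<Longrightarrow> ((\<lambda>t. dM u z (\<tau> + t *\<^sub>R u)) has_vector_derivative ddM u z \<tau>) (at 0)"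
proof -
  have reg: "\<forall>u\<in>Basis.
        (\<forall>z>0. \<forall>\<tau>. (\<lambda>t. M z (\<tau> + t *\<^sub>R u)) differentiable (at 0)) \<and>
        continuous_on ({0<..} \<times> UNIV) (\<lambda>(z, \<tau>). dir_deriv (M z) u \<tau>) \<and>
        (\<forall>v\<in>Basis.
           (\<forall>z>0. \<forall>\<tau>. (\<lambda>t. dir_deriv (M z) u (\<tau> + t *\<^sub>R v)) differentiable (at 0)) \<and>
           continuous_on ({0<..} \<times> UNIV) (\<lambda>(z, \<tau>). dir_deriv (dir_deriv (M z) u) v \<tau>))"
    using sol unfolding moment_solution_def classical_regularity_def by (elim conjE)
  show "continuous_on ({0<..} \<times> UNIV) (\<lambda>(z, \<tau>). dM u z \<tau>)"
    "continuous_on ({0<..} \<times> UNIV) (\<lambda>(z, \<tau>). ddM u z \<tau>)"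
    using reg assms by blast+
  show "((\<lambda>t. M z (\<tau> + t *\<^sub>R u)) has_vector_derivative dM u z \<tau>) (at 0)" if "z > 0"
    unfolding dir_deriv_def[of "M z" u \<tau>] using reg assms that
    by (intro vector_derivative_works[THEN iffD1]) blast
  show "((\<lambda>t. dM u z (\<tau> + t *\<^sub>R u)) has_vector_derivative ddM u z \<tau>) (at 0)" if "z > 0"
    unfolding dir_deriv_def[of "dM u z" u \<tau>] using reg assms that
    by (intro vector_derivative_works[THEN iffD1]) blast
qed

lemma cont_slice:
  assumes "z > 0" "u \<in> Basis"
  shows "continuous_on UNIV (M z)" "continuous_on UNIV (dM u z)" "continuous_on UNIV (ddM u z)"
  using continuous_on_slice[OF contM, of z] continuous_on_slice[OF contdM[OF assms(2)], of z]
    continuous_on_slice[OF contddM[OF assms(2)], of z] assms(1) by auto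

text \<open>Green's identity in one direction: the integrand is the \<open>u\<close>-derivative of
  \<open>\<partial>M (E \<chi>) - M \<partial>(E \<chi>)\<close>, the mixed products cancelling. The
  derivatives of \<open>M\<close> carry no growth bound; the compact support of the cutoff makes the
  integral exist and vanish.\<close>

lemma flux_div_integral:
  assumes R: "R > 0" and z: "z > 0" and u: "u \<in> Basis"
  shows "(LINT \<tau>|lborel. flux_div R z u \<tau>) = 0" "integrable lborel (flux_div R z u)"
proof -
  note c = cont_slice[OF z u]
  define f where "f \<tau> = dM u z \<tau> * (E z \<tau> * cutoff R \<tau>) -
     M z \<tau> * (slope u z \<tau> * E z \<tau> * cutoff R \<tau> + E z \<tau> * of_real (bump_slope R u \<tau>))" for \<tau>
  have cf: "continuous_on UNIV f" unfolding f_def by (intro continuous_intros c)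
  have cf': "continuous_on UNIV (flux_div R z u)"
    unfolding flux_div_def[abs_def] by (intro continuous_intros c)
  have supp: "norm \<tau> > R \<Longrightarrow> f \<tau> = 0" "norm \<tau> > R \<Longrightarrow> flux_div R z u \<tau> = 0" for \<tau>
    by (simp_all add: f_def flux_div_def bump_outside[OF R] bump_slope_def bump_curvature_def)
  show "integrable lborel (flux_div R z u)"
    by (rule integrable_compact_support[OF cf' supp(2)])
  have "((\<lambda>t. f (\<tau> + t *\<^sub>R u)) has_vector_derivative flux_div R z u \<tau>) (at 0)" for \<tau>
  proof -
    have 1: "((\<lambda>t. E z (\<tau> + t *\<^sub>R u) * cutoff R (\<tau> + t *\<^sub>R u)) has_vector_derivative
       E z \<tau> * of_real (bump_slope R u \<tau>) + slope u z \<tau> * E z \<tau> * cutoff R \<tau>) (at 0)"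
      using has_vector_derivative_mult[OF gauss_line_deriv[OF u, of "A z" "B z" p "C z" \<tau>] bump_line_deriv[OF R u, of \<tau>]] by simp
    have 2: "((\<lambda>t. slope u z (\<tau> + t *\<^sub>R u) * E z (\<tau> + t *\<^sub>R u) * cutoff R (\<tau> + t *\<^sub>R u)) has_vector_derivative
       slope u z \<tau> * E z \<tau> * of_real (bump_slope R u \<tau>) +
       (slope u z \<tau> * slope u z \<tau> - 2 * A z) * E z \<tau> * cutoff R \<tau>) (at 0)"
      using has_vector_derivative_mult[OF gauss_line_deriv2[OF u, of "A z" "B z" p u \<tau> "C z"] bump_line_deriv[OF R u, of \<tau>]] u
      by (simp add: inner_Basis)
    have 3: "((\<lambda>t. E z (\<tau> + t *\<^sub>R u) * of_real (bump_slope R u (\<tau> + t *\<^sub>R u))) has_vector_derivative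
       E z \<tau> * of_real (bump_curvature R u \<tau>) + slope u z \<tau> * E z \<tau> * of_real (bump_slope R u \<tau>)) (at 0)"
      using has_vector_derivative_mult[OF gauss_line_deriv[OF u, of "A z" "B z" p "C z" \<tau>] bump_slope_line_deriv[OF R u, of \<tau>]] by simp
    note d = has_vector_derivative_diff[OF has_vector_derivative_mult[OF ddM_line[OF u z, of \<tau>] 1]
        has_vector_derivative_mult[OF dM_line[OF u z, of \<tau>] has_vector_derivative_add[OF 2 3]]]
    show ?thesis
      unfolding f_def by (rule has_vector_derivative_eq_rhs[OF d]) (simp add: flux_div_def algebra_simps)
  qed
  then show "(LINT \<tau>|lborel. flux_div R z u \<tau>) = 0"
    by (rule integral_dir_deriv_0[OF cf cf' _ supp])
qed

lemma commutator_integrable: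
  assumes R: "R > 0" and z: "z > 0" and u: "u \<in> Basis"
  shows "integrable lborel (commutator R z u)"
proof (rule integrable_compact_support[where R = R])
  show "continuous_on UNIV (commutator R z u)"
    unfolding commutator_def[abs_def] by (intro continuous_intros cont_slice[OF z u])
qed (simp add: commutator_def bump_outside[OF R] bump_slope_def bump_curvature_def)

text \<open>The potential terms cancel because \<open>E\<close> solves the dual equation. What
  remains is \<open>K (\<Delta>M E - M \<Delta>E) \<chi>\<close>, and replacing
  \<open>\<chi> \<Delta>E\<close> by \<open>\<Delta>(E \<chi>)\<close> costs the commutator.\<close>

lemma dt_integrand_eq:
  "dt_integrand R z \<tau> = K * (\<Sum>u\<in>Basis. flux_div R z u \<tau> + commutator R z u \<tau>)"
proof -
  have s: "dtE z \<tau> = (of_real (\<gamma> * (norm \<tau>)\<^sup>2) - K * (\<Sum>u\<in>Basis. (slope u z \<tau>)\<^sup>2 - 2 * A z)) * E z \<tau>"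
    unfolding dtE_def sum_gauss_slope_square by (simp add: algebra_simps)
  have "(\<Sum>u\<in>Basis. flux_div R z u \<tau> + commutator R z u \<tau>)
      = (\<Sum>u\<in>Basis. ddM u z \<tau> * (E z \<tau> * cutoff R \<tau>) - ((slope u z \<tau>)\<^sup>2 - 2 * A z) * (M z \<tau> * E z \<tau> * cutoff R \<tau>))"
    by (rule sum.cong) (simp_all add: flux_div_def commutator_def algebra_simps power2_eq_square)
  also have "\<dots> = laplacian (M z) \<tau> * (E z \<tau> * cutoff R \<tau>)
      - (\<Sum>u\<in>Basis. (slope u z \<tau>)\<^sup>2 - 2 * A z) * (M z \<tau> * E z \<tau> * cutoff R \<tau>)"
    unfolding laplacian_def sum_distrib_right by (rule sum_subtractf)
  finally have t: "(\<Sum>u\<in>Basis. flux_div R z u \<tau> + commutator R z u \<tau>) = laplacian (M z) \<tau> * (E z \<tau> * cutoff R \<tau>)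
      - (\<Sum>u\<in>Basis. (slope u z \<tau>)\<^sup>2 - 2 * A z) * (M z \<tau> * E z \<tau> * cutoff R \<tau>)" .
  show ?thesis
    unfolding dt_integrand_def s t by (simp add: algebra_simps)
qed

lemma integral_dt_integrand:
  assumes R: "R > 0" and z: "z > 0"
  shows "(LINT \<tau>|lborel. dt_integrand R z \<tau>) = K * (\<Sum>u\<in>Basis. LINT \<tau>|lborel. commutator R z u \<tau>)"
  unfolding dt_integrand_eq using flux_div_integral[OF R z] commutator_integrable[OF R z] by simp

lemma cutoff_integral_deriv:
  assumes R: "R > 0" and z: "0 < z" "z < T"
  shows "((\<lambda>z. LINT \<tau>|lborel. M z \<tau> * E z \<tau> * cutoff R \<tau>) has_vector_derivative
     (LINT \<tau>|lborel. dt_integrand R z \<tau>)) (at z)"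
proof -
  \<comment> \<open>The interval lies strictly inside \<open>(0, T)\<close>, because the equation
    and the continuity of the \<open>\<tau>\<close>-derivatives hold for \<open>z > 0\<close>
    only.\<close>
  define a where "a = z / 2"
  define b where "b = (z + T) / 2"
  have ab: "0 < a" "a < z" "z < b" "b < T" using z by (auto simp: a_def b_def)
  have sub: "{a..b} \<subseteq> {0..T}" "{a..b} \<times> UNIV \<subseteq> {0..} \<times> UNIV" "{a..b} \<times> UNIV \<subseteq> {0<..} \<times> UNIV"
    using ab by auto
  have fsts: "continuous_on ({a..b} \<times> UNIV) (\<lambda>x. A (fst x))" "continuous_on ({a..b} \<times> UNIV) (\<lambda>x. B (fst x))"
     "continuous_on ({a..b} \<times> UNIV) (\<lambda>x. C (fst x))"
    using sub(1) by (auto intro!: continuous_on_compose2[OF contA] continuous_on_compose2[OF contB]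
        continuous_on_compose2[OF contC] continuous_intros)
  have cM: "continuous_on ({a..b} \<times> UNIV) (\<lambda>x. M (fst x) (snd x))"
    using continuous_on_subset[OF contM sub(2)] by (simp add: case_prod_beta)
  have cL: "continuous_on ({a..b} \<times> UNIV) (\<lambda>x. laplacian (M (fst x)) (snd x))"
    unfolding laplacian_def
    by (intro continuous_on_sum) (use continuous_on_subset[OF contddM sub(3)] in \<open>simp add: case_prod_beta\<close>)
  have "((\<lambda>z. LINT \<tau>|lborel. M z \<tau> * E z \<tau> * cutoff R \<tau>) has_vector_derivative
     (LINT \<tau>|lborel. dt_integrand R z \<tau>)) (at z within {a..b})"
  proof (rule integral_param_deriv_compact_support[where R = R])
    show "z \<in> {a..b}" using ab by simp
    show "continuous_on UNIV (\<lambda>\<tau>. M s \<tau> * E s \<tau> * cutoff R \<tau>)" if "s \<in> {a..b}" for s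
      using that ab by (intro continuous_intros continuous_on_slice[OF contM]) auto
    show "continuous_on ({a..b} \<times> UNIV) (\<lambda>(z, x). dt_integrand R z x)"
      unfolding dt_integrand_def dtE_def case_prod_beta by (intro continuous_intros fsts cM cL)
    show "((\<lambda>s. M s \<tau> * E s \<tau> * cutoff R \<tau>) has_vector_derivative dt_integrand R s \<tau>) (at s within {a..b})"
      if s: "s \<in> {a..b}" for s \<tau>
    proof -
      have "s \<in> {0..T}" "s > 0" using s ab by auto
      have 1: "((\<lambda>s. E s \<tau>) has_vector_derivative dtE s \<tau>) (at s within {a..b})"
        unfolding dtE_def
        by (intro gauss_param_deriv has_vector_derivative_within_subset[OF dA[OF \<open>s \<in> {0..T}\<close>] sub(1)]
            has_vector_derivative_within_subset[OF dB[OF \<open>s \<in> {0..T}\<close>] sub(1)]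
            has_vector_derivative_within_subset[OF dC[OF \<open>s \<in> {0..T}\<close>] sub(1)])
      have 2: "((\<lambda>s. M s \<tau>) has_vector_derivative
        (K * laplacian (M s) \<tau> - of_real (\<gamma> * (norm \<tau>)\<^sup>2) * M s \<tau>)) (at s within {a..b})"
        using sol \<open>s > 0\<close> by (simp add: moment_solution_def has_vector_derivative_at_within)
      show ?thesis
        unfolding dt_integrand_def
        by (intro has_vector_derivative_mult_left has_vector_derivative_mult 1 2)
    qed
  qed (simp_all add: bump_outside[OF R] dt_integrand_def)
  moreover have "at z within {a..b} = at z" using ab by (intro at_within_interior) auto
  ultimately show ?thesis by simp
qed

text \<open>One integrable \<open>g\<close> serves all \<open>z\<close> and \<open>R\<close>: it
  removes the cutoff by dominated convergence and makes the commutator \<open>O(1 / R)\<close>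
  uniformly in \<open>z\<close>. Compactness of \<open>[0, T]\<close> gives a positive lower bound
  for \<open>Re A\<close> and upper bounds for \<open>A\<close>, \<open>B\<close>, \<open>C\<close>;
  the factor \<open>(1 + norm \<tau>)\<^sup>2\<close> in \<open>g\<close> pays for the linear growth
  of the slope.\<close>

lemma gaussian_pairing_dominated:
  "\<exists>(g :: 'a \<Rightarrow> real) L. integrable lborel g \<and> (\<forall>\<tau>. g \<tau> \<ge> 0) \<and> L \<ge> 0 \<and>
    (\<forall>z\<in>{0..T}. \<forall>\<tau>. norm (M z \<tau> * E z \<tau>) \<le> g \<tau>) \<and>
    (\<forall>R\<ge>1. \<forall>z\<in>{0..T}. \<forall>u\<in>Basis. \<forall>\<tau>. norm (commutator R z u \<tau>) \<le> L / R * g \<tau>)"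
proof -
  have "\<exists>z0\<in>{0..T}. \<forall>z\<in>{0..T}. Re (A z0) \<le> Re (A z)"
    using T contA by (intro continuous_attains_inf continuous_intros) auto
  then obtain z0 where z0: "z0 \<in> {0..T}" "\<And>z. z \<in> {0..T} \<Longrightarrow> Re (A z0) \<le> Re (A z)" by blast
  define m where "m = Re (A z0)"
  have m: "m > 0" using ReA[OF z0(1)] by (simp add: m_def)
  obtain a where a: "a \<ge> 0" "\<And>z. z \<in> {0..T} \<Longrightarrow> norm (A z) \<le> a"
    using continuous_on_bounded_interval[OF contA] by blast
  obtain b where b: "b \<ge> 0" "\<And>z. z \<in> {0..T} \<Longrightarrow> norm (B z) \<le> b"
    using continuous_on_bounded_interval[OF contB] by blast
  obtain c where c: "c \<ge> 0" "\<And>z. z \<in> {0..T} \<Longrightarrow> norm (C z) \<le> c"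
    using continuous_on_bounded_interval[OF contC] by blast
  obtain k where k0: "\<forall>z\<in>{0..T}. \<forall>\<tau>. norm (M z \<tau>) \<le> k"
    using sol unfolding moment_solution_def by blast
  have k: "norm (M z \<tau>) \<le> k" if "z \<in> {0..T}" for z \<tau> using k0 that by blast
  have "norm (M 0 0) = 1" using sol by (simp add: moment_solution_def)
  then have k1: "k \<ge> 1" using k[of 0 0] T by simp
  define e where "e \<tau> = exp c * exp (2 * b * norm p * norm \<tau> - m * (norm \<tau>)\<^sup>2)" for \<tau> :: 'a
  define g where "g \<tau> = k * exp c * ((1 + norm \<tau>)\<^sup>2 * exp (2 * b * norm p * norm \<tau> - m * (norm \<tau>)\<^sup>2))" for \<tau> :: 'a
  have ge: "g \<tau> = k * ((1 + norm \<tau>)\<^sup>2 * e \<tau>)" for \<tau> by (simp add: g_def e_def)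
  have e0: "e \<tau> \<ge> 0" for \<tau> by (simp add: e_def)
  have E: "norm (E z \<tau>) \<le> e \<tau>" if "z \<in> {0..T}" for z \<tau>
    unfolding e_def using z0(2)[OF that] b(2)[OF that] c(2)[OF that] by (intro norm_gauss_le) (simp add: m_def)
  have one: "1 \<le> (1 + norm \<tau>)\<^sup>2" "1 + norm \<tau> \<le> (1 + norm \<tau>)\<^sup>2" for \<tau> :: 'a
    by (simp_all add: power2_eq_square algebra_simps)
  have ke: "k * e \<tau> \<le> g \<tau>" for \<tau>
    unfolding ge using mult_right_mono[OF one(1)[of \<tau>] e0[of \<tau>]] k1 by (intro mult_left_mono) auto
  define S where "S = 2 * a + 2 * b * norm p"
  have S: "S \<ge> 0" using a b by (simp add: S_def)
  show ?thesis
  \<comment> \<open>\<open>12 * S\<close> is twice the slope bound times the \<open>6\<close> of the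
    first cutoff derivative, and \<open>30\<close> comes from the second; \<open>R \<ge> 1\<close>
    weakens \<open>30 / R\<^sup>2\<close> to \<open>30 / R\<close>.\<close>
  proof (intro exI[of _ g] exI[of _ "12 * S + 30"] conjI allI ballI impI)
    show "integrable lborel g"
      unfolding g_def by (intro integrable_mult_right integrable_quadratic_gaussian m)
    show "g \<tau> \<ge> 0" for \<tau> using k1 by (simp add: g_def)
    show "12 * S + 30 \<ge> 0" using S by simp
    show "norm (M z \<tau> * E z \<tau>) \<le> g \<tau>" if "z \<in> {0..T}" for z \<tau>
    proof -
      have "norm (M z \<tau> * E z \<tau>) \<le> k * e \<tau>"
        unfolding norm_mult using E[OF that] k[OF that] k1 by (intro mult_mono) auto
      then show ?thesis using ke[of \<tau>] by linarith
    qed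
    show "norm (commutator R z u \<tau>) \<le> (12 * S + 30) / R * g \<tau>" if R: "R \<ge> 1" and z: "z \<in> {0..T}" and u: "u \<in> Basis" for R z u \<tau>
    proof -
      have R0: "R > 0" using R by simp
      have sl: "norm (slope u z \<tau>) \<le> S * (1 + norm \<tau>)"
        unfolding S_def by (rule norm_gauss_slope_le[OF u a(2)[OF z] b(2)[OF z]])
      have bs: "norm (complex_of_real (bump_slope R u \<tau>)) \<le> 6 / R"
        using bump_slope_le[OF R0 u, of \<tau>] by simp
      have "30 / R\<^sup>2 \<le> 30 / R" using R by (intro divide_left_mono) (auto simp: power2_eq_square)
      then have bc: "norm (complex_of_real (bump_curvature R u \<tau>)) \<le> 30 / R"
        using bump_curvature_le[OF R0 u, of \<tau>] by simp
      have 1: "norm (2 * slope u z \<tau> * E z \<tau> * of_real (bump_slope R u \<tau>)) \<le> 2 * (S * (1 + norm \<tau>)) * e \<tau> * (6 / R)"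
        unfolding norm_mult using sl E[OF z, of \<tau>] bs S e0 R0 by (intro mult_mono) auto
      have 2: "norm (E z \<tau> * of_real (bump_curvature R u \<tau>)) \<le> e \<tau> * (30 / R)"
        unfolding norm_mult using E[OF z, of \<tau>] bc e0 R0 by (intro mult_mono) auto
      have "norm (commutator R z u \<tau>) \<le> k * (2 * (S * (1 + norm \<tau>)) * e \<tau> * (6 / R) + e \<tau> * (30 / R))"
        unfolding commutator_def norm_mult[of "M z \<tau>"]
        using order_trans[OF norm_triangle_ineq add_mono[OF 1 2]] k[OF z, of \<tau>] k1
        by (intro mult_mono) auto
      also have "\<dots> = k * ((12 * S * (1 + norm \<tau>) + 30) * (e \<tau> / R))"
        by (simp add: algebra_simps)
      also have "\<dots> \<le> k * (((12 * S + 30) * (1 + norm \<tau>)\<^sup>2) * (e \<tau> / R))"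
      proof -
        have "12 * S * (1 + norm \<tau>) + 30 * 1 \<le> 12 * S * (1 + norm \<tau>)\<^sup>2 + 30 * (1 + norm \<tau>)\<^sup>2"
          using one[of \<tau>] S by (intro add_mono mult_left_mono) auto
        then have "12 * S * (1 + norm \<tau>) + 30 \<le> (12 * S + 30) * (1 + norm \<tau>)\<^sup>2"
          by (simp add: distrib_right)
        then show ?thesis
          using k1 e0[of \<tau>] R0 by (intro mult_left_mono mult_right_mono) auto
      qed
      also have "\<dots> = (12 * S + 30) / R * g \<tau>" by (simp add: ge)
      finally show ?thesis .
    qed
  qed
qed

lemma cutoff_integral_continuous:
  assumes R: "R > 0"
  shows "continuous_on {0..T} (\<lambda>z. LINT \<tau>|lborel. M z \<tau> * E z \<tau> * cutoff R \<tau>)"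
proof (rule continuous_on_param_integral[where R = R])
  have fsts: "continuous_on ({0..T} \<times> (UNIV::'a set)) (\<lambda>x. A (fst x))" "continuous_on ({0..T} \<times> (UNIV::'a set)) (\<lambda>x. B (fst x))"
     "continuous_on ({0..T} \<times> (UNIV::'a set)) (\<lambda>x. C (fst x))"
    by (auto intro!: continuous_on_compose2[OF contA] continuous_on_compose2[OF contB]
        continuous_on_compose2[OF contC] continuous_intros)
  have cM: "continuous_on ({0..T} \<times> UNIV) (\<lambda>x. M (fst x) (snd x))"
  proof -
    have "{0..T} \<times> (UNIV::'a set) \<subseteq> {0..} \<times> UNIV" by auto
    from continuous_on_subset[OF contM this] show ?thesis by (simp add: case_prod_beta)
  qed
  show "continuous_on ({0..T} \<times> UNIV) (\<lambda>(z, \<tau>). M z \<tau> * E z \<tau> * cutoff R \<tau>)"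
    unfolding case_prod_beta by (intro continuous_intros fsts cM)
qed (simp add: bump_outside[OF R])

lemma cutoff_tendsto_1: "(\<lambda>n. cutoff (real (Suc n)) \<tau>) \<longlonglongrightarrow> 1"
proof -
  have "(\<lambda>n. inverse (real (Suc n))) \<longlonglongrightarrow> 0" by (rule LIMSEQ_inverse_real_of_nat)
  then have "(\<lambda>n. of_real (max 0 (1 - (norm \<tau>)\<^sup>2 * (inverse (real (Suc n)))\<^sup>2) ^ 3) :: complex)
     \<longlonglongrightarrow> of_real (max 0 (1 - (norm \<tau>)\<^sup>2 * 0\<^sup>2) ^ 3)"
    by (intro tendsto_intros)
  then show ?thesis by (simp add: bump_def divide_inverse power_inverse)
qed

text \<open>The derivative bound \<open>Q / R\<close> holds on the open interval; continuity of the
  cut-off pairing up to \<open>z = 0\<close> and \<open>z = T\<close> extends it to a bound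
  \<open>Q * T / R\<close> for the total change. After \<open>R \<rightarrow> \<infinity>\<close>
  the initial value \<open>M 0 = 1\<close> leaves a right-hand side that does not involve
  \<open>M\<close>.\<close>

lemma gaussian_pairing:
  "(LINT \<tau>|lborel. M T \<tau> * E T \<tau>) = (LINT \<tau>|lborel. E 0 \<tau>)"
proof -
  obtain g :: "'a \<Rightarrow> real" and L where g: "integrable lborel g" "\<forall>\<tau>. g \<tau> \<ge> 0" and L: "L \<ge> 0"
    and gE: "\<forall>z\<in>{0..T}. \<forall>\<tau>. norm (M z \<tau> * E z \<tau>) \<le> g \<tau>"
    and gc: "\<forall>R\<ge>1. \<forall>z\<in>{0..T}. \<forall>u\<in>Basis. \<forall>\<tau>. norm (commutator R z u \<tau>) \<le> L / R * g \<tau>"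
    using gaussian_pairing_dominated by (elim exE conjE)
  define I where "I R z = (LINT \<tau>|lborel. M z \<tau> * E z \<tau> * cutoff R \<tau>)" for R z
  define Q where "Q = norm K * (real DIM('a) * (L * (LINT \<tau>|lborel. g \<tau>)))"
  have diff: "norm (I R T - I R 0) \<le> Q / R * T" if R: "R \<ge> 1" for R
  proof -
    have R0: "R > 0" using R by simp
    have der: "(I R has_vector_derivative (LINT \<tau>|lborel. dt_integrand R z \<tau>)) (at z)" if "0 < z" "z < T" for z
      unfolding I_def by (rule cutoff_integral_deriv[OF R0 that])
    have bound: "norm (LINT \<tau>|lborel. dt_integrand R z \<tau>) \<le> Q / R" if z: "0 < z" "z < T" for z
    proof -
      have zT: "z \<in> {0..T}" using z by simp
      have "norm (LINT \<tau>|lborel. commutator R z u \<tau>) \<le> L / R * (LINT \<tau>|lborel. g \<tau>)" if u: "u \<in> Basis" for u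
      proof -
        have "norm (LINT \<tau>|lborel. commutator R z u \<tau>) \<le> (LINT \<tau>|lborel. L / R * g \<tau>)"
          by (rule Bochner_Integration.integral_norm_bound_integral[OF commutator_integrable[OF R0 z(1) u]])
            (use g gc R zT u in auto)
        then show ?thesis by simp
      qed
      then have "norm (\<Sum>u\<in>(Basis::'a set). LINT \<tau>|lborel. commutator R z u \<tau>)
         \<le> of_nat DIM('a) * (L / R * (LINT \<tau>|lborel. g \<tau>))"
        by (intro sum_norm_bound)
      then have "norm K * norm (\<Sum>u\<in>(Basis::'a set). LINT \<tau>|lborel. commutator R z u \<tau>)
         \<le> norm K * (of_nat DIM('a) * (L / R * (LINT \<tau>|lborel. g \<tau>)))"
        by (rule mult_left_mono) simp
      then show ?thesis
        unfolding integral_dt_integrand[OF R0 z(1)] Q_def norm_mult by simp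
    qed
    have "norm (I R T - I R 0) \<le> Q / R * T - Q / R * 0"
    proof (rule differentiable_bound_general[OF T])
      show "continuous_on {0..T} (I R)" unfolding I_def by (rule cutoff_integral_continuous[OF R0])
      show "((\<lambda>z. Q / R * z) has_vector_derivative Q / R) (at z)" for z
        unfolding has_real_derivative_iff_has_vector_derivative[symmetric] by (auto intro!: derivative_eq_intros)
      show "continuous_on {0..T} (\<lambda>z. Q / R * z)"
        by (intro continuous_on_mult continuous_on_const continuous_on_id)
    qed (use der bound in auto)
    then show ?thesis by simp
  qed
  have limI: "(\<lambda>n. I (real (Suc n)) z) \<longlonglongrightarrow> (LINT \<tau>|lborel. M z \<tau> * E z \<tau>)" if z: "z \<in> {0..T}" for z
    unfolding I_def
  proof (rule integral_dominated_convergence[OF _ _ g(1)])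
    have cM: "continuous_on UNIV (M z)" using z by (intro continuous_on_slice[OF contM]) auto
    have "continuous_on UNIV (\<lambda>\<tau>. M z \<tau> * E z \<tau>)" "continuous_on UNIV (\<lambda>\<tau>. M z \<tau> * E z \<tau> * cutoff R \<tau>)" for R
      by (intro continuous_intros cM)+
    then show "(\<lambda>\<tau>. M z \<tau> * E z \<tau>) \<in> borel_measurable lborel"
      "(\<lambda>\<tau>. M z \<tau> * E z \<tau> * cutoff (real (Suc n)) \<tau>) \<in> borel_measurable lborel" for n
      by (simp_all add: borel_measurable_continuous_onI)
    show "AE \<tau> in lborel. (\<lambda>n. M z \<tau> * E z \<tau> * cutoff (real (Suc n)) \<tau>) \<longlonglongrightarrow> M z \<tau> * E z \<tau>"
      using tendsto_mult[OF tendsto_const cutoff_tendsto_1] by (intro AE_I2) fastforce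
    show "AE \<tau> in lborel. norm (M z \<tau> * E z \<tau> * cutoff (real (Suc n)) \<tau>) \<le> g \<tau>" for n
    proof (rule AE_I2)
      fix \<tau> :: 'a
      have "norm (M z \<tau> * E z \<tau> * cutoff (real (Suc n)) \<tau>) \<le> g \<tau> * 1"
        unfolding norm_mult[of "M z \<tau> * E z \<tau>"] using gE z bump_le_1[of "real (Suc n)" \<tau>] g(2)
        by (intro mult_mono) (auto simp: norm_power power_le_one)
      then show "norm (M z \<tau> * E z \<tau> * cutoff (real (Suc n)) \<tau>) \<le> g \<tau>" by simp
    qed
  qed
  have "(\<lambda>n. I (real (Suc n)) T - I (real (Suc n)) 0) \<longlonglongrightarrow> 0"
  proof (rule Lim_null_comparison)
    show "\<forall>\<^sub>F n in sequentially. norm (I (real (Suc n)) T - I (real (Suc n)) 0) \<le> Q * T * inverse (real (Suc n))"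
      using diff[of "real (Suc n)" for n] by (intro always_eventually allI) (simp add: divide_inverse mult_ac)
    show "(\<lambda>n. Q * T * inverse (real (Suc n))) \<longlonglongrightarrow> 0"
      by (rule tendsto_mult_right_zero[OF LIMSEQ_inverse_real_of_nat])
  qed
  moreover have "(\<lambda>n. I (real (Suc n)) T - I (real (Suc n)) 0)
      \<longlonglongrightarrow> (LINT \<tau>|lborel. M T \<tau> * E T \<tau>) - (LINT \<tau>|lborel. M 0 \<tau> * E 0 \<tau>)"
    using T by (intro tendsto_diff limI) auto
  ultimately have "(LINT \<tau>|lborel. M T \<tau> * E T \<tau>) - (LINT \<tau>|lborel. M 0 \<tau> * E 0 \<tau>) = 0"
    using LIMSEQ_unique by blast
  moreover have "M 0 \<tau> = 1" for \<tau> using sol by (simp add: moment_solution_def)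
  ultimately show ?thesis by simp
qed

end

end

lemma integral_lborel_affine:
  fixes f :: "'a::euclidean_space \<Rightarrow> complex"
  assumes f: "continuous_on UNIV f" and c: "c \<noteq> 0"
  shows "(LINT x|lborel. f x) = \<bar>c\<bar> ^ DIM('a) *\<^sub>R (LINT x|lborel. f (t + c *\<^sub>R x))"
proof -
  have [measurable]: "f \<in> borel_measurable borel" using f by (rule borel_measurable_continuous_onI)
  have "(LINT x|lborel. f x)
      = (LINT x|density (distr lborel borel (\<lambda>x. t + c *\<^sub>R x)) (\<lambda>_. ennreal (\<bar>c\<bar> ^ DIM('a))). f x)"
    by (subst lborel_affine[OF c, of t]) simp
  also have "\<dots> = (LINT x|distr lborel borel (\<lambda>x. t + c *\<^sub>R x). \<bar>c\<bar> ^ DIM('a) *\<^sub>R f x)"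
    by (rule integral_density) auto
  also have "\<dots> = (LINT x|lborel. \<bar>c\<bar> ^ DIM('a) *\<^sub>R f (t + c *\<^sub>R x))"
    by (rule integral_distr) auto
  finally show ?thesis by simp
qed

text \<open>An approximate identity: for \<open>N = (n + 1)\<^sup>2\<close> the substitution
  \<open>x = p + y / (n + 1)\<close> makes the weight independent of \<open>n\<close>, while
  \<open>D\<close> converges boundedly to \<open>D p\<close>. The limit is \<open>D p\<close> times
  a positive Gaussian integral.\<close>

lemma gaussian_integrals_zero_imp_zero:
  fixes D :: "'a::euclidean_space \<Rightarrow> complex"
  assumes D: "continuous_on UNIV D" and k: "\<And>x. norm (D x) \<le> k"
    and zero: "\<And>N::real. N > 0 \<Longrightarrow> (LINT x|lborel. D x * of_real (exp (- N * (norm (x - p))\<^sup>2))) = 0"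
  shows "D p = 0"
proof -
  define c where "c n = inverse (real (Suc n))" for n
  have c0: "c n \<noteq> 0" for n by (simp add: c_def)
  have z: "(LINT x|lborel. D (p + c n *\<^sub>R x) * of_real (exp (- (norm x)\<^sup>2))) = 0" for n
  proof -
    let ?f = "\<lambda>x. D x * complex_of_real (exp (- ((real (Suc n))\<^sup>2) * (norm (x - p))\<^sup>2))"
    have "continuous_on UNIV ?f" by (intro continuous_intros D)
    from integral_lborel_affine[OF this c0[of n], of p] zero[of "(real (Suc n))\<^sup>2"]
    have "(LINT x|lborel. ?f (p + c n *\<^sub>R x)) = 0" using c0[of n] by auto
    moreover have "(real (Suc n))\<^sup>2 * (norm (p + c n *\<^sub>R x - p))\<^sup>2 = (norm x)\<^sup>2" for x
    proof -
      have "real (Suc n) * norm (p + c n *\<^sub>R x - p) = norm x" by (simp add: c_def)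
      then show ?thesis by (metis power_mult_distrib)
    qed
    ultimately show ?thesis by (simp only: minus_mult_left[symmetric])
  qed
  have "(\<lambda>n. LINT x|lborel. D (p + c n *\<^sub>R x) * of_real (exp (- (norm x)\<^sup>2)))
      \<longlonglongrightarrow> (LINT x::'a|lborel. D p * of_real (exp (- (norm x)\<^sup>2)))"
  proof (rule integral_dominated_convergence[where w = "\<lambda>x. k * exp (- 1 * (norm x)\<^sup>2)"])
    show "integrable lborel (\<lambda>x::'a. k * exp (- 1 * (norm x)\<^sup>2))"
      by (intro integrable_mult_right integrable_gaussian) simp
    have "continuous_on UNIV (\<lambda>x::'a. D p * complex_of_real (exp (- (norm x)\<^sup>2)))"
      by (intro continuous_intros)
    then show "(\<lambda>x. D p * complex_of_real (exp (- (norm x)\<^sup>2))) \<in> borel_measurable lborel"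
      by (simp add: borel_measurable_continuous_onI)
    have "continuous_on UNIV (\<lambda>x::'a. D (p + c n *\<^sub>R x) * complex_of_real (exp (- (norm x)\<^sup>2)))" for n
      by (intro continuous_intros continuous_on_compose2[OF D]) auto
    then show "(\<lambda>x. D (p + c n *\<^sub>R x) * complex_of_real (exp (- (norm x)\<^sup>2))) \<in> borel_measurable lborel" for n
      by (simp add: borel_measurable_continuous_onI)
    show "AE x in lborel. (\<lambda>n. D (p + c n *\<^sub>R x) * complex_of_real (exp (- (norm x)\<^sup>2)))
        \<longlonglongrightarrow> D p * of_real (exp (- (norm x)\<^sup>2))"
    proof (rule AE_I2)
      fix x :: 'a
      have "(\<lambda>n. p + c n *\<^sub>R x) \<longlonglongrightarrow> p + 0 *\<^sub>R x"
        unfolding c_def by (intro tendsto_intros LIMSEQ_inverse_real_of_nat)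
      moreover have "isCont D p" using D by (simp add: continuous_on_eq_continuous_at)
      ultimately have "(\<lambda>n. D (p + c n *\<^sub>R x)) \<longlonglongrightarrow> D p"
        using isCont_tendsto_compose by fastforce
      then show "(\<lambda>n. D (p + c n *\<^sub>R x) * complex_of_real (exp (- (norm x)\<^sup>2)))
        \<longlonglongrightarrow> D p * of_real (exp (- (norm x)\<^sup>2))"
        by (intro tendsto_intros)
    qed
    show "AE x in lborel. norm (D (p + c n *\<^sub>R x) * complex_of_real (exp (- (norm x)\<^sup>2))) \<le> k * exp (- 1 * (norm x)\<^sup>2)" for n
      using k by (intro AE_I2) (simp add: norm_mult mult_right_mono)
  qed
  then have "(LINT x|lborel. D p * of_real (exp (- (norm (x::'a))\<^sup>2))) = 0"
    unfolding z by (simp add: LIMSEQ_const_iff)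
  moreover have "(LINT x::'a|lborel. D p * of_real (exp (- (norm x)\<^sup>2)))
      = D p * of_real (LINT x::'a|lborel. exp (- (norm x)\<^sup>2))"
    by (simp only: integral_mult_right_zero integral_complex_of_real)
  ultimately show ?thesis
    using integral_gaussian_pos[where 'a='a] by simp
qed

lemma has_vector_derivative_reflect:
  fixes f :: "real \<Rightarrow> complex"
  assumes "(f has_vector_derivative f') (at (T - z))"
  shows "((\<lambda>z. f (T - z)) has_vector_derivative - f') (at z within S)"
proof -
  have "((\<lambda>z. T - z) has_vector_derivative - 1) (at z)"
    by (auto intro!: derivative_eq_intros)
  from vector_diff_chain_at[OF this assms] show ?thesis
    by (simp add: o_def has_vector_derivative_at_within)
qed

context schroedinger_params
begin

text \<open>The dual coefficients depend on \<open>N\<close>, \<open>p\<close> and \<open>T\<close>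
  but not on the solution, and both pairings start from the same initial integral. Hence
  \<open>M1 T\<close> and \<open>M2 T\<close> have equal integrals against
  \<open>exp (- N \<bar>\<tau> - p\<bar>\<^sup>2)\<close> for each \<open>N > 0\<close>.\<close>

lemma moment_solution_unique:
  fixes M1 M2 :: "real \<Rightarrow> 'a::euclidean_space \<Rightarrow> complex"
  assumes M1: "moment_solution M1" and M2: "moment_solution M2" and T: "T > 0"
  shows "M1 T p = M2 T p"
proof -
  define D where "D \<tau> = M1 T \<tau> - M2 T \<tau>" for \<tau>
  have cont: "continuous_on UNIV (M T)" if "moment_solution M" for M :: "real \<Rightarrow> 'a \<Rightarrow> complex"
    using that T by (auto simp: moment_solution_def classical_regularity_def intro: continuous_on_slice[of "{0..}"])
  have bound: "\<exists>k. \<forall>\<tau>. norm (M T \<tau>) \<le> k" if "moment_solution M" for M :: "real \<Rightarrow> 'a \<Rightarrow> complex"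
  proof -
    have "\<exists>C. \<forall>z\<in>{0..T}. \<forall>\<tau>. norm (M z \<tau>) \<le> C" using that by (simp add: moment_solution_def)
    moreover have "T \<in> {0..T}" using T by simp
    ultimately show ?thesis by blast
  qed
  obtain k1 k2 where k: "\<forall>\<tau>. norm (M1 T \<tau>) \<le> k1" "\<forall>\<tau>. norm (M2 T \<tau>) \<le> k2"
    using bound[OF M1] bound[OF M2] by blast
  have "D p = 0"
  proof (rule gaussian_integrals_zero_imp_zero[where D = D and k = "k1 + k2" and p = p])
    show "continuous_on UNIV D" unfolding D_def by (intro continuous_intros cont M1 M2)
    show "norm (D x) \<le> k1 + k2" for x
      unfolding D_def by (rule order_trans[OF norm_triangle_ineq4]) (use k in \<open>auto intro: add_mono\<close>)
    fix N :: real assume N: "N > 0"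
    \<comment> \<open>Reversing \<open>z\<close> turns the Riccati solution with initial value
      \<open>N\<close> into a solution of the dual system with value \<open>N\<close> at
      \<open>z = T\<close>; positivity of the real part is carried over.\<close>
    define A where "A z = riccati K \<alpha> N (T - z)" for z
    define B where "B z = of_real N / riccati_den K \<alpha> N (T - z)" for z
    define c where "c z = 2 * K * of_nat DIM('a) * A z - 4 * K * (B z)\<^sup>2 * of_real ((norm p)\<^sup>2)" for z
    have dA: "(A has_vector_derivative 4 * K * (A z)\<^sup>2 - of_real \<gamma>) (at z within {0..T})" if "z \<in> {0..T}" for z
      using has_vector_derivative_reflect[OF riccati_deriv(1)[of "T - z" N]] that N unfolding A_def by simp
    have dB: "(B has_vector_derivative 4 * K * A z * B z) (at z within {0..T})" if "z \<in> {0..T}" for z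
      using has_vector_derivative_reflect[OF riccati_deriv(2)[of "T - z" N]] that N unfolding A_def B_def by simp
    have "continuous_on {0..T} A" by (rule continuous_on_vector_derivative, erule dA)
    moreover have "continuous_on {0..T} B" by (rule continuous_on_vector_derivative, erule dB)
    ultimately have "continuous_on {0..T} c" unfolding c_def by (intro continuous_intros)
    \<comment> \<open>Any antiderivative will do: its value at \<open>T\<close> only enters the
      nonzero factor \<open>w\<close>, which is divided out at the end.\<close>
    then obtain C where dC: "\<And>z. z \<in> {0..T} \<Longrightarrow> (C has_vector_derivative c z) (at z within {0..T})"
      using antiderivative_continuous by blast
    have ReA: "Re (A z) > 0" if "z \<in> {0..T}" for z
      unfolding A_def using that N by (intro Re_riccati_pos) auto
    note pairing = gaussian_pairing[OF _ T dA dB dC[unfolded c_def] ReA]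
    have ATBT: "A T = of_real N" "B T = of_real N"
      by (simp_all add: A_def B_def riccati_def riccati_num_def riccati_den_def)
    define w where "w = exp (of_real (N * (norm p)\<^sup>2) + C T)"
    have gT: "gauss (A T) (B T) p (C T) \<tau> = of_real (exp (- N * (norm (\<tau> - p))\<^sup>2)) * w" for \<tau>
    proof -
      have n: "(norm (\<tau> - p))\<^sup>2 = (norm \<tau>)\<^sup>2 - 2 * (p \<bullet> \<tau>) + (norm p)\<^sup>2"
        unfolding power2_norm_eq_inner by (simp add: inner_simps inner_commute)
      have "- of_real N * of_real ((norm \<tau>)\<^sup>2) + 2 * of_real N * of_real (p \<bullet> \<tau>) + C T
        = of_real (- N * (norm (\<tau> - p))\<^sup>2) + (of_real (N * (norm p)\<^sup>2) + C T)"
        unfolding n by (simp add: algebra_simps)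
      then show ?thesis
        unfolding gauss_def ATBT w_def by (simp only: exp_add exp_of_real)
    qed
    have eq: "(LINT \<tau>|lborel. M1 T \<tau> * gauss (A T) (B T) p (C T) \<tau>) = (LINT \<tau>|lborel. M2 T \<tau> * gauss (A T) (B T) p (C T) \<tau>)"
      using pairing[OF M1] pairing[OF M2] by simp
    have int: "integrable lborel (\<lambda>\<tau>. M T \<tau> * gauss (A T) (B T) p (C T) \<tau>)" if M: "moment_solution M" for M :: "real \<Rightarrow> 'a \<Rightarrow> complex"
    proof -
      obtain k where k: "\<forall>\<tau>. norm (M T \<tau>) \<le> k" using bound[OF M] by blast
      show ?thesis
      proof (rule Bochner_Integration.integrable_bound)
        have "integrable lborel (\<lambda>\<tau>. gauss (A T) (B T) p (C T) \<tau> / exp (C T))"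
          using integrable_gaussian_complex_euclidean[of "A T" "B T" p] ReA[of T] T by (simp add: gauss_def exp_add)
        then have "integrable lborel (\<lambda>\<tau>. of_real k * exp (C T) * (gauss (A T) (B T) p (C T) \<tau> / exp (C T)))"
          by (rule integrable_mult_right)
        then show "integrable lborel (\<lambda>\<tau>. of_real k * gauss (A T) (B T) p (C T) \<tau>)" by simp
        have "continuous_on UNIV (\<lambda>\<tau>. M T \<tau> * gauss (A T) (B T) p (C T) \<tau>)"
          by (intro continuous_intros cont[OF M])
        then show "(\<lambda>\<tau>. M T \<tau> * gauss (A T) (B T) p (C T) \<tau>) \<in> borel_measurable lborel"
          by (simp add: borel_measurable_continuous_onI)
        show "AE \<tau> in lborel. norm (M T \<tau> * gauss (A T) (B T) p (C T) \<tau>) \<le> norm (of_real k * gauss (A T) (B T) p (C T) \<tau>)"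
        proof (rule AE_I2)
          fix \<tau>
          have "norm (M T \<tau>) \<le> \<bar>k\<bar>" using k[rule_format, of \<tau>] by linarith
          then show "norm (M T \<tau> * gauss (A T) (B T) p (C T) \<tau>) \<le> norm (of_real k * gauss (A T) (B T) p (C T) \<tau>)"
            unfolding norm_mult norm_of_real by (rule mult_right_mono) simp
        qed
      qed
    qed
    have "(LINT \<tau>|lborel. (M1 T \<tau> * gauss (A T) (B T) p (C T) \<tau> - M2 T \<tau> * gauss (A T) (B T) p (C T) \<tau>)) = 0"
      by (subst Bochner_Integration.integral_diff[OF int[OF M1] int[OF M2]]) (simp add: eq)
    moreover have "M1 T \<tau> * gauss (A T) (B T) p (C T) \<tau> - M2 T \<tau> * gauss (A T) (B T) p (C T) \<tau>
        = D \<tau> * of_real (exp (- N * (norm (\<tau> - p))\<^sup>2)) * w" for \<tau>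
      unfolding gT D_def by (simp only: left_diff_distrib mult.assoc)
    ultimately have "(LINT \<tau>|lborel. D \<tau> * of_real (exp (- N * (norm (\<tau> - p))\<^sup>2))) * w = 0"
      by (simp only: integral_mult_left_zero)
    then show "(LINT \<tau>|lborel. D \<tau> * of_real (exp (- N * (norm (\<tau> - p))\<^sup>2))) = 0"
      by (simp add: w_def)
  qed
  then show ?thesis by (simp add: D_def)
qed

lemma plane_wave_solution: "moment_solution (plane_wave_moment :: real \<Rightarrow> 'a::euclidean_space \<Rightarrow> complex)"
  unfolding moment_solution_def
proof (intro conjI allI impI)
  show "plane_wave_moment 0 \<tau> = 1" for \<tau> :: 'a
    by (simp add: plane_wave_moment_def gauss_def riccati_0 log_cosh_0[OF cosh_nonzero])
qed (rule plane_wave_regular plane_wave_bounded plane_wave_equation; assumption?)+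

lemma moment_solution_eq:
  assumes "moment_solution M" "z > 0"
  shows "M z \<tau> = plane_wave_moment z \<tau>"
  by (rule moment_solution_unique[OF assms(1) plane_wave_solution assms(2)])

end

section \<open>Principal roots in the prefactor\<close>

lemma powr_half_nat:
  assumes "z \<noteq> 0"
  shows "z powr (of_nat n / 2) = csqrt z ^ n"
  using assms by (simp add: powr_def csqrt_exp_Ln exp_of_nat_mult[symmetric] mult_ac)

text \<open>The principal root of an imaginary \<open>W\<close> has argument \<open>pi / 4\<close>
  or \<open>- pi / 4\<close>, and that of \<open>b\<close> has an argument strictly between these.
  Their quotient therefore has positive real part, which identifies it as the principal root of the
  quotient; for general arguments a sign could appear.\<close>

lemma csqrt_mult_of_real_divide:
  assumes W: "Re W = 0" "W \<noteq> 0" and b: "Re b > 0" and r: "r > 0"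
  shows "csqrt (W * of_real r / b) = csqrt W * of_real (sqrt r) / csqrt b"
proof (rule csqrt_unique)
  define u where "u = csqrt W"
  define v where "v = csqrt b"
  have uu: "u\<^sup>2 = W" and vv: "v\<^sup>2 = b" by (simp_all add: u_def v_def)
  show "(csqrt W * of_real (sqrt r) / csqrt b)\<^sup>2 = W * of_real r / b"
    using r by (simp add: power_mult_distrib power_divide flip: of_real_power)
  have v0: "Re v \<ge> 0" "u \<noteq> 0" "Re u \<ge> 0" using W(2) csqrt_principal[of W] csqrt_principal[of b] by (auto simp: u_def v_def)
  have "(Re u)\<^sup>2 = (Im u)\<^sup>2" using W(1) uu[symmetric] by (simp add: Re_power2)
  then have absu: "\<bar>Im u\<bar> = Re u" using v0 by (metis abs_of_nonneg power2_eq_iff abs_minus_cancel)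
  then have u1: "Re u > 0" using v0 by (metis abs_eq_0 complex_eq_iff less_eq_real_def zero_complex.sel)
  have "(Im v)\<^sup>2 < (Re v)\<^sup>2" using b vv[symmetric] by (simp add: Re_power2)
  then have v1: "\<bar>Im v\<bar> < Re v" using v0 abs_le_square_iff[of "Re v" "Im v"] by linarith
  have "- (Im u * Im v) \<le> \<bar>Im u\<bar> * \<bar>Im v\<bar>" by (metis abs_ge_minus_self abs_mult)
  also have "\<dots> < Re u * Re v" unfolding absu using u1 v1 by (rule mult_strict_left_mono[rotated])
  finally have "Re (u * cnj v) > 0" by simp
  moreover have "v \<noteq> 0" using v1 by auto
  ultimately have "Re (u / v) > 0"
    unfolding complex_div_cnj[of u v] by (simp flip: of_real_power)
  moreover have "Re (u * of_real (sqrt r) / v) = Re (u / v) * sqrt r"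
  proof -
    have "Re (x * of_real y) = Re x * y" for x y by simp
    moreover have "u * of_real (sqrt r) / v = u / v * of_real (sqrt r)" by simp
    ultimately show ?thesis by (simp only:)
  qed
  ultimately show "0 < Re (csqrt W * of_real (sqrt r) / csqrt b) \<or> Re (csqrt W * of_real (sqrt r) / csqrt b) = 0 \<and> 0 \<le> Im (csqrt W * of_real (sqrt r) / csqrt b)"
    unfolding u_def[symmetric] v_def[symmetric] using r by simp
qed

section \<open>The correlation and its optimal shift\<close>

lemma alpha_square: "(alpha s)\<^sup>2 = \<i> * s\<^sup>2"
proof -
  have "(exp (\<i> * of_real pi / 4))\<^sup>2 = exp (\<i> * of_real (pi / 2))"
    by (simp add: exp_double[symmetric])
  also have "\<dots> = \<i>" by (simp only: cis_conv_exp[symmetric] cis_pi_half)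
  finally show ?thesis by (simp add: alpha_def power_mult_distrib)
qed

lemma schroedinger_params_alpha:
  assumes "\<Omega> \<noteq> 0" "\<sigma> > 0" "\<omega>0 \<noteq> 0" "s\<^sup>2 = of_real (\<sigma>\<^sup>2 * \<Omega> / 4)"
  shows "schroedinger_params (\<i> * of_real \<Omega> / (2 * of_real (\<omega>0\<^sup>2))) (alpha s) (\<omega>0\<^sup>2 * \<sigma>\<^sup>2 / 8)"
proof
  have "\<i> * of_real \<Omega> / (2 * of_real (\<omega>0\<^sup>2)) = \<i> * of_real (\<Omega> / (2 * \<omega>0\<^sup>2))" by simp
  then show "Re (\<i> * of_real \<Omega> / (2 * of_real (\<omega>0\<^sup>2))) = 0" by (simp only:) simp
  show "(alpha s)\<^sup>2 = 4 * (\<i> * of_real \<Omega> / (2 * of_real (\<omega>0\<^sup>2))) * of_real (\<omega>0\<^sup>2 * \<sigma>\<^sup>2 / 8)"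
    unfolding alpha_square assms(4) using assms(3) by (simp add: field_simps)
qed (use assms in auto)

lemma frak_b_eq: "frak_b \<omega>0 \<sigma> \<alpha> z0 h = coeff_b \<omega>0 \<sigma> \<alpha> z0 - \<i> * of_real (\<omega>0 / (2 * h))"
  by (simp add: frak_b_def complex_eq_iff)

text \<open>In the integration variable the exponent is quadratic with leading coefficient
  \<open>bb\<close>: the oscillating kernel shifts \<open>b\<close> by an imaginary amount. The
  kernel has modulus one, so integrability comes from \<open>Re bb = Re b > 0\<close>.\<close>

lemma m11_gaussian:
  fixes M :: "real \<Rightarrow> 'a::euclidean_space \<Rightarrow> complex" and b C :: complex
  assumes \<omega>0: "\<omega>0 \<noteq> 0" and h: "h \<noteq> 0" and b: "Re b > 0"
    and M: "\<And>\<tau>. M z0 \<tau> = gauss b 0 0 C \<tau>"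
    and bb: "bb = b - \<i> * of_real (\<omega>0 / (2 * h))"
  shows "m11 \<omega>0 M z0 h \<tau> =
     (of_real \<omega>0 / (2 * \<i> * of_real h * bb)) powr (of_nat DIM('a) / 2)
     * exp C
     * of_real (exp (- (\<omega>0\<^sup>2 * Re bb * (norm \<tau>)\<^sup>2 / (4 * h\<^sup>2 * (cmod bb)\<^sup>2))))
     * exp (\<i> * of_real (\<omega>0 * (norm \<tau>)\<^sup>2 / (2 * h) * (1 + \<omega>0 * Im bb / (2 * h * (cmod bb)\<^sup>2))))"
proof -
  define k where "k = \<omega>0 / (2 * h)"
  have bb': "bb = b - \<i> * of_real k" by (simp add: bb k_def)
  have Rebb: "Re bb > 0" using b by (simp add: bb')
  then have bb0: "bb \<noteq> 0" by auto
  have integrand: "M z0 (\<tau> - \<tau>') * exp (\<i> * of_real \<omega>0 / (2 * of_real h) * of_real ((norm \<tau>')\<^sup>2))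
     = exp (C - b * of_real ((norm \<tau>)\<^sup>2)) * exp (- bb * of_real ((norm \<tau>')\<^sup>2) + 2 * b * of_real (\<tau> \<bullet> \<tau>'))" for \<tau>'
  proof -
    have n: "(norm (\<tau> - \<tau>'))\<^sup>2 = (norm \<tau>)\<^sup>2 - 2 * (\<tau> \<bullet> \<tau>') + (norm \<tau>')\<^sup>2"
      unfolding power2_norm_eq_inner by (simp add: inner_simps inner_commute)
    have "\<i> * of_real \<omega>0 / (2 * of_real h) = \<i> * of_real k" by (simp add: k_def)
    then show ?thesis
      unfolding M gauss_def exp_add[symmetric] n bb' by (simp add: algebra_simps)
  qed
  have int: "(LINT \<tau>'|lborel. M z0 (\<tau> - \<tau>') * exp (\<i> * of_real \<omega>0 / (2 * of_real h) * of_real ((norm \<tau>')\<^sup>2)))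
     = exp (C - b * of_real ((norm \<tau>)\<^sup>2)) * ((of_real (sqrt pi) / csqrt bb) ^ DIM('a) * exp (b\<^sup>2 / bb * of_real ((norm \<tau>)\<^sup>2)))"
    unfolding integrand by (simp only: integral_mult_right_zero integral_gaussian_complex_euclidean[OF Rebb])
  define W where "W = of_real \<omega>0 / (2 * of_real pi * \<i> * of_real h)"
  have "W * \<i> = of_real (k / pi)" unfolding W_def k_def by (simp add: field_simps)
  moreover have "W = - \<i> * (W * \<i>)" by (simp add: mult.left_commute[of \<i> W])
  ultimately have W: "W = - \<i> * of_real (k / pi)" by (simp only:)
  have W0: "Re W = 0" "W \<noteq> 0" using \<omega>0 h by (simp_all add: W k_def)
  have V: "of_real \<omega>0 / (2 * \<i> * of_real h * bb) = W * of_real pi / bb"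
    by (simp add: W_def field_simps)
  have pre: "W powr (of_nat DIM('a) / 2) * (of_real (sqrt pi) / csqrt bb) ^ DIM('a)
      = (of_real \<omega>0 / (2 * \<i> * of_real h * bb)) powr (of_nat DIM('a) / 2)"
  proof -
    have "W * of_real pi / bb \<noteq> 0" using W0 bb0 by simp
    then show ?thesis
      unfolding V powr_half_nat[OF W0(2)] powr_half_nat[OF \<open>W * of_real pi / bb \<noteq> 0\<close>]
        csqrt_mult_of_real_divide[OF W0 Rebb pi_gt_zero] power_mult_distrib[symmetric] by simp
  qed
  \<comment> \<open>Substituting \<open>b = bb + \<i> * k\<close> gives
    \<open>- b + b\<^sup>2 / bb = \<i> * k - k\<^sup>2 / bb\<close>; its real part is the decay rate
    in the formula and its imaginary part the phase.\<close>
  have e: "- b + b\<^sup>2 / bb = of_real (- (k\<^sup>2 * Re bb / (cmod bb)\<^sup>2)) + \<i> * of_real (k * (1 + k * Im bb / (cmod bb)\<^sup>2))"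
  proof -
    have inv: "1 / bb = cnj bb / of_real ((cmod bb)\<^sup>2)"
      by (subst complex_div_cnj) simp
    have "- b + b\<^sup>2 / bb = \<i> * of_real k - of_real (k\<^sup>2) * (1 / bb)"
    proof -
      have bk: "b = bb + \<i> * of_real k" by (simp add: bb')
      show ?thesis unfolding bk using bb0 by (simp add: field_simps power2_eq_square)
    qed
    also have "\<dots> = of_real (- (k\<^sup>2 * Re bb / (cmod bb)\<^sup>2)) + \<i> * of_real (k * (1 + k * Im bb / (cmod bb)\<^sup>2))"
      unfolding inv by (simp add: complex_eq_iff Re_divide_of_real Im_divide_of_real algebra_simps power2_eq_square flip: of_real_power)
    finally show ?thesis .
  qed
  have "exp (C - b * of_real ((norm \<tau>)\<^sup>2)) * exp (b\<^sup>2 / bb * of_real ((norm \<tau>)\<^sup>2))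
      = exp C * exp ((- b + b\<^sup>2 / bb) * of_real ((norm \<tau>)\<^sup>2))"
    unfolding exp_add[symmetric] by (simp add: algebra_simps)
  also have "(- b + b\<^sup>2 / bb) * of_real ((norm \<tau>)\<^sup>2)
      = of_real (- (\<omega>0\<^sup>2 * Re bb * (norm \<tau>)\<^sup>2 / (4 * h\<^sup>2 * (cmod bb)\<^sup>2)))
      + \<i> * of_real (\<omega>0 * (norm \<tau>)\<^sup>2 / (2 * h) * (1 + \<omega>0 * Im bb / (2 * h * (cmod bb)\<^sup>2)))"
  proof -
    have 1: "- (\<omega>0\<^sup>2 * Re bb * (norm \<tau>)\<^sup>2 / (4 * h\<^sup>2 * (cmod bb)\<^sup>2)) = - (k\<^sup>2 * Re bb / (cmod bb)\<^sup>2) * (norm \<tau>)\<^sup>2"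
      by (simp add: k_def power_divide power_mult_distrib)
    have 2: "\<omega>0 * (norm \<tau>)\<^sup>2 / (2 * h) * (1 + \<omega>0 * Im bb / (2 * h * (cmod bb)\<^sup>2))
        = k * (1 + k * Im bb / (cmod bb)\<^sup>2) * (norm \<tau>)\<^sup>2"
      by (simp add: k_def)
    show ?thesis unfolding e 1 2 of_real_mult[of _ "(norm \<tau>)\<^sup>2"] by (simp only: distrib_right mult.assoc)
  qed
  finally have ex: "exp (C - b * of_real ((norm \<tau>)\<^sup>2)) * exp (b\<^sup>2 / bb * of_real ((norm \<tau>)\<^sup>2))
    = exp C * (of_real (exp (- (\<omega>0\<^sup>2 * Re bb * (norm \<tau>)\<^sup>2 / (4 * h\<^sup>2 * (cmod bb)\<^sup>2))))
     * exp (\<i> * of_real (\<omega>0 * (norm \<tau>)\<^sup>2 / (2 * h) * (1 + \<omega>0 * Im bb / (2 * h * (cmod bb)\<^sup>2)))))"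
    by (simp only: exp_add exp_of_real)
  have "m11 \<omega>0 M z0 h \<tau> = W powr (of_nat DIM('a) / 2) * (of_real (sqrt pi) / csqrt bb) ^ DIM('a)
     * (exp (C - b * of_real ((norm \<tau>)\<^sup>2)) * exp (b\<^sup>2 / bb * of_real ((norm \<tau>)\<^sup>2)))"
    unfolding m11_def int W_def[symmetric] by (simp only: mult_ac)
  then show ?thesis unfolding pre ex by (simp only: mult.assoc)
qed

context
  fixes \<Omega> \<sigma> \<omega>0 :: real and s :: complex
  assumes \<Omega>: "\<Omega> \<noteq> 0" and \<sigma>: "\<sigma> > 0" and \<omega>0: "\<omega>0 \<noteq> 0" and s: "s\<^sup>2 = of_real (\<sigma>\<^sup>2 * \<Omega> / 4)"
begin

interpretation schroedinger_params "\<i> * of_real \<Omega> / (2 * of_real (\<omega>0\<^sup>2))" "alpha s" "\<omega>0\<^sup>2 * \<sigma>\<^sup>2 / 8"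
  by (rule schroedinger_params_alpha[OF \<Omega> \<sigma> \<omega>0 s])

lemma M11_solution_iff: "M11_solution \<omega>0 \<sigma> \<Omega> M \<longleftrightarrow> moment_solution M"
  unfolding M11_solution_def moment_solution_def ..

lemma M11_solution_exists: "\<exists>M :: real \<Rightarrow> 'a::euclidean_space \<Rightarrow> complex. M11_solution \<omega>0 \<sigma> \<Omega> M"
  unfolding M11_solution_iff using plane_wave_solution by blast

text \<open>The two prefactors of \<open>tanh\<close> agree because
  \<open>\<alpha>\<^sup>2 = 4 K \<gamma>\<close> gives
  \<open>\<gamma> / \<alpha> = \<alpha> / (4 K)\<close>.\<close>

lemma coeff_b_eq: "coeff_b \<omega>0 \<sigma> (alpha s) z = riccati (\<i> * of_real \<Omega> / (2 * of_real (\<omega>0\<^sup>2))) (alpha s) 0 z"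
proof -
  have "a / (4 * K) = g / a" if "a\<^sup>2 = 4 * K * g" "a \<noteq> 0" "K \<noteq> 0" for a K g :: complex
    using that by (simp add: field_simps power2_eq_square)
  from this[OF \<alpha>_square \<alpha>_nonzero K_nonzero]
  show ?thesis unfolding riccati_0 coeff_b_def by simp
qed

lemma M11_solution_eq:
  fixes M :: "real \<Rightarrow> 'a::euclidean_space \<Rightarrow> complex"
  assumes "M11_solution \<omega>0 \<sigma> \<Omega> M" "z0 > 0"
  shows "M z0 \<tau> = gauss (coeff_b \<omega>0 \<sigma> (alpha s) z0) 0 0 (- of_nat DIM('a) * coeff_a (alpha s) z0) \<tau>"
  using moment_solution_eq[OF assms(1)[unfolded M11_solution_iff] assms(2), of \<tau>]
  unfolding coeff_b_eq coeff_a_def plane_wave_moment_def .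

lemma Re_coeff_b_pos: "z0 > 0 \<Longrightarrow> Re (coeff_b \<omega>0 \<sigma> (alpha s) z0) > 0"
  unfolding coeff_b_eq by (rule Re_riccati_pos) auto

lemma m11_formula:
  fixes M :: "real \<Rightarrow> 'a::euclidean_space \<Rightarrow> complex"
  assumes M: "M11_solution \<omega>0 \<sigma> \<Omega> M" and z0: "z0 > 0" and h: "h \<noteq> 0"
  defines "bb \<equiv> frak_b \<omega>0 \<sigma> (alpha s) z0 h"
  shows "m11 \<omega>0 M z0 h \<tau> =
     (of_real \<omega>0 / (2 * \<i> * of_real h * bb)) powr (of_nat DIM('a) / 2)
     * exp (- of_nat DIM('a) * coeff_a (alpha s) z0)
     * of_real (exp (- (\<omega>0\<^sup>2 * Re bb * (norm \<tau>)\<^sup>2 / (4 * h\<^sup>2 * (cmod bb)\<^sup>2))))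
     * exp (\<i> * of_real (\<omega>0 * (norm \<tau>)\<^sup>2 / (2 * h) * (1 + \<omega>0 * Im bb / (2 * h * (cmod bb)\<^sup>2))))"
proof (rule m11_gaussian[where b = "coeff_b \<omega>0 \<sigma> (alpha s) z0"])
  show "M z0 \<tau> = gauss (coeff_b \<omega>0 \<sigma> (alpha s) z0) 0 0 (- of_nat DIM('a) * coeff_a (alpha s) z0) \<tau>" for \<tau>
    by (rule M11_solution_eq[OF M z0])
qed (simp_all only: \<omega>0 h Re_coeff_b_pos[OF z0] bb_def frak_b_eq not_False_eq_True)

lemma log_cosh_eq_Ln_alpha:
  assumes "z \<ge> 0" "\<And>t. t \<in> {0..z} \<Longrightarrow> Re (cosh (alpha s * of_real t)) > 0"
  shows "log_cosh (alpha s) z = Ln (cosh (alpha s * of_real z))"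
  by (rule log_cosh_eq_Ln[OF cosh_nonzero assms])

lemma alpha_nonzero: "alpha s \<noteq> 0"
  by (rule \<alpha>_nonzero)

end

section \<open>Expansions for small argument\<close>

lemma norm_exp_Taylor_le:
  fixes w :: complex
  assumes "norm w \<le> 1"
  shows "norm (exp w - (\<Sum>i\<le>n. w ^ i / fact i)) \<le> 3 * norm w ^ Suc n / fact n"
proof -
  have "norm (exp w - (\<Sum>i\<le>n. w ^ i / fact i)) \<le> exp (norm w) * (norm w ^ Suc n) / fact n"
    by (rule Taylor_exp_field)
  also have "\<dots> \<le> 3 * norm w ^ Suc n / fact n"
  proof (intro divide_right_mono mult_right_mono)
    have "exp (norm w) \<le> exp 1" using assms by simp
    also have "\<dots> \<le> 3" by (rule exp_le)
    finally show "exp (norm w) \<le> 3" .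
  qed auto
  finally show ?thesis .
qed

text \<open>\<open>cosh\<close> is the even part of \<open>exp\<close>, so the odd terms of the
  cubic Taylor polynomial cancel and the error is of fourth order. The odd part gives
  \<open>sinh\<close> in the same way, one order higher.\<close>

lemma cosh_approx:
  fixes w :: complex
  assumes "norm w \<le> 1"
  shows "norm (cosh w - 1 - w\<^sup>2 / 2) \<le> norm w ^ 4"
proof -
  define e where "e v = exp v - (\<Sum>i\<le>3. v ^ i / fact i)" for v :: complex
  have e: "norm (e v) \<le> norm v ^ 4" if "norm v \<le> 1" for v
  proof -
    have "norm (e v) \<le> 3 * norm v ^ 4 / 6"
      using norm_exp_Taylor_le[OF that, of 3] by (simp add: e_def fact_numeral)
    also have "\<dots> \<le> norm v ^ 4" by simp
    finally show ?thesis .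
  qed
  have eq: "cosh w - 1 - w\<^sup>2 / 2 = (e w + e (- w)) / 2"
    by (simp add: e_def cosh_field_def atMost_nat_numeral fact_numeral field_simps power2_eq_square power3_eq_cube)
  have "norm (cosh w - 1 - w\<^sup>2 / 2) \<le> (norm (e w) + norm (e (- w))) / 2"
    unfolding eq using norm_triangle_ineq[of "e w" "e (- w)"] by (simp add: norm_divide)
  then show ?thesis using e[of w] e[of "- w"] assms by simp
qed

lemma sinh_approx:
  fixes w :: complex
  assumes "norm w \<le> 1"
  shows "norm (sinh w - w - w ^ 3 / 6) \<le> norm w ^ 5"
proof -
  define e where "e v = exp v - (\<Sum>i\<le>4. v ^ i / fact i)" for v :: complex
  have e: "norm (e v) \<le> norm v ^ 5" if "norm v \<le> 1" for v
  proof -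
    have "norm (e v) \<le> 3 * norm v ^ 5 / 24"
      using norm_exp_Taylor_le[OF that, of 4] by (simp add: e_def fact_numeral)
    also have "\<dots> \<le> norm v ^ 5" by simp
    finally show ?thesis .
  qed
  have eq: "sinh w - w - w ^ 3 / 6 = (e w - e (- w)) / 2"
    by (simp add: e_def sinh_field_def atMost_nat_numeral fact_numeral field_simps power2_eq_square power3_eq_cube)
  have "norm (sinh w - w - w ^ 3 / 6) \<le> (norm (e w) + norm (e (- w))) / 2"
    unfolding eq using norm_triangle_ineq4[of "e w" "e (- w)"] by (simp add: norm_divide)
  then show ?thesis using e[of w] e[of "- w"] assms by simp
qed

text \<open>For \<open>norm w \<le> 1 / 2\<close> the value of \<open>cosh\<close> lies in the disc
  of radius \<open>1 / 4\<close> around \<open>1\<close>, away from zero and from the cut of the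
  principal logarithm.\<close>

lemma cosh_minus_1_le:
  fixes w :: complex
  assumes "norm w \<le> 1 / 2"
  shows "norm (cosh w - 1) \<le> (norm w)\<^sup>2" "norm (cosh w - 1) \<le> 1 / 4" "norm (cosh w) \<ge> 1 / 2" "Re (cosh w) > 0"
proof -
  define r where "r = norm w"
  have r: "0 \<le> r" "r \<le> 1 / 2" using assms by (simp_all add: r_def)
  have r2: "r\<^sup>2 \<le> 1 / 4" using power_mono[OF r(2) r(1), of 2] by (simp add: power2_eq_square)
  have "norm (cosh w - 1) \<le> norm (cosh w - 1 - w\<^sup>2 / 2) + norm (w\<^sup>2 / 2)"
    using norm_triangle_ineq[of "cosh w - 1 - w\<^sup>2 / 2" "w\<^sup>2 / 2"] by simp
  also have "\<dots> \<le> r ^ 4 + r\<^sup>2 / 2"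
    using cosh_approx[of w] assms by (simp add: r_def norm_divide norm_power)
  also have "r ^ 4 = r\<^sup>2 * r\<^sup>2" by (simp add: power2_eq_square power4_eq_xxxx)
  also have "r\<^sup>2 * r\<^sup>2 + r\<^sup>2 / 2 \<le> r\<^sup>2"
    using mult_left_mono[OF r2, of "r\<^sup>2"] zero_le_power2[of r] by linarith
  finally show 1: "norm (cosh w - 1) \<le> (norm w)\<^sup>2" by (simp add: r_def)
  then show 2: "norm (cosh w - 1) \<le> 1 / 4" using r2 by (simp add: r_def)
  show "norm (cosh w) \<ge> 1 / 2"
    using norm_triangle_ineq2[of 1 "1 - cosh w"] 2 by (simp add: norm_minus_commute)
  show "Re (cosh w) > 0"
    using complex_Re_le_cmod[of "1 - cosh w"] 2 by (simp add: norm_minus_commute)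
qed

text \<open>With \<open>u = cosh w - 1 = w\<^sup>2 / 2 + O(w ^ 4)\<close>, both errors
  \<open>Ln (1 + u) - u\<close> and \<open>u - w\<^sup>2 / 2\<close> are of fourth order. The
  constant \<open>5\<close> is generous, shared with the estimate for \<open>tanh\<close>.\<close>

lemma half_Ln_cosh_approx:
  fixes w :: complex
  assumes w: "norm w \<le> 1 / 2"
  shows "norm (Ln (cosh w) / 2 - w\<^sup>2 / 4) \<le> 5 * norm w ^ 4"
proof -
  define u where "u = cosh w - 1"
  have u: "norm u \<le> (norm w)\<^sup>2" "norm u \<le> 1 / 4" unfolding u_def by (rule cosh_minus_1_le[OF w])+
  have "norm (u - Ln (1 + u)) \<le> (norm u)\<^sup>2 / (1 - norm u)"
    using Ln_approx_linear[of u] u by (simp add: norm_minus_commute)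
  also have "\<dots> \<le> (norm u)\<^sup>2 / (1 / 2)"
    by (rule divide_left_mono) (use u in auto)
  also have "\<dots> \<le> 2 * ((norm w)\<^sup>2)\<^sup>2"
    using power_mono[OF u(1) norm_ge_zero, of 2] by simp
  finally have 1: "norm (Ln (1 + u) - u) \<le> 2 * norm w ^ 4"
    by (simp add: norm_minus_commute)
  have 2: "norm (u - w\<^sup>2 / 2) \<le> norm w ^ 4"
    using cosh_approx[of w] w by (simp add: u_def)
  have "Ln (cosh w) / 2 - w\<^sup>2 / 4 = ((Ln (1 + u) - u) + (u - w\<^sup>2 / 2)) / 2"
    by (simp add: u_def)
  also have "norm \<dots> \<le> (norm (Ln (1 + u) - u) + norm (u - w\<^sup>2 / 2)) / 2"
    unfolding norm_divide norm_numeral by (rule divide_right_mono[OF norm_triangle_ineq]) simp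
  also have "\<dots> \<le> (2 * norm w ^ 4 + norm w ^ 4) / 2"
    by (intro divide_right_mono add_mono 1 2) simp
  also have "\<dots> \<le> 5 * norm w ^ 4" by simp
  finally show ?thesis .
qed

text \<open>Instead of dividing power series, \<open>sinh w\<close> is compared with
  \<open>(w - w ^ 3 / 3) * cosh w\<close>. The terms up to third order cancel; the rest is at most
  \<open>1 + 1 / 6 + 4 / 3 = 5 / 2\<close> times \<open>norm w ^ 5\<close>, and dividing by
  \<open>norm (cosh w) \<ge> 1 / 2\<close> doubles this.\<close>

lemma tanh_approx:
  fixes w :: complex
  assumes w: "norm w \<le> 1 / 2"
  shows "norm (tanh w - (w - w ^ 3 / 3)) \<le> 5 * norm w ^ 5"
proof -
  define r where "r = norm w"
  have r: "0 \<le> r" "r \<le> 1" using w by (simp_all add: r_def)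
  have c: "norm (cosh w) \<ge> 1 / 2" by (rule cosh_minus_1_le[OF w])
  then have c0: "cosh w \<noteq> 0" by auto
  define x where "x = sinh w - w - w ^ 3 / 6"
  define y where "y = cosh w - 1 - w\<^sup>2 / 2"
  have x: "norm x \<le> r ^ 5" and y: "norm y \<le> r ^ 4"
    unfolding x_def y_def r_def by (rule sinh_approx cosh_approx, use w in simp)+
  have "sinh w - (w - w ^ 3 / 3) * cosh w = x + w ^ 5 / 6 - (w - w ^ 3 / 3) * y"
    unfolding x_def y_def by (simp add: field_simps power2_eq_square eval_nat_numeral)
  also have "norm \<dots> \<le> norm x + norm (w ^ 5 / 6) + norm ((w - w ^ 3 / 3) * y)"
    by (rule order_trans[OF norm_triangle_ineq4 add_right_mono[OF norm_triangle_ineq]])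
  also have "\<dots> \<le> r ^ 5 + r ^ 5 / 6 + (4 / 3 * r) * r ^ 4"
  proof (intro add_mono x)
    show "norm (w ^ 5 / 6) \<le> r ^ 5 / 6" by (simp add: r_def norm_divide norm_power)
    have "norm (w - w ^ 3 / 3) \<le> r + r ^ 3 / 3"
      using norm_triangle_ineq4[of w "w ^ 3 / 3"] by (simp add: r_def norm_divide norm_power)
    also have "\<dots> \<le> 4 / 3 * r"
      using power_decreasing[of 1 3 r] r by simp
    finally show "norm ((w - w ^ 3 / 3) * y) \<le> (4 / 3 * r) * r ^ 4"
      unfolding norm_mult using y r by (intro mult_mono) auto
  qed
  also have "\<dots> = 5 / 2 * r ^ 5" by (simp add: eval_nat_numeral)
  finally have num: "norm (sinh w - (w - w ^ 3 / 3) * cosh w) \<le> 5 / 2 * r ^ 5" .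
  have "tanh w - (w - w ^ 3 / 3) = (sinh w - (w - w ^ 3 / 3) * cosh w) / cosh w"
    using c0 by (simp add: tanh_def diff_divide_distrib)
  also have "norm \<dots> \<le> (5 / 2 * r ^ 5) / (1 / 2)"
    unfolding norm_divide using num c r by (intro frac_le) auto
  finally show ?thesis by (simp add: r_def)
qed

lemma coeff_expansions:
  assumes \<Omega>: "\<Omega> \<noteq> 0" and \<sigma>: "\<sigma> > 0" and \<omega>0: "\<omega>0 \<noteq> 0" and z0: "z0 > 0"
    and s: "s\<^sup>2 = of_real (\<sigma>\<^sup>2 * \<Omega> / 4)" and small: "cmod (alpha s * of_real z0) < 1 / 2"
  defines "w \<equiv> alpha s * of_real z0" and "k \<equiv> \<omega>0\<^sup>2 * \<sigma>\<^sup>2 * z0 / 8"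
  shows "cmod (coeff_a (alpha s) z0 - w\<^sup>2 / 4) \<le> 5 * cmod w ^ 4"
    and "cmod (coeff_b \<omega>0 \<sigma> (alpha s) z0 - of_real k * (1 - w\<^sup>2 / 3)) \<le> 5 * k * cmod w ^ 4"
proof -
  have w: "norm w \<le> 1 / 2" using small by (simp add: w_def)
  have \<alpha>0: "alpha s \<noteq> 0" by (rule alpha_nonzero[OF \<Omega> \<sigma> \<omega>0 s])
  have w0: "w \<noteq> 0" using \<alpha>0 z0 by (simp add: w_def)
  \<comment> \<open>For \<open>t \<le> z0\<close> the argument \<open>alpha s * t\<close> is no
    larger than \<open>w\<close>, so the path of \<open>cosh\<close> stays in the right half-plane
    and the continuous branch is the principal one.\<close>
  have "log_cosh (alpha s) z0 = Ln (cosh w)"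
    unfolding w_def
  proof (rule log_cosh_eq_Ln_alpha[OF \<Omega> \<sigma> \<omega>0 s])
    fix t assume t: "t \<in> {0..z0}"
    have "norm (alpha s * of_real t) \<le> norm w"
      using t z0 by (simp add: w_def norm_mult mult_left_mono)
    then show "Re (cosh (alpha s * of_real t)) > 0" using w by (intro cosh_minus_1_le) simp
  qed (use z0 in simp)
  then show "cmod (coeff_a (alpha s) z0 - w\<^sup>2 / 4) \<le> 5 * cmod w ^ 4"
    unfolding coeff_a_def using half_Ln_cosh_approx[OF w] by simp
  have k: "k > 0" using \<sigma> \<omega>0 z0 by (simp add: k_def)
  \<comment> \<open>The division by \<open>w\<close> turns the fifth-order error of
    \<open>tanh\<close> into a fourth-order one, relative to \<open>k\<close>.\<close>
  have "coeff_b \<omega>0 \<sigma> (alpha s) z0 = of_real k * (tanh w / w)"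
    unfolding coeff_b_def w_def k_def using \<alpha>0 z0 by (simp add: field_simps)
  moreover have "of_real k * (1 - w\<^sup>2 / 3) = of_real k * ((w - w ^ 3 / 3) / w)"
    using w0 by (simp add: field_simps power2_eq_square power3_eq_cube)
  ultimately have "coeff_b \<omega>0 \<sigma> (alpha s) z0 - of_real k * (1 - w\<^sup>2 / 3)
      = of_real k * ((tanh w - (w - w ^ 3 / 3)) / w)"
    by (simp only: right_diff_distrib[symmetric] diff_divide_distrib)
  also have "norm \<dots> = k * (norm (tanh w - (w - w ^ 3 / 3)) / norm w)"
    using k by (simp add: norm_mult norm_divide)
  also have "\<dots> \<le> k * (5 * norm w ^ 5 / norm w)"
    using k by (intro mult_left_mono divide_right_mono tanh_approx w) auto
  also have "\<dots> = 5 * k * norm w ^ 4" using w0 by (simp add: eval_nat_numeral)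
  finally show "cmod (coeff_b \<omega>0 \<sigma> (alpha s) z0 - of_real k * (1 - w\<^sup>2 / 3)) \<le> 5 * k * cmod w ^ 4" .
qed

lemma square_less_iff_abs: "x\<^sup>2 < y\<^sup>2 \<longleftrightarrow> \<bar>x\<bar> < \<bar>y\<bar>" for x y :: real
  using abs_le_square_iff[of y x] by linarith

section \<open>Maximising the correlation over the axial shift\<close>

context
  fixes \<Omega> \<sigma> \<omega>0 z0 :: real and s :: complex and M :: "real \<Rightarrow> 'a::euclidean_space \<Rightarrow> complex"
  assumes \<Omega>: "\<Omega> \<noteq> 0" and \<sigma>: "\<sigma> > 0" and \<omega>0: "\<omega>0 \<noteq> 0" and z0: "z0 > 0"
    and s: "s\<^sup>2 = of_real (\<sigma>\<^sup>2 * \<Omega> / 4)" and M: "M11_solution \<omega>0 \<sigma> \<Omega> M"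
begin

private abbreviation (input) "b \<equiv> coeff_b \<omega>0 \<sigma> (alpha s) z0"
private abbreviation (input) "corr h \<equiv> cmod (m11 \<omega>0 M z0 h 0)"

definition shift_opt :: real where
  "shift_opt = \<omega>0 * Im b / (2 * (cmod b)\<^sup>2)"

lemma b_nonzero: "b \<noteq> 0"
  using Re_coeff_b_pos[OF \<Omega> \<sigma> \<omega>0 s z0] by auto

text \<open>The polynomial that \<open>\<bar>h \<bb>\<bar>\<^sup>2\<close> becomes after expansion.
  It is defined at \<open>h = 0\<close> too, with value \<open>\<omega>0\<^sup>2 / 4\<close>, which
  is the reference level of the unshifted correlation.\<close>

definition spread :: "real \<Rightarrow> real" where
  "spread h = h\<^sup>2 * (cmod b)\<^sup>2 - \<omega>0 * h * Im b + \<omega>0\<^sup>2 / 4"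

lemma spread_eq: "h \<noteq> 0 \<Longrightarrow> spread h = (h * cmod (frak_b \<omega>0 \<sigma> (alpha s) z0 h))\<^sup>2"
  unfolding spread_def frak_b_def power_mult_distrib cmod_power2
  by (simp add: field_simps power2_eq_square)

lemma spread_pos: "h \<noteq> 0 \<Longrightarrow> spread h > 0"
proof -
  assume h: "h \<noteq> 0"
  have "frak_b \<omega>0 \<sigma> (alpha s) z0 h \<noteq> 0"
    using Re_coeff_b_pos[OF \<Omega> \<sigma> \<omega>0 s z0] by (auto simp: frak_b_def complex_eq_iff)
  then show ?thesis using h by (simp add: spread_eq)
qed

text \<open>At \<open>\<tau> = 0\<close> both exponentials in \<open>\<tau>\<close> are
  \<open>1\<close>, and the remaining exponential is \<open>M z0 0\<close>; only the modulus of the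
  prefactor depends on \<open>h\<close>.\<close>

lemma corr_eq:
  assumes h: "h \<noteq> 0"
  shows "corr h = sqrt (\<bar>\<omega>0\<bar> / (2 * sqrt (spread h))) ^ DIM('a) * cmod (M z0 0)"
proof -
  let ?bb = "frak_b \<omega>0 \<sigma> (alpha s) z0 h"
  have bb: "?bb \<noteq> 0" using spread_pos[OF h] h by (auto simp: spread_eq)
  have nz: "of_real \<omega>0 / (2 * \<i> * of_real h * ?bb) \<noteq> 0" using \<omega>0 h bb by simp
  have M0: "M z0 0 = exp (- of_nat DIM('a) * coeff_a (alpha s) z0)"
    unfolding M11_solution_eq[OF \<Omega> \<sigma> \<omega>0 s M z0] gauss_def by simp
  have "m11 \<omega>0 M z0 h 0 = csqrt (of_real \<omega>0 / (2 * \<i> * of_real h * ?bb)) ^ DIM('a) * M z0 0"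
    unfolding m11_formula[OF \<Omega> \<sigma> \<omega>0 s M z0 h] powr_half_nat[OF nz] M0 by simp
  then have "corr h = sqrt (cmod (of_real \<omega>0 / (2 * \<i> * of_real h * ?bb))) ^ DIM('a) * cmod (M z0 0)"
    by (simp only: norm_mult norm_power norm_csqrt)
  also have "cmod (of_real \<omega>0 / (2 * \<i> * of_real h * ?bb)) = \<bar>\<omega>0\<bar> / (2 * sqrt (spread h))"
    unfolding spread_eq[OF h] by (simp add: norm_divide norm_mult abs_mult)
  finally show ?thesis .
qed

lemma M_nonzero: "cmod (M z0 0) > 0"
  unfolding M11_solution_eq[OF \<Omega> \<sigma> \<omega>0 s M z0] gauss_def by simp

lemma corr_less:
  assumes "h \<noteq> 0" "h' \<noteq> 0" "spread h' < spread h"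
  shows "corr h < corr h'"
proof -
  have "\<bar>\<omega>0\<bar> / (2 * sqrt (spread h)) < \<bar>\<omega>0\<bar> / (2 * sqrt (spread h'))"
    using assms spread_pos[of h] spread_pos[of h'] \<omega>0 by (intro divide_strict_left_mono) auto
  then have "sqrt (\<bar>\<omega>0\<bar> / (2 * sqrt (spread h))) ^ DIM('a) < sqrt (\<bar>\<omega>0\<bar> / (2 * sqrt (spread h'))) ^ DIM('a)"
    using spread_pos[OF assms(1)] by (intro power_strict_mono) auto
  then show ?thesis
    unfolding corr_eq[OF assms(1)] corr_eq[OF assms(2)] using M_nonzero by simp
qed

text \<open>When \<open>spread h\<close> equals \<open>\<omega>0\<^sup>2 / 4\<close>, its value at
  \<open>h = 0\<close>, the prefactor has modulus \<open>1\<close>; a smaller spread makes it exceed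
  \<open>1\<close>. In this sense \<open>M z0 0\<close> stands for the correlation without
  shift.\<close>

lemma corr_gt_unshifted:
  assumes "h \<noteq> 0" "spread h < \<omega>0\<^sup>2 / 4"
  shows "cmod (M z0 0) < corr h"
proof -
  have "sqrt (spread h) < sqrt ((\<bar>\<omega>0\<bar> / 2)\<^sup>2)"
    using assms(2) by (simp add: power_divide)
  then have "2 * sqrt (spread h) < \<bar>\<omega>0\<bar>" by simp
  then have "1 < sqrt (\<bar>\<omega>0\<bar> / (2 * sqrt (spread h)))"
    using spread_pos[OF assms(1)] by simp
  then have "1 < sqrt (\<bar>\<omega>0\<bar> / (2 * sqrt (spread h))) ^ DIM('a)"
    by (intro one_less_power) auto
  then show ?thesis unfolding corr_eq[OF assms(1)] using M_nonzero by simp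
qed

lemma spread_square: "spread h = (cmod b)\<^sup>2 * (h - shift_opt)\<^sup>2 + (\<omega>0\<^sup>2 / 4 - (cmod b)\<^sup>2 * shift_opt\<^sup>2)"
proof -
  have "(cmod b)\<^sup>2 * shift_opt = \<omega>0 * Im b / 2" using b_nonzero by (simp add: shift_opt_def)
  then have "\<omega>0 * Im b = 2 * ((cmod b)\<^sup>2 * shift_opt)" by simp
  then have "\<omega>0 * h * Im b = 2 * ((cmod b)\<^sup>2 * shift_opt) * h"
    by (metis mult.assoc mult.commute)
  then show ?thesis unfolding spread_def \<open>\<omega>0 * h * Im b = _\<close> by (simp add: power2_diff algebra_simps power2_eq_square)
qed

text \<open>A parabola with vertex \<open>shift_opt\<close>: comparing correlations amounts to
  comparing distances to the vertex.\<close>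

lemma spread_less_iff: "spread h < spread h' \<longleftrightarrow> \<bar>h - shift_opt\<bar> < \<bar>h' - shift_opt\<bar>"
  using b_nonzero unfolding spread_square by (simp add: square_less_iff_abs)

lemma spread_less_unshifted_iff: "spread h < \<omega>0\<^sup>2 / 4 \<longleftrightarrow> \<bar>h - shift_opt\<bar> < \<bar>shift_opt\<bar>"
proof -
  have "spread h < \<omega>0\<^sup>2 / 4 \<longleftrightarrow> (cmod b)\<^sup>2 * (h - shift_opt)\<^sup>2 < (cmod b)\<^sup>2 * shift_opt\<^sup>2"
    unfolding spread_square by linarith
  also have "\<dots> \<longleftrightarrow> (h - shift_opt)\<^sup>2 < shift_opt\<^sup>2" using b_nonzero by simp
  finally show ?thesis by (simp add: square_less_iff_abs)
qed

text \<open>Writing \<open>b = k (1 + \<eta>)\<close> with \<open>\<eta> = - w\<^sup>2 / 3 + O(w\<^sup>4)\<close> and \<open>w\<^sup>2 = \<i> \<nu>\<close>, the optimal shift is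
  \<open>\<omega>\<^sub>0 / (2 k) * Im \<eta> / \<bar>1 + \<eta>\<bar>\<^sup>2\<close>, and \<open>\<omega>\<^sub>0 / (2 k) * (- \<nu> / 3) = - z\<^sub>0 \<Omega> / (3 \<omega>\<^sub>0)\<close>.\<close>

lemma shift_opt_approx:
  assumes small: "cmod (alpha s * of_real z0) \<le> \<delta>" and \<delta>: "\<delta> \<le> 1 / 4"
  defines "h0 \<equiv> - (z0 * \<Omega> / (3 * \<omega>0))"
  shows "\<bar>shift_opt - h0\<bar> \<le> 40 * \<delta>\<^sup>2 * \<bar>h0\<bar>"
proof -
  define w where "w = alpha s * of_real z0"
  define k where "k = \<omega>0\<^sup>2 * \<sigma>\<^sup>2 * z0 / 8"
  define \<nu> where "\<nu> = \<sigma>\<^sup>2 * \<Omega> * z0\<^sup>2 / 4"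
  have w2: "w\<^sup>2 = \<i> * of_real \<nu>"
    unfolding w_def power_mult_distrib alpha_square s \<nu>_def by simp
  define r where "r = \<bar>\<nu>\<bar>"
  have r: "r = (cmod w)\<^sup>2" unfolding r_def using arg_cong[OF w2, of cmod] by (simp add: norm_mult norm_power)
  have r0: "r > 0" using \<sigma> \<Omega> z0 by (simp add: r_def \<nu>_def)
  have rd: "r \<le> \<delta>\<^sup>2" unfolding r using small by (intro power_mono) (auto simp: w_def)
  have d0: "0 \<le> \<delta>" using small norm_ge_zero order_trans by blast
  have "\<delta>\<^sup>2 \<le> (1 / 4)\<^sup>2" using \<delta> d0 by (rule power_mono)
  then have r16: "r \<le> 1 / 16" using rd by (simp add: power2_eq_square)
  have k0: "k > 0" using \<sigma> \<omega>0 z0 by (simp add: k_def)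
  define \<eta> where "\<eta> = b / of_real k - 1"
  have b: "b = of_real k * (1 + \<eta>)" using k0 by (simp add: \<eta>_def)
  define e where "e = \<eta> + w\<^sup>2 / 3"
  have "cmod (b - of_real k * (1 - w\<^sup>2 / 3)) \<le> 5 * k * cmod w ^ 4"
    unfolding w_def k_def
    by (rule coeff_expansions(2)[OF \<Omega> \<sigma> \<omega>0 z0 s]) (use small \<delta> in linarith)
  also have "b - of_real k * (1 - w\<^sup>2 / 3) = of_real k * e" by (simp add: b e_def algebra_simps)
  finally have "cmod e \<le> 5 * cmod w ^ 4" using k0 by (simp add: norm_mult)
  also have "cmod w ^ 4 = r\<^sup>2" by (simp add: r)
  finally have e: "cmod e \<le> 5 * r\<^sup>2" .
  have rr: "r\<^sup>2 \<le> r / 16" using mult_left_mono[OF r16, of r] r0 by (simp add: power2_eq_square)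
  have "\<eta> = e - w\<^sup>2 / 3" by (simp add: e_def)
  then have Im\<eta>: "Im \<eta> = Im e - \<nu> / 3" by (simp add: w2)
  have "cmod \<eta> \<le> cmod e + cmod (w\<^sup>2 / 3)" unfolding \<open>\<eta> = e - w\<^sup>2 / 3\<close> by (rule norm_triangle_ineq4)
  also have "cmod (w\<^sup>2 / 3) = r / 3" by (simp add: norm_divide norm_power r)
  finally have \<eta>: "cmod \<eta> \<le> r" using e rr r0 by linarith
  define P where "P = (cmod (1 + \<eta>))\<^sup>2"
  have "\<bar>cmod (1 + \<eta>) - 1\<bar> \<le> cmod \<eta>"
    using norm_triangle_ineq3[of "1 + \<eta>" 1] by simp
  then have n: "\<bar>cmod (1 + \<eta>) - 1\<bar> \<le> r" using \<eta> by linarith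
  have "P - 1 = (cmod (1 + \<eta>) - 1) * (cmod (1 + \<eta>) + 1)"
    by (simp add: P_def power2_eq_square algebra_simps)
  then have "\<bar>P - 1\<bar> = \<bar>cmod (1 + \<eta>) - 1\<bar> * (cmod (1 + \<eta>) + 1)" by (simp add: abs_mult)
  also have "\<dots> \<le> r * 3"
    using n r16 by (intro mult_mono) auto
  finally have P: "\<bar>P - 1\<bar> \<le> 3 * r" by simp
  \<comment> \<open>\<open>P\<close> is the denominator of the optimal shift after scaling; bounded
    below, it affects the relative error only at order \<open>r\<close>.\<close>
  have P2: "P \<ge> 1 / 2" using P r16 by linarith
  define q where "q = \<omega>0 / (2 * k)"
  have h0: "h0 = q * (- \<nu> / 3)"
    using \<sigma> \<omega>0 z0 by (simp add: h0_def q_def \<nu>_def k_def field_simps power2_eq_square)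
  have h1: "shift_opt = q * (Im \<eta> / P)"
    using k0 unfolding shift_opt_def b P_def q_def by (simp add: norm_mult power_mult_distrib power2_eq_square)
  have "shift_opt - h0 = q * ((Im e - \<nu> / 3 + P * \<nu> / 3) / P)"
    unfolding h0 h1 Im\<eta> using P2 by (simp add: field_simps)
  also have "Im e - \<nu> / 3 + P * \<nu> / 3 = Im e + (P - 1) * (\<nu> / 3)" by (simp add: field_simps)
  finally have d: "\<bar>shift_opt - h0\<bar> = \<bar>q\<bar> * (\<bar>Im e + (P - 1) * (\<nu> / 3)\<bar> / P)"
    using P2 by (simp add: abs_mult)
  have "\<bar>Im e + (P - 1) * (\<nu> / 3)\<bar> \<le> \<bar>Im e\<bar> + \<bar>P - 1\<bar> * (r / 3)"
    using abs_triangle_ineq[of "Im e" "(P - 1) * (\<nu> / 3)"] by (simp add: abs_mult r_def)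
  also have "\<dots> \<le> 5 * r\<^sup>2 + (3 * r) * (r / 3)"
    using abs_Im_le_cmod[of e] e P r0 by (intro add_mono mult_right_mono) auto
  also have "\<dots> = 6 * r\<^sup>2" by (simp add: power2_eq_square)
  finally have "\<bar>Im e + (P - 1) * (\<nu> / 3)\<bar> / P \<le> 6 * r\<^sup>2 / (1 / 2)"
    using P2 by (intro frac_le) auto
  then have "\<bar>shift_opt - h0\<bar> \<le> \<bar>q\<bar> * (12 * r\<^sup>2)"
    unfolding d by (intro mult_left_mono) auto
  \<comment> \<open>Since \<open>\<bar>h0\<bar> = \<bar>q\<bar> * r / 3\<close>, one power of
    \<open>r\<close> is absorbed by \<open>h0\<close> and the other is the relative error;
    \<open>40\<close> rounds up \<open>36\<close>.\<close>
  also have "\<dots> = 36 * r * \<bar>h0\<bar>" by (simp add: h0 abs_mult r_def power2_eq_square)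
  also have "\<dots> \<le> 40 * \<delta>\<^sup>2 * \<bar>h0\<bar>"
    using rd r0 by (intro mult_right_mono) auto
  finally show ?thesis .
qed

text \<open>With \<open>\<delta> = min \<epsilon> 1 / 80\<close> the quadratic estimate gives
  \<open>\<bar>shift_opt - h0\<bar> \<le> \<delta> * \<bar>h0\<bar>\<close>. As
  \<open>\<delta>\<close> is much smaller than \<open>\<epsilon>\<close> and than \<open>1\<close>,
  a shift \<open>h\<close> at distance at least \<open>\<epsilon> * \<bar>h0\<bar>\<close> from
  \<open>h0\<close> is farther from the vertex than \<open>h0\<close> is, and so is the shift
  \<open>0\<close>.\<close>

lemma optimal_shift:
  assumes \<epsilon>: "\<epsilon> > 0" and small: "cmod (alpha s * of_real z0) \<le> min \<epsilon> 1 / 80"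
  defines "h0 \<equiv> - (z0 * \<Omega> / (3 * \<omega>0))"
  shows "(\<exists>h1. strict_max_shift corr h1 \<and> \<bar>h1 - h0\<bar> \<le> \<epsilon> * \<bar>h0\<bar>) \<and>
    (\<forall>h. h \<noteq> 0 \<longrightarrow> \<bar>h - h0\<bar> \<ge> \<epsilon> * \<bar>h0\<bar> \<longrightarrow> corr h < corr h0) \<and>
    cmod (M z0 0) < corr h0"
proof -
  define \<delta> where "\<delta> = min \<epsilon> 1 / 80"
  have \<delta>: "0 < \<delta>" "\<delta> \<le> 1 / 80" "80 * \<delta> \<le> \<epsilon>" "80 * \<delta> \<le> 1" using \<epsilon> by (auto simp: \<delta>_def)
  have h0: "h0 \<noteq> 0" using z0 \<Omega> \<omega>0 by (simp add: h0_def)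
  have "\<bar>shift_opt - h0\<bar> \<le> 40 * \<delta>\<^sup>2 * \<bar>h0\<bar>"
    unfolding h0_def by (rule shift_opt_approx) (use small \<delta> in \<open>auto simp: \<delta>_def\<close>)
  also have "\<dots> \<le> \<delta> * \<bar>h0\<bar>"
    using \<delta> by (intro mult_right_mono) (auto simp: power2_eq_square)
  finally have close: "\<bar>shift_opt - h0\<bar> \<le> \<delta> * \<bar>h0\<bar>" .
  have pos: "\<delta> * \<bar>h0\<bar> > 0" using \<delta> h0 by simp
  have eps: "80 * (\<delta> * \<bar>h0\<bar>) \<le> \<epsilon> * \<bar>h0\<bar>" and one: "80 * (\<delta> * \<bar>h0\<bar>) \<le> \<bar>h0\<bar>"
    using mult_right_mono[OF \<delta>(3), of "\<bar>h0\<bar>"] mult_right_mono[OF \<delta>(4), of "\<bar>h0\<bar>"] by simp_all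
  have h1: "shift_opt \<noteq> 0" using close one pos by auto
  have "strict_max_shift corr shift_opt"
    unfolding strict_max_shift_def using h1 by (auto intro!: corr_less simp: spread_less_iff)
  moreover have "\<bar>shift_opt - h0\<bar> \<le> \<epsilon> * \<bar>h0\<bar>" using close eps pos by linarith
  moreover have "corr h < corr h0" if "h \<noteq> 0" "\<bar>h - h0\<bar> \<ge> \<epsilon> * \<bar>h0\<bar>" for h
  proof (rule corr_less[OF that(1) h0])
    show "spread h0 < spread h"
      unfolding spread_less_iff using that(2) close eps pos by linarith
  qed
  moreover have "cmod (M z0 0) < corr h0"
  proof (rule corr_gt_unshifted[OF h0])
    show "spread h0 < \<omega>0\<^sup>2 / 4"
      unfolding spread_less_unshifted_iff using close one pos by linarith
  qed
  ultimately show ?thesis by blast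
qed

end

theorem theorem2p5:
  fixes \<Omega> :: real
  assumes \<Omega>_nonzero: "\<Omega> \<noteq> 0"
  shows
   "(\<forall>\<sigma> \<omega>0. \<sigma> > 0 \<longrightarrow> \<omega>0 \<noteq> 0 \<longrightarrow>
       (\<exists>M :: real \<Rightarrow> 'a::euclidean_space \<Rightarrow> complex. M11_solution \<omega>0 \<sigma> \<Omega> M) \<and>
       (\<forall>(M :: real \<Rightarrow> 'a \<Rightarrow> complex) s.
          M11_solution \<omega>0 \<sigma> \<Omega> M \<longrightarrow> s\<^sup>2 = of_real (\<sigma>\<^sup>2 * \<Omega> / 4) \<longrightarrow>
          (\<forall>z0 h \<tau>. z0 > 0 \<longrightarrow> h \<noteq> 0 \<longrightarrow>
             (let \<alpha> = alpha s; bb = frak_b \<omega>0 \<sigma> \<alpha> z0 h in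
              m11 \<omega>0 M z0 h \<tau> =
                (of_real \<omega>0 / (2 * \<i> * of_real h * bb)) powr (of_nat DIM('a) / 2)
                * exp (- of_nat DIM('a) * coeff_a \<alpha> z0)
                * of_real (exp (- (\<omega>0\<^sup>2 * Re bb * (norm \<tau>)\<^sup>2 / (4 * h\<^sup>2 * (cmod bb)\<^sup>2))))
                * exp (\<i> * of_real (\<omega>0 * (norm \<tau>)\<^sup>2 / (2 * h)
                          * (1 + \<omega>0 * Im bb / (2 * h * (cmod bb)\<^sup>2))))))))
    \<and>
    (\<exists>C>0. \<exists>\<delta>>0. \<forall>\<sigma> \<omega>0 z0 s.
       \<sigma> > 0 \<longrightarrow> \<omega>0 \<noteq> 0 \<longrightarrow> z0 > 0 \<longrightarrow> s\<^sup>2 = of_real (\<sigma>\<^sup>2 * \<Omega> / 4) \<longrightarrow>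
       cmod (alpha s * of_real z0) < \<delta> \<longrightarrow>
       (let \<alpha> = alpha s; w = \<alpha> * of_real z0; k = \<omega>0\<^sup>2 * \<sigma>\<^sup>2 * z0 / 8 in
          cmod (coeff_a \<alpha> z0 - w\<^sup>2 / 4) \<le> C * cmod w ^ 4 \<and>
          cmod (coeff_b \<omega>0 \<sigma> \<alpha> z0 - of_real k * (1 - w\<^sup>2 / 3)) \<le> C * k * cmod w ^ 4))
    \<and>
    (\<forall>\<epsilon>>0. \<exists>\<delta>>0. \<forall>\<sigma> \<omega>0 z0 s (M :: real \<Rightarrow> 'a \<Rightarrow> complex).
       \<sigma> > 0 \<longrightarrow> \<omega>0 \<noteq> 0 \<longrightarrow> z0 > 0 \<longrightarrow> s\<^sup>2 = of_real (\<sigma>\<^sup>2 * \<Omega> / 4) \<longrightarrow>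
       M11_solution \<omega>0 \<sigma> \<Omega> M \<longrightarrow> cmod (alpha s * of_real z0) < \<delta> \<longrightarrow>
       (let h0 = - (z0 * \<Omega> / (3 * \<omega>0)); corr = (\<lambda>h. cmod (m11 \<omega>0 M z0 h 0)) in
          (\<exists>h1. strict_max_shift corr h1 \<and> \<bar>h1 - h0\<bar> \<le> \<epsilon> * \<bar>h0\<bar>) \<and>
          (\<forall>h. h \<noteq> 0 \<longrightarrow> \<bar>h - h0\<bar> \<ge> \<epsilon> * \<bar>h0\<bar> \<longrightarrow> corr h < corr h0) \<and>
          cmod (M z0 0) < corr h0))"
  unfolding Let_def
proof (intro conjI, goal_cases)
  case 1
  \<comment> \<open>Existence mentions no root \<open>s\<close>, yet the explicit solution is built
    from one; \<open>power2_csqrt\<close> supplies the principal root.\<close>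
  show ?case
    by (intro allI impI conjI)
      (rule M11_solution_exists[OF \<Omega>_nonzero _ _ power2_csqrt] m11_formula[OF \<Omega>_nonzero]; assumption)+
next
  case 2
  show ?case
    by (rule exI[of _ 5], rule conjI, simp, rule exI[of _ "1 / 2"], rule conjI, simp, intro allI impI conjI)
      (rule coeff_expansions[OF \<Omega>_nonzero]; assumption)+
next
  case 3
  show ?case
    by (rule allI, rule impI, rule_tac x = "min \<epsilon> 1 / 80" in exI, rule conjI, simp, intro allI impI,
        rule optimal_shift[OF \<Omega>_nonzero]) (assumption | erule less_imp_le)+
qed

end
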